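(* Let $K$ be a relatively closed subset of the bidisc $\Delta^2=\{(z,w)\in\mathbb{C}^2 : |z|<1,\ |w|<1\}$ which is a disjoint union of holomorphic graphs $w=f_\alpha(z)$, where each $f_\alpha$ is a holomorphic function on the unit disc $\Delta$ with $f_\alpha(0)=\alpha$ and $|f_\alpha(z)|<1$ for all $z\in\Delta$. Let $\mathcal{L}$ denote the lamination of $K$ by these graphs. Let $T$ be a positive closed $(1,1)$ current on $\Delta^2$ supported on $K$, and assume that $T$ is the restriction of a positive closed current defined on a neighborhood of $\overline{\Delta}^2$. Then $T$ is directed by $\mathcal{L}$ if and only if $T$ is weakly directed by $\mathcal{L}$.
   Context: $\Delta$ is the open unit disc in $\mathbb{C}$. The index $\alpha$ ranges over the set $\{\alpha\in\Delta : (0,\alpha)\in K\}$; distinct graphs are disjoint and their union is $K$. $[V_\alpha]$ denotes the current of integration along the graph $V_\alpha=\{(z,f_\alpha(z)) : z\in\Delta\}$. Weakly directed: $T$ is weakly directed by $\mathcal{L}$ if $\lambda\wedge T=0$ for every continuous $(1,0)$ form $\lambda$ which at each point $(z,f_\alpha(z))$ of $K$ equals a nonzero multiple of $dw-f_\alpha'(z)\,dz$. (The product $\lambda\wedge T$ makes sense because a positive current has measure coefficients, here supported on $K$.) Directed: $T$ is directed by $\mathcal{L}$ if there is a positive measure $\mu$ on the set of indices $\alpha$ such that $T=\int_\alpha [V_\alpha]\,d\mu(\alpha)$. *)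

theory Defs
  imports "HOL-Complex_Analysis.Complex_Analysis"
begin

section \<open>Smooth functions with compact support\<close>

text \<open>Iterated directional derivatives, along an arbitrary list of directions.\<close>

primrec iter_deriv ::
  "'a::real_normed_vector list \<Rightarrow> ('a \<Rightarrow> 'b::real_normed_vector) \<Rightarrow> 'a \<Rightarrow> 'b" where
  "iter_deriv [] f = f"
| "iter_deriv (v # vs) f = (\<lambda>x. frechet_derivative (iter_deriv vs f) (at x) v)"

definition smooth :: "('a::euclidean_space \<Rightarrow> 'b::real_normed_vector) \<Rightarrow> bool" where
  "smooth f \<longleftrightarrow> (\<forall>vs. iter_deriv vs f differentiable_on UNIV)"

definition supp :: "('a::topological_space \<Rightarrow> 'b::zero) \<Rightarrow> 'a set" where
  "supp f = closure {x. f x \<noteq> 0}"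

text \<open>Functions with compact support in the open set \<open>U\<close> are extended by zero to the whole
  space, so smoothness on the whole space is smoothness on \<open>U\<close>.\<close>

definition test_on :: "'a::euclidean_space set \<Rightarrow> ('a \<Rightarrow> 'b::real_normed_vector) \<Rightarrow> bool" where
  "test_on U \<phi> \<longleftrightarrow> smooth \<phi> \<and> compact (supp \<phi>) \<and> supp \<phi> \<subseteq> U"


section \<open>Forms on open subsets of \<open>\<complex>\<^sup>2\<close>\<close>

text \<open>
  The coordinates \<open>z\<^sub>1 = z\<close> and \<open>z\<^sub>2 = w\<close> are indexed by the type \<open>2\<close>.

  A function \<open>\<phi>\<close> of type \<open>form11\<close> stands for the \<open>(1,1)\<close> form
  \<open>\<Sum>j k. \<phi>\<^sub>j\<^sub>k (\<i>/2) dz\<^sub>j \<and> d(cnj z\<^sub>k)\<close>; the factor \<open>\<i>/2\<close> makes \<open>(\<i>/2) dz \<and> d(cnj z)\<close> the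
  Lebesgue area form.  A function \<open>a\<close> of type \<open>coform\<close> stands for the \<open>(1,0)\<close> form
  \<open>\<Sum>j. a\<^sub>j dz\<^sub>j\<close> or for the \<open>(0,1)\<close> form \<open>\<Sum>k. a\<^sub>k d(cnj z\<^sub>k)\<close>, according to context.
\<close>

type_synonym form11 = "complex \<times> complex \<Rightarrow> complex^2^2"
type_synonym coform = "complex \<times> complex \<Rightarrow> complex^2"

definition along :: "2 \<Rightarrow> complex \<Rightarrow> complex \<times> complex" where
  "along j c = (if j = 1 then (c, 0) else (0, c))"

definition d_z :: "2 \<Rightarrow> (complex \<times> complex \<Rightarrow> complex) \<Rightarrow> complex \<times> complex \<Rightarrow> complex" where
  "d_z j g p = (frechet_derivative g (at p) (along j 1)
                 - \<i> * frechet_derivative g (at p) (along j \<i>)) / 2"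

definition d_zbar :: "2 \<Rightarrow> (complex \<times> complex \<Rightarrow> complex) \<Rightarrow> complex \<times> complex \<Rightarrow> complex" where
  "d_zbar j g p = (frechet_derivative g (at p) (along j 1)
                    + \<i> * frechet_derivative g (at p) (along j \<i>)) / 2"

text \<open>The wedge product of a \<open>(1,0)\<close> form and a \<open>(0,1)\<close> form;
  note \<open>dz\<^sub>j \<and> d(cnj z\<^sub>k) = -2\<i> \<cdot> (\<i>/2) dz\<^sub>j \<and> d(cnj z\<^sub>k)\<close>.\<close>

definition wedge :: "coform \<Rightarrow> coform \<Rightarrow> form11" where
  "wedge a b = (\<lambda>p. \<chi> j k. - 2 * \<i> * (a p $ j * b p $ k))"

text \<open>The \<open>(1,1)\<close> component of the exterior derivative of the 1-form
  \<open>\<Sum>j. a\<^sub>j dz\<^sub>j + \<Sum>k. b\<^sub>k d(cnj z\<^sub>k)\<close>.\<close>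

definition ext_deriv11 :: "coform \<Rightarrow> coform \<Rightarrow> form11" where
  "ext_deriv11 a b =
     (\<lambda>p. \<chi> j k. - 2 * \<i> * (d_z j (\<lambda>q. b q $ k) p - d_zbar k (\<lambda>q. a q $ j) p))"

text \<open>A \<open>(1,1)\<close> form is positive if it restricts to a nonnegative area form on every
  complex line.\<close>

definition positive_form :: "form11 \<Rightarrow> bool" where
  "positive_form \<phi> \<longleftrightarrow>
     (\<forall>p. \<forall>v::complex^2. (\<Sum>j\<in>UNIV. \<Sum>k\<in>UNIV. \<phi> p $ j $ k * (v $ j * cnj (v $ k))) \<in> \<real>\<^sub>\<ge>\<^sub>0)"


section \<open>Currents of bidegree \<open>(1,1)\<close>\<close>

text \<open>A current on \<open>U\<close> is a linear functional on the smooth \<open>(1,1)\<close> forms with compact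
  support in \<open>U\<close>, sequentially continuous for the usual topology of test forms.  Its values on
  other functions carry no meaning.\<close>

type_synonym current11 = "form11 \<Rightarrow> complex"

definition current :: "(complex \<times> complex) set \<Rightarrow> current11 \<Rightarrow> bool" where
  "current U T \<longleftrightarrow>
     (\<forall>\<phi> \<psi>. test_on U \<phi> \<longrightarrow> test_on U \<psi> \<longrightarrow> T (\<lambda>p. \<phi> p + \<psi> p) = T \<phi> + T \<psi>) \<and>
     (\<forall>c \<phi>. test_on U \<phi> \<longrightarrow> T (\<lambda>p. \<chi> j k. c * \<phi> p $ j $ k) = c * T \<phi>) \<and>
     (\<forall>\<phi> C. (\<forall>n::nat. test_on U (\<phi> n) \<and> supp (\<phi> n) \<subseteq> C) \<longrightarrow> compact C \<longrightarrow> C \<subseteq> U \<longrightarrow>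
        (\<forall>vs. uniform_limit UNIV (\<lambda>n. iter_deriv vs (\<phi> n)) (\<lambda>_. 0) sequentially) \<longrightarrow>
        (\<lambda>n. T (\<phi> n)) \<longlonglongrightarrow> 0)"

definition positive_current :: "(complex \<times> complex) set \<Rightarrow> current11 \<Rightarrow> bool" where
  "positive_current U T \<longleftrightarrow>
     current U T \<and> (\<forall>\<phi>. test_on U \<phi> \<longrightarrow> positive_form \<phi> \<longrightarrow> T \<phi> \<in> \<real>\<^sub>\<ge>\<^sub>0)"

text \<open>\<open>dT = 0\<close>; a current of bidegree \<open>(1,1)\<close> annihilates the \<open>(2,0)\<close> and \<open>(0,2)\<close>
  components of the derivative of a test 1-form.\<close>

definition closed_current :: "(complex \<times> complex) set \<Rightarrow> current11 \<Rightarrow> bool" where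
  "closed_current U T \<longleftrightarrow> (\<forall>a b. test_on U a \<longrightarrow> test_on U b \<longrightarrow> T (ext_deriv11 a b) = 0)"

text \<open>For \<open>K\<close> relatively closed in \<open>U\<close>: \<open>T\<close> vanishes on the open set \<open>U - K\<close>.\<close>

definition supported_on ::
  "(complex \<times> complex) set \<Rightarrow> current11 \<Rightarrow> (complex \<times> complex) set \<Rightarrow> bool" where
  "supported_on U T K \<longleftrightarrow> (\<forall>\<phi>. test_on (U - K) \<phi> \<longrightarrow> T \<phi> = 0)"

definition equal_on :: "(complex \<times> complex) set \<Rightarrow> current11 \<Rightarrow> current11 \<Rightarrow> bool" where
  "equal_on U T S \<longleftrightarrow> (\<forall>\<phi>. test_on U \<phi> \<longrightarrow> T \<phi> = S \<phi>)"

text \<open>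
  A positive current has measure coefficients, i.e. it has order zero: on test forms with
  support in a fixed compact set it is continuous for uniform convergence.  So it extends uniquely to
  continuous forms with compact support in \<open>U\<close>, integration against the coefficient measures
  being the extension.  Its value at \<open>\<phi>\<close> is the common limit along all approximations
  of \<open>\<phi>\<close> by test forms.
\<close>

definition approximates ::
  "(complex \<times> complex) set \<Rightarrow> (nat \<Rightarrow> form11) \<Rightarrow> form11 \<Rightarrow> bool" where
  "approximates U \<psi> \<phi> \<longleftrightarrow>
     (\<exists>C. compact C \<and> C \<subseteq> U \<and> (\<forall>n. test_on U (\<psi> n) \<and> supp (\<psi> n) \<subseteq> C)) \<and>
     uniform_limit UNIV \<psi> \<phi> sequentially"

definition cont_ext :: "(complex \<times> complex) set \<Rightarrow> current11 \<Rightarrow> current11" where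
  "cont_ext U T \<phi> = (THE c. \<forall>\<psi>. approximates U \<psi> \<phi> \<longrightarrow> (\<lambda>n. T (\<psi> n)) \<longlonglongrightarrow> c)"

text \<open>The \<open>(2,1)\<close> current \<open>\<lambda> \<and> T\<close>, for a continuous \<open>(1,0)\<close> form \<open>\<lambda>\<close> and a positive current
  \<open>T\<close>, as a functional on \<open>(0,1)\<close> test forms.\<close>

definition wedge_current ::
  "(complex \<times> complex) set \<Rightarrow> coform \<Rightarrow> current11 \<Rightarrow> coform \<Rightarrow> complex" where
  "wedge_current U l T b = cont_ext U T (wedge l b)"

text \<open>The pairing of the current of integration along the graph of a holomorphic function
  \<open>g\<close> on the unit disc with a form; \<open>(1, g'(z))\<close> is the velocity of \<open>z \<mapsto> (z, g z)\<close>.\<close>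

definition graph_current :: "(complex \<Rightarrow> complex) \<Rightarrow> current11" where
  "graph_current g \<phi> =
     set_lebesgue_integral lborel (ball 0 1)
       (\<lambda>z. let v = vector [1, deriv g z] :: complex^2
            in \<Sum>j\<in>UNIV. \<Sum>k\<in>UNIV. \<phi> (z, g z) $ j $ k * (v $ j * cnj (v $ k)))"


section \<open>Laminations of subsets of the bidisc by graphs\<close>

definition bidisc :: "(complex \<times> complex) set" where
  "bidisc = ball 0 1 \<times> ball 0 1"

definition graph :: "(complex \<Rightarrow> complex) \<Rightarrow> (complex \<times> complex) set" where
  "graph g = (\<lambda>z. (z, g z)) ` ball 0 1"

definition indices :: "(complex \<times> complex) set \<Rightarrow> complex set" where
  "indices K = {\<alpha> \<in> ball 0 1. (0, \<alpha>) \<in> K}"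

definition laminated_by ::
  "(complex \<times> complex) set \<Rightarrow> (complex \<Rightarrow> complex \<Rightarrow> complex) \<Rightarrow> bool" where
  "laminated_by K f \<longleftrightarrow>
     (\<forall>\<alpha>\<in>indices K. f \<alpha> holomorphic_on ball 0 1 \<and> f \<alpha> 0 = \<alpha> \<and> (\<forall>z\<in>ball 0 1. cmod (f \<alpha> z) < 1)) \<and>
     (\<forall>\<alpha>\<in>indices K. \<forall>\<beta>\<in>indices K. \<alpha> \<noteq> \<beta> \<longrightarrow> graph (f \<alpha>) \<inter> graph (f \<beta>) = {}) \<and>
     K = (\<Union>\<alpha>\<in>indices K. graph (f \<alpha>))"

definition weakly_directed ::
  "(complex \<times> complex) set \<Rightarrow> (complex \<Rightarrow> complex \<Rightarrow> complex) \<Rightarrow> current11 \<Rightarrow> bool" where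
  "weakly_directed K f T \<longleftrightarrow>
     (\<forall>l :: coform. continuous_on bidisc l \<longrightarrow>
        (\<forall>\<alpha>\<in>indices K. \<forall>z\<in>ball 0 1. \<exists>c. c \<noteq> 0 \<and>
            l (z, f \<alpha> z) $ 1 = - c * deriv (f \<alpha>) z \<and> l (z, f \<alpha> z) $ 2 = c) \<longrightarrow>
        (\<forall>b. test_on bidisc b \<longrightarrow> wedge_current bidisc l T b = 0))"

text \<open>The integral of currents is taken weakly, i.e. against every test form.\<close>

definition directed ::
  "(complex \<times> complex) set \<Rightarrow> (complex \<Rightarrow> complex \<Rightarrow> complex) \<Rightarrow> current11 \<Rightarrow> bool" where
  "directed K f T \<longleftrightarrow>
     (\<exists>\<mu> :: complex measure. sets \<mu> = sets (restrict_space borel (indices K)) \<and>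
        (\<forall>\<phi>. test_on bidisc \<phi> \<longrightarrow>
           integrable \<mu> (\<lambda>\<alpha>. graph_current (f \<alpha>) \<phi>) \<and>
           T \<phi> = (LINT \<alpha>|\<mu>. graph_current (f \<alpha>) \<phi>)))"

end

theory Submission imports Defs begin

text \<open>
  A positive current extends to continuous forms with compact support (\<open>T_adj_and_bound\<close>,
  \<open>cont_ext_lim\<close>): a Hermitian form is dominated by a multiple of a fixed positive form.  By the
  Riesz representation theorem, the coefficient of \<open>T\<close> that is tested by multiples of
  \<open>(\<i>/2) dz \<and> d(cnj z)\<close> is a positive measure \<open>N\<close> on \<open>K\<close>.

  Suppose that \<open>T\<close> is weakly directed.  The slope of the leaves is continuous on \<open>K\<close>, so
  \<open>dw - G dz\<close> is an admissible \<open>(1,0)\<close> form for every continuous extension \<open>G\<close> of the slope.  Hence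
  all four coefficient measures are multiples of \<open>N\<close>, and \<open>T\<close> applied to \<open>\<phi>\<close> is the integral over
  \<open>N\<close> of the value of \<open>\<phi>\<close> on the tangent vector \<open>(1, slope)\<close> of the leaf (\<open>TE_representation\<close>).
  Closedness of \<open>T\<close> now says that derivatives of test functions along the leaves have \<open>N\<close>-integral
  \<open>0\<close> (\<open>leafwise_derivative\<close>).

  One would like to apply this to \<open>\<chi>(z) g(\<alpha>)\<close>, with \<open>\<alpha>\<close> the label of the leaf, and conclude that
  \<open>N\<close> is invariant under translation along the leaves.  But the label is only a Hoelder continuous
  function on \<open>K\<close>.  The difference of two leaves has no zero, and Harnack's inequality for its
  logarithm gives two facts (\<open>leaves_bounds\<close>): the distance \<open>y(z)\<close> of two leaves over \<open>z\<close> is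
  comparable, up to powers, with their distance over \<open>0\<close>, and its derivative is
  at most a multiple of \<open>y ln (1/y)\<close>.  So \<open>g\<close> of the label can be replaced by a smooth average of
  the values of \<open>g\<close> on a finite net of leaves, with weights \<open>(\<epsilon>\<^sup>2 + y\<^sup>2)^(-M)\<close>.  Along the
  leaves these weights have logarithmic derivatives of size \<open>ln (1/\<epsilon>)\<close>, whereas the oscillation of
  \<open>g\<close> where the weights are concentrated is of size \<open>\<epsilon>^c\<close> for some \<open>c > 0\<close>; the product tends to
  \<open>0\<close> (\<open>blend_estimate\<close>, \<open>product_derivative_zero\<close>).

  Translation invariance (\<open>translation_continuous\<close>) and Fubini's theorem split \<open>N\<close> as the product
  of the area in \<open>z\<close> and a measure on the set of labels (\<open>disintegration\<close>), which is the asserted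
  decomposition of \<open>T\<close>.

  Conversely, if \<open>T\<close> is directed and \<open>\<lambda>\<close> is conormal to the leaves, then \<open>\<lambda> \<and> b\<close> vanishes on
  every leaf.  Test forms that approximate it uniformly are small on each leaf compared with the
  area form, and the areas of the leaves, smoothly cut off, are integrable
  (\<open>directed_imp_weakly_directed\<close>).
\<close>

(* The dollar sign is to denote components of vectors only. *)
no_notation fps_nth (infixl "$" 75)

section \<open>Smooth functions\<close>

text \<open>With a polynomial factor, the flat functions \<open>exp (-1/t)\<close> become a class that is closed
  under differentiation.\<close>

definition flat :: "real poly \<Rightarrow> real \<Rightarrow> real" where
  "flat P t = (if t \<le> 0 then 0 else poly P (inverse t) * exp (- inverse t))"

lemma flat_tendsto_0: "((\<lambda>t. flat P t) \<longlongrightarrow> 0) (at_right 0)"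
proof -
  have e: "((\<lambda>u::real. u ^ n * exp (- u)) \<longlongrightarrow> 0) at_top" for n
    using tendsto_power_div_exp_0[of n] by (simp add: exp_minus field_simps)
  have "((\<lambda>u::real. \<Sum>i\<le>degree P. coeff P i * (u ^ i * exp (- u))) \<longlongrightarrow> (\<Sum>i\<le>degree P. coeff P i * 0)) at_top"
    by (intro tendsto_intros e)
  then have "((\<lambda>u::real. poly P u * exp (- u)) \<longlongrightarrow> 0) at_top"
    by (simp add: poly_altdef sum_distrib_right mult.assoc)
  then have "((\<lambda>t::real. poly P (inverse t) * exp (- inverse t)) \<longlongrightarrow> 0) (at_right 0)"
    by (rule filterlim_compose[OF _ filterlim_inverse_at_top_right])
  then show ?thesis
    by (rule tendsto_cong[THEN iffD1, rotated])
       (auto simp: flat_def eventually_at_filter)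
qed

definition flat_next :: "real poly \<Rightarrow> real poly" where
  "flat_next P = [:0,0,1:] * (P - pderiv P)"

lemma flat_deriv: "(flat P has_real_derivative flat (flat_next P) t) (at t)"
proof -
  consider "t < 0" | "t = 0" | "t > 0" by linarith
  then show ?thesis
  proof cases
    case 1
    have "((\<lambda>_. 0) has_real_derivative 0) (at t)" by simp
    then have "(flat P has_real_derivative 0) (at t)"
      by (rule has_field_derivative_transform_within_open[where S="{..<0}"])
         (use 1 in \<open>auto simp: flat_def\<close>)
    then show ?thesis using 1 by (simp add: flat_def)
  next
    case 2
    have r: "((\<lambda>h. (flat P (0 + h) - flat P 0) / h) \<longlongrightarrow> 0) (at_right 0)"
    proof -
      \<comment> \<open>dividing \<open>flat P\<close> by \<open>h\<close> multiplies \<open>P(1/h)\<close> by \<open>1/h\<close>\<close>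
      have "((\<lambda>h. flat ([:0,1:] * P) h) \<longlongrightarrow> 0) (at_right 0)" by (rule flat_tendsto_0)
      then show ?thesis
        by (rule tendsto_cong[THEN iffD1, rotated])
           (auto simp: flat_def eventually_at_filter field_simps)
    qed
    have l: "((\<lambda>h. (flat P (0 + h) - flat P 0) / h) \<longlongrightarrow> 0) (at_left 0)"
      by (rule tendsto_eventually) (auto simp: flat_def eventually_at_filter)
    have "((\<lambda>h. (flat P (0 + h) - flat P 0) / h) \<longlongrightarrow> 0) (at 0)"
      using r l filterlim_split_at by blast
    then show ?thesis using 2 by (simp add: DERIV_def flat_def)
  next
    case 3
    have "((\<lambda>t. poly P (inverse t) * exp (- inverse t)) has_real_derivative
        flat (flat_next P) t) (at t)"
      using 3 by (auto intro!: derivative_eq_intros poly_DERIV[THEN DERIV_chain2]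
          simp: flat_def flat_next_def power2_eq_square field_simps)
    then show ?thesis
      by (rule has_field_derivative_transform_within_open[where S="{0<..}"])
         (use 3 in \<open>auto simp: flat_def\<close>)
  qed
qed

text \<open>Smoothness asks for all iterated directional derivatives.  Membership in a class that is
  closed under differentiation settles them all at once, without higher chain and product rules.
  The clauses cover the functions needed later: cutoffs, polynomials, and weights built from the
  holomorphic functions whose graphs are the leaves.\<close>

inductive elem :: "(complex \<times> complex) set \<Rightarrow> (complex \<times> complex \<Rightarrow> complex) \<Rightarrow> bool"
  for S where
  elem_const: "elem S (\<lambda>_. c)"
| elem_linear: "bounded_linear L \<Longrightarrow> elem S L"
| elem_add: "elem S g \<Longrightarrow> elem S h \<Longrightarrow> elem S (\<lambda>x. g x + h x)"
| elem_mult: "elem S g \<Longrightarrow> elem S h \<Longrightarrow> elem S (\<lambda>x. g x * h x)"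
| elem_cnj: "elem S g \<Longrightarrow> elem S (\<lambda>x. cnj (g x))"
| elem_inverse: "elem S g \<Longrightarrow> (\<And>x. x \<in> S \<Longrightarrow> g x \<noteq> 0) \<Longrightarrow> elem S (\<lambda>x. inverse (g x))"
| elem_holo: "G holomorphic_on ball 0 1 \<Longrightarrow> S \<subseteq> ball 0 1 \<times> UNIV \<Longrightarrow> elem S (\<lambda>x. G (fst x))"
| elem_flat: "elem S g \<Longrightarrow> elem S (\<lambda>x. of_real (flat P (Re (g x))))"

lemma elem_cmult: "elem S g \<Longrightarrow> elem S (\<lambda>x. c * g x)"
  by (intro elem_mult elem_const)

lemma elem_minus: "elem S g \<Longrightarrow> elem S (\<lambda>x. - g x)"
  using elem_cmult[of S g "-1"] by simp

lemma elem_diff: "elem S g \<Longrightarrow> elem S h \<Longrightarrow> elem S (\<lambda>x. g x - h x)"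
  using elem_add[OF _ elem_minus] by force

lemma elem_Re: "elem S g \<Longrightarrow> elem S (\<lambda>x. of_real (Re (g x)))"
proof -
  assume g: "elem S g"
  have "elem S (\<lambda>x. (1/2) * (g x + cnj (g x)))"
    by (intro elem_cmult elem_add g elem_cnj)
  then show ?thesis by (simp add: complex_add_cnj)
qed

lemma elem_sum: "(\<And>i. i \<in> A \<Longrightarrow> elem S (g i)) \<Longrightarrow> elem S (\<lambda>x. \<Sum>i\<in>A. g i x)"
  by (induction A rule: infinite_finite_induct) (auto intro: elem_const elem_add)

lemma elem_power: "elem S g \<Longrightarrow> elem S (\<lambda>x. g x ^ n)"
  by (induction n) (auto intro: elem_const elem_mult)

lemma elem_has_derivative:
  assumes "elem S g" "open S"
  shows "\<exists>D. (\<forall>v. elem S (\<lambda>x. D x v)) \<and> (\<forall>x\<in>S. (g has_derivative D x) (at x))"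
  using assms(1)
proof induction
  case (elem_const c)
  show ?case by (rule exI[of _ "\<lambda>_ _. 0"]) (auto intro: elem.elem_const)
next
  case (elem_linear L)
  show ?case
    by (rule exI[of _ "\<lambda>_. L"])
       (auto intro: elem.elem_const bounded_linear_imp_has_derivative elem_linear)
next
  case (elem_add g h)
  then obtain D E where "\<forall>v. elem S (\<lambda>x. D x v)" "\<forall>v. elem S (\<lambda>x. E x v)"
    "\<forall>x\<in>S. (g has_derivative D x) (at x)" "\<forall>x\<in>S. (h has_derivative E x) (at x)" by auto
  then show ?case
    by (intro exI[of _ "\<lambda>x v. D x v + E x v"])
       (auto intro!: elem.elem_add derivative_eq_intros)
next
  case (elem_mult g h)
  then obtain D E where "\<forall>v. elem S (\<lambda>x. D x v)" "\<forall>v. elem S (\<lambda>x. E x v)"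
    "\<forall>x\<in>S. (g has_derivative D x) (at x)" "\<forall>x\<in>S. (h has_derivative E x) (at x)" by auto
  then show ?case using elem_mult.hyps
    by (intro exI[of _ "\<lambda>x v. g x * E x v + D x v * h x"])
       (auto intro!: elem.elem_add elem.elem_mult derivative_eq_intros)
next
  case (elem_cnj g)
  then obtain D where "\<forall>v. elem S (\<lambda>x. D x v)" "\<forall>x\<in>S. (g has_derivative D x) (at x)" by auto
  then show ?case
    by (intro exI[of _ "\<lambda>x v. cnj (D x v)"])
       (auto intro!: elem.elem_cnj has_derivative_cnj)
next
  case (elem_inverse g)
  then obtain D where D: "\<forall>v. elem S (\<lambda>x. D x v)" "\<forall>x\<in>S. (g has_derivative D x) (at x)" by auto
  have "elem S (\<lambda>x. - (inverse (g x) * D x v * inverse (g x)))" for v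
    by (intro elem_minus elem.elem_mult elem.elem_inverse D(1)[rule_format] elem_inverse.hyps)
  moreover have "\<forall>x\<in>S. ((\<lambda>x. inverse (g x)) has_derivative
      (\<lambda>v. - (inverse (g x) * D x v * inverse (g x)))) (at x)"
    using D elem_inverse.hyps by (auto intro!: has_derivative_inverse)
  ultimately show ?case
    by (intro exI[of _ "\<lambda>x v. - (inverse (g x) * D x v * inverse (g x))"]) blast
next
  case (elem_holo G)
  have "elem S (\<lambda>x. deriv G (fst x) * fst v)" for v
    using elem_holo by (intro elem.elem_mult elem.elem_const elem.elem_holo holomorphic_deriv) auto
  moreover have "((\<lambda>x. G (fst x)) has_derivative (\<lambda>v. deriv G (fst x) * fst v)) (at x)"
    if "x \<in> S" for x
  proof -
    have "fst x \<in> ball 0 1" using that elem_holo by auto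
    then have "(G has_derivative (*) (deriv G (fst x))) (at (fst x))"
      using elem_holo holomorphic_derivI[OF elem_holo(1) open_ball]
      by (metis has_field_derivative_def)
    from has_derivative_compose[OF has_derivative_fst[OF has_derivative_ident] this]
    show ?thesis by simp
  qed
  ultimately show ?case by (intro exI[of _ "\<lambda>x v. deriv G (fst x) * fst v"]) blast
next
  case (elem_flat g P)
  then obtain D where D: "\<forall>v. elem S (\<lambda>x. D x v)" "\<forall>x\<in>S. (g has_derivative D x) (at x)" by auto
  let ?E = "\<lambda>x v. of_real (flat (flat_next P) (Re (g x))) * complex_of_real (Re (D x v))"
  have "elem S (\<lambda>x. ?E x v)" for v
    by (intro elem.elem_mult elem.elem_flat elem_Re D(1)[rule_format] elem_flat.hyps)
  moreover have "((\<lambda>x. complex_of_real (flat P (Re (g x)))) has_derivative ?E x) (at x)"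
    if "x \<in> S" for x
  proof -
    have "((\<lambda>x. Re (g x)) has_derivative (\<lambda>v. Re (D x v))) (at x)"
      using D that by (auto intro: bounded_linear.has_derivative[OF bounded_linear_Re])
    from has_derivative_compose[OF this flat_deriv[unfolded has_field_derivative_def]]
    have "((\<lambda>x. flat P (Re (g x))) has_derivative
       (\<lambda>v. flat (flat_next P) (Re (g x)) * Re (D x v))) (at x)" .
    from bounded_linear.has_derivative[OF bounded_linear_of_real this]
    show ?thesis by simp
  qed
  ultimately show ?case by (intro exI[of _ ?E]) blast
qed

lemma elem_iter_deriv:
  assumes "elem S g" "open S"
  shows "\<exists>g'. elem S g' \<and> (\<forall>x\<in>S. iter_deriv vs g x = g' x)"
proof (induction vs)
  case Nil
  then show ?case using assms by auto
next
  case (Cons v vs)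
  then obtain g' where g': "elem S g'" "\<forall>x\<in>S. iter_deriv vs g x = g' x" by blast
  from elem_has_derivative[OF g'(1) assms(2)] obtain D where
    D: "\<forall>v. elem S (\<lambda>x. D x v)" "\<forall>x\<in>S. (g' has_derivative D x) (at x)" by blast
  have "frechet_derivative (iter_deriv vs g) (at x) v = D x v" if "x \<in> S" for x
  proof -
    have "(iter_deriv vs g has_derivative D x) (at x)"
      using D that g'
      by (auto intro: has_derivative_transform_within_open[OF _ assms(2) that])
    then show ?thesis by (metis frechet_derivative_at)
  qed
  then show ?case using D(1)[rule_format, of v]
    by (intro exI[of _ "\<lambda>x. D x v"]) (simp del: split_paired_All)
qed

lemma iter_deriv_cong:
  assumes "open S" "\<forall>x\<in>S. f x = g x"
  shows "\<forall>x\<in>S. iter_deriv vs f x = iter_deriv vs g x"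
proof (induction vs)
  case (Cons v vs)
  have "frechet_derivative (iter_deriv vs f) (at x) = frechet_derivative (iter_deriv vs g) (at x)"
    if "x \<in> S" for x
    unfolding frechet_derivative_def
    by (rule arg_cong[where f=Eps], rule ext)
       (use Cons that assms(1) in \<open>auto intro: has_derivative_transform_within_open\<close>)
  then show ?case by simp
qed (use assms in auto)

text \<open>The description may vary from point to point: the blends below are elementary only over
  the unit disc, and the cutoffs that multiply them vanish near its boundary.\<close>

lemma smoothI_elem:
  assumes "\<And>x. \<exists>S h. open S \<and> x \<in> S \<and> elem S h \<and> (\<forall>y\<in>S. g y = h y)"
  shows "smooth g"
  unfolding smooth_def differentiable_on_def
proof (intro allI ballI)
  fix vs x
  obtain S h where S: "open S" "x \<in> S" "elem S h" "\<forall>y\<in>S. g y = h y" using assms by blast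
  obtain h' where h': "elem S h'" "\<forall>x\<in>S. iter_deriv vs h x = h' x"
    using elem_iter_deriv[OF S(3,1)] by blast
  obtain D where "(h' has_derivative D) (at x)"
    using elem_has_derivative[OF h'(1) S(1)] S(2) by blast
  then have "(iter_deriv vs g has_derivative D) (at x)"
    using iter_deriv_cong[OF S(1,4), of vs] h' S
    by (auto intro: has_derivative_transform_within_open[OF _ S(1,2)])
  then show "iter_deriv vs g differentiable at x"
    unfolding differentiable_def by blast
qed

lemma elem_imp_smooth: "elem UNIV g \<Longrightarrow> smooth g"
  by (rule smoothI_elem) blast

lemma smooth_differentiable: "smooth f \<Longrightarrow> f differentiable at x"
  unfolding smooth_def differentiable_on_def by (metis UNIV_I iter_deriv.simps(1))

lemma smooth_continuous: "smooth f \<Longrightarrow> continuous_on S f"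
  by (simp add: continuous_at_imp_continuous_on differentiable_imp_continuous_within smooth_differentiable)

lemma smooth_linear:
  assumes "smooth f" "bounded_linear L"
  shows "smooth (\<lambda>x. L (f x))"
proof -
  have "iter_deriv vs (\<lambda>x. L (f x)) = (\<lambda>x. L (iter_deriv vs f x))" for vs
  proof (induction vs)
    case (Cons v vs)
    have "(iter_deriv vs f has_derivative frechet_derivative (iter_deriv vs f) (at x)) (at x)" for x
      using assms(1) by (metis UNIV_I smooth_def differentiable_on_def frechet_derivative_works)
    note bounded_linear.has_derivative[OF assms(2) this]
    from frechet_derivative_at[OF this, symmetric] show ?case by (simp add: Cons)
  qed simp
  moreover have "(\<lambda>x. L (iter_deriv vs f x)) differentiable_on UNIV" for vs
  proof -
    have "iter_deriv vs f differentiable at x" for x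
      using assms(1) by (auto simp: smooth_def differentiable_on_def)
    then show ?thesis
      unfolding differentiable_on_def differentiable_def
      using bounded_linear.has_derivative[OF assms(2)] by blast
  qed
  ultimately show ?thesis by (simp add: smooth_def)
qed

lemma smooth_add:
  assumes "smooth f" "smooth g"
  shows "smooth (\<lambda>x. f x + g x)"
proof -
  have d: "iter_deriv vs f differentiable at x" "iter_deriv vs g differentiable at x" for vs x
    using assms by (auto simp: smooth_def differentiable_on_def)
  have "iter_deriv vs (\<lambda>x. f x + g x) = (\<lambda>x. iter_deriv vs f x + iter_deriv vs g x)" for vs
  proof (induction vs)
    case (Cons v vs)
    have "((\<lambda>x. iter_deriv vs f x + iter_deriv vs g x) has_derivative
       (\<lambda>v. frechet_derivative (iter_deriv vs f) (at x) v + frechet_derivative (iter_deriv vs g) (at x) v)) (at x)" for x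
      using d by (intro has_derivative_add) (auto simp: frechet_derivative_works[symmetric])
    from frechet_derivative_at[OF this, symmetric] show ?case by (simp add: Cons)
  qed simp
  then show ?thesis using d by (auto simp: smooth_def differentiable_on_def)
qed

lemma smooth_0: "smooth (\<lambda>_::'a::euclidean_space. 0::'b::real_normed_vector)"
proof -
  have "iter_deriv vs (\<lambda>_::'a. 0::'b) = (\<lambda>_. 0)" for vs
    by (induction vs) (auto simp: frechet_derivative_const)
  then have "iter_deriv vs (\<lambda>_. 0 :: 'b) differentiable_on (UNIV :: 'a set)" for vs
    by (simp add: differentiable_on_def)
  then show ?thesis by (simp add: smooth_def)
qed

lemma smooth_sum: "(\<And>i. i \<in> A \<Longrightarrow> smooth (f i)) \<Longrightarrow> smooth (\<lambda>x. \<Sum>i\<in>A. f i x)"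
  by (induction A rule: infinite_finite_induct) (auto intro: smooth_0 smooth_add)

text \<open>A smooth step that falls from \<open>1\<close> to \<open>0\<close> between \<open>a\<close> and \<open>b\<close>.\<close>

definition bump :: "real \<Rightarrow> real \<Rightarrow> real \<Rightarrow> real" where
  "bump a b x = flat 1 (b - x) / (flat 1 (b - x) + flat 1 (x - a))"

lemma flat_nonneg: "flat 1 t \<ge> 0" and flat_pos: "flat 1 t > 0 \<longleftrightarrow> t > 0"
  and flat_eq_0: "flat 1 t = 0 \<longleftrightarrow> t \<le> 0"
  by (auto simp: flat_def)

lemma bump_denom: "a < b \<Longrightarrow> flat 1 (b - x) + flat 1 (x - a) > 0"
  using flat_nonneg[of "b-x"] flat_nonneg[of "x-a"] flat_pos[of "b-x"] flat_pos[of "x-a"]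
  by (cases "x < b") linarith+

lemma bump_range: "a < b \<Longrightarrow> 0 \<le> bump a b x \<and> bump a b x \<le> 1"
  using bump_denom[of a b x] flat_nonneg[of "b-x"] flat_nonneg[of "x-a"]
  by (auto simp: bump_def divide_simps)

lemma bump_1: "a < b \<Longrightarrow> x \<le> a \<Longrightarrow> bump a b x = 1"
  using bump_denom[of a b x] flat_eq_0[of "x-a"] by (simp add: bump_def)

lemma bump_0: "x \<ge> b \<Longrightarrow> bump a b x = 0"
  using flat_eq_0[of "b-x"] by (simp add: bump_def)

lemma elem_bump:
  assumes g: "elem S g" and ab: "a < b"
  shows "elem S (\<lambda>x. of_real (bump a b (Re (g x))))"
proof -
  have 1: "elem S (\<lambda>x. of_real (flat 1 (b - Re (g x))))"
    using elem_flat[OF elem_diff[OF elem_const[of S "of_real b"] g], of 1] by simp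
  have 2: "elem S (\<lambda>x. of_real (flat 1 (Re (g x) - a)))"
    using elem_flat[OF elem_diff[OF g elem_const[of S "of_real a"]], of 1] by simp
  have "of_real (flat 1 (b - Re (g x))) + complex_of_real (flat 1 (Re (g x) - a)) \<noteq> 0" for x
    using bump_denom[OF ab, of "Re (g x)"] by (metis less_irrefl of_real_add of_real_eq_0_iff)
  then have "elem S (\<lambda>x. of_real (flat 1 (b - Re (g x))) *
      inverse (of_real (flat 1 (b - Re (g x))) + of_real (flat 1 (Re (g x) - a))))"
    by (intro elem_mult elem_inverse elem_add 1 2)
  then show ?thesis by (simp add: bump_def divide_inverse)
qed

lemma elem_norm_sq: "elem S g \<Longrightarrow> elem S (\<lambda>x. of_real ((cmod (g x))\<^sup>2))"
  using elem_mult[OF _ elem_cnj, of S g g] by (simp add: complex_norm_square del: of_real_power)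

lemma elem_fst: "elem S fst" and elem_snd: "elem S snd"
  by (auto intro: elem_linear bounded_linear_fst bounded_linear_snd)

lemma elem_real_polynomial:
  "real_polynomial_function p \<Longrightarrow> elem S (\<lambda>x. of_real (p x))"
proof (induction rule: real_polynomial_function.induct)
  case (linear L)
  then show ?case
    using elem_linear[OF bounded_linear_compose[OF bounded_linear_of_real]] by blast
qed (auto intro: elem_const elem_add elem_mult)

text \<open>The squares keep the cutoff smooth where a coordinate vanishes.\<close>

definition cut :: "real \<Rightarrow> real \<Rightarrow> complex \<times> complex \<Rightarrow> real" where
  "cut a b x = bump (a\<^sup>2) (b\<^sup>2) ((cmod (fst x))\<^sup>2) * bump (a\<^sup>2) (b\<^sup>2) ((cmod (snd x))\<^sup>2)"

lemma elem_bump_norm: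
  assumes "elem S g" "0 \<le> a" "a < b"
  shows "elem S (\<lambda>x. of_real (bump (a\<^sup>2) (b\<^sup>2) ((cmod (g x))\<^sup>2)))"
proof -
  have "a\<^sup>2 < b\<^sup>2" using assms by (simp add: power_strict_mono)
  from elem_bump[OF elem_norm_sq[OF assms(1)] this] show ?thesis by simp
qed

lemma elem_cut: "0 \<le> a \<Longrightarrow> a < b \<Longrightarrow> elem S (\<lambda>x. of_real (cut a b x))"
  unfolding cut_def of_real_mult
  by (intro elem_mult elem_bump_norm elem_fst elem_snd)

lemma cut_range: "0 \<le> a \<Longrightarrow> a < b \<Longrightarrow> 0 \<le> cut a b x \<and> cut a b x \<le> 1"
  using bump_range[of "a\<^sup>2" "b\<^sup>2"] by (auto simp: cut_def power_strict_mono intro: mult_le_one)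

lemma cut_1: "0 \<le> a \<Longrightarrow> a < b \<Longrightarrow> x \<in> cball 0 a \<times> cball 0 a \<Longrightarrow> cut a b x = 1"
  by (auto simp: cut_def power_strict_mono power_mono bump_1)

lemma cut_0: "0 < b \<Longrightarrow> x \<notin> cball 0 b \<times> cball 0 b \<Longrightarrow> cut a b x = 0"
  by (cases x) (auto simp: cut_def not_le intro!: bump_0 power_mono)

lemma compact_in_bidisc:
  assumes "compact C" "C \<subseteq> bidisc"
  obtains r where "0 < r" "r < 1" "C \<subseteq> cball 0 r \<times> cball 0 r"
proof (cases "C = {}")
  case True
  then show ?thesis using that[of "1/2"] by auto
next
  case False
  have "continuous_on C (\<lambda>x. max (cmod (fst x)) (cmod (snd x)))"
    by (intro continuous_intros)
  from continuous_attains_sup[OF assms(1) False this] obtain x where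
    x: "x \<in> C" "\<And>y. y \<in> C \<Longrightarrow> max (cmod (fst y)) (cmod (snd y)) \<le> max (cmod (fst x)) (cmod (snd x))"
    by auto
  have "max (cmod (fst x)) (cmod (snd x)) < 1" using x(1) assms(2) by (auto simp: bidisc_def)
  then have "C \<subseteq> cball 0 (max (1/2) (max (cmod (fst x)) (cmod (snd x)))) \<times> cball 0 (max (1/2) (max (cmod (fst x)) (cmod (snd x))))"
    using x(2) by fastforce
  then show ?thesis using \<open>max (cmod (fst x)) (cmod (snd x)) < 1\<close>
    by (intro that[of "max (1/2) (max (cmod (fst x)) (cmod (snd x)))"]) auto
qed

lemma compact_bidisc_cball: "r < 1 \<Longrightarrow> compact (cball 0 r \<times> cball 0 r :: (complex \<times> complex) set) \<and> cball 0 r \<times> cball 0 r \<subseteq> bidisc"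
  by (intro conjI compact_Times compact_cball) (auto simp: bidisc_def)

lemma supp_subset: "closed C \<Longrightarrow> (\<And>x. x \<notin> C \<Longrightarrow> f x = 0) \<Longrightarrow> supp f \<subseteq> C"
  unfolding supp_def by (rule closure_minimal) auto

lemma not_in_supp: "x \<notin> supp f \<Longrightarrow> f x = 0"
  using closure_subset[of "{x. f x \<noteq> 0}"] by (auto simp: supp_def)

lemma test_onI:
  assumes "smooth f" "compact C" "C \<subseteq> U" "\<And>x. x \<notin> C \<Longrightarrow> f x = 0"
  shows "test_on U f"
proof -
  have "supp f \<subseteq> C" using assms by (intro supp_subset compact_imp_closed)
  moreover have "closed (supp f)" by (simp add: supp_def)
  ultimately show ?thesis
    using assms compact_Int_closed[of C "supp f"] by (auto simp: test_on_def inf_absorb2)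
qed

lemma test_onD:
  assumes "test_on U f"
  shows "smooth f" "compact (supp f)" "supp f \<subseteq> U"
  using assms by (auto simp: test_on_def)

lemma test_on_linear:
  assumes "test_on U f" "bounded_linear L"
  shows "test_on U (\<lambda>x. L (f x))"
proof (rule test_onI)
  show "smooth (\<lambda>x. L (f x))" by (rule smooth_linear[OF test_onD(1)[OF assms(1)] assms(2)])
  show "L (f x) = 0" if "x \<notin> supp f" for x
    using not_in_supp[OF that] assms(2) by (simp add: linear_simps)
qed (rule test_onD[OF assms(1)])+

lemma test_on_add:
  assumes "test_on U f" "test_on U g"
  shows "test_on U (\<lambda>x. f x + g x)"
proof (rule test_onI)
  show "smooth (\<lambda>x. f x + g x)" using assms by (intro smooth_add test_onD(1))
  show "f x + g x = 0" if "x \<notin> supp f \<union> supp g" for x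
    using not_in_supp[of x f] not_in_supp[of x g] that by auto
qed (use assms in \<open>auto dest: test_onD intro!: compact_Un\<close>)

lemma test_on_0: "test_on U (\<lambda>_. 0)"
  by (rule test_onI[of _ "{}"]) (auto intro: smooth_0)

lemma test_on_sum: "(\<And>i. i \<in> A \<Longrightarrow> test_on U (f i)) \<Longrightarrow> test_on U (\<lambda>x. \<Sum>i\<in>A. f i x)"
  by (induction A rule: infinite_finite_induct) (auto intro: test_on_0 test_on_add)

section \<open>Positive currents have order zero\<close>

definition mscale :: "complex \<Rightarrow> complex^2^2 \<Rightarrow> complex^2^2" where
  "mscale c A = (\<chi> j k. c * A $ j $ k)"

definition adj :: "complex^2^2 \<Rightarrow> complex^2^2" where
  "adj A = (\<chi> j k. cnj (A $ k $ j))"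

definition munit :: "2 \<Rightarrow> 2 \<Rightarrow> complex \<Rightarrow> complex^2^2" where
  "munit j k c = (\<chi> a b. if a = j \<and> b = k then c else 0)"

lemma mat_linear:
  fixes L :: "'a::euclidean_space \<Rightarrow> complex^2^2"
  assumes "\<And>x y. L (x + y) = L x + L y" "\<And>r x. L (r *\<^sub>R x) = r *\<^sub>R L x"
  shows "bounded_linear L"
  using assms by (intro linear_conv_bounded_linear[THEN iffD1] linearI)

lemma bl_mscale: "bounded_linear (mscale c)"
  by (rule mat_linear) (auto simp: mscale_def vec_eq_iff algebra_simps)

lemma bl_adj: "bounded_linear adj"
  by (rule mat_linear) (auto simp: adj_def vec_eq_iff)

lemma bl_munit: "bounded_linear (munit j k)"
  by (rule mat_linear) (auto simp: munit_def vec_eq_iff)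

lemma bl_entry: "bounded_linear (\<lambda>A::complex^2^2. A $ j $ k)"
  by (rule bounded_linear_compose[OF bounded_linear_vec_nth bounded_linear_vec_nth])

lemma entry_le_norm: "cmod ((A::complex^2^2) $ j $ k) \<le> norm A"
  by (meson Finite_Cartesian_Product.norm_nth_le order_trans)

lemma norm_le_entries:
  fixes A :: "complex^2^2"
  assumes "\<And>j k. cmod (A $ j $ k) \<le> c"
  shows "norm A \<le> 4 * c"
proof -
  have "norm (A $ j) \<le> 2 * c" for j
    using L2_set_le_sum[of UNIV "\<lambda>k. cmod (A $ j $ k)"] assms[of j 1] assms[of j 2]
    by (simp add: norm_vec_def sum_2)
  from this[of 1] this[of 2] show ?thesis
    using L2_set_le_sum[of UNIV "\<lambda>j. norm (A $ j)"]
    by (simp add: norm_vec_def[of A] sum_2)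
qed

lemma mat_decomp: "(A::complex^2^2) = (\<Sum>j\<in>UNIV. \<Sum>k\<in>UNIV. munit j k (A $ j $ k))"
  using exhaust_2 by (auto simp: munit_def vec_eq_iff sum_2)

text \<open>The value of a \<open>(1,1)\<close> form on the complex line spanned by \<open>v\<close>; both positivity of forms
  and the current of a graph are defined through it.\<close>

definition qform :: "complex^2^2 \<Rightarrow> complex^2 \<Rightarrow> complex" where
  "qform A v = (\<Sum>j\<in>UNIV. \<Sum>k\<in>UNIV. A $ j $ k * (v $ j * cnj (v $ k)))"

text \<open>A Hermitian 2 by 2 matrix with entries bounded by \<open>c\<close> has eigenvalues \<open>\<ge> - 2 c\<close>.\<close>

lemma qform_hermitian_nonneg:
  fixes A :: "complex^2^2"
  assumes "adj A = A" "\<And>j k. cmod (A $ j $ k) \<le> c"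
  shows "qform (munit 1 1 (2 * c) + munit 2 2 (2 * c) + A) v \<in> \<real>\<^sub>\<ge>\<^sub>0"
proof -
  have h: "cnj (A $ k $ j) = A $ j $ k" for j k
    using assms(1) by (simp add: adj_def vec_eq_iff)
  define x y where "x = cmod (v $ 1)" and "y = cmod (v $ 2)"
  define a d where "a = Re (A $ 1 $ 1)" and "d = Re (A $ 2 $ 2)"
  have A: "A $ 1 $ 1 = of_real a" "A $ 2 $ 2 = of_real d"
    using h[of 1 1] h[of 2 2] by (auto simp: a_def d_def complex_eq_iff)
  define t where "t = A $ 1 $ 2 * (v $ 1 * cnj (v $ 2))"
  have t2: "A $ 2 $ 1 * (v $ 2 * cnj (v $ 1)) = cnj t"
    using h[of 1 2] by (simp add: t_def mult.commute)
  have vv: "v $ 1 * cnj (v $ 1) = of_real (x\<^sup>2)" "v $ 2 * cnj (v $ 2) = of_real (y\<^sup>2)"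
    by (auto simp: x_def y_def complex_norm_square simp del: of_real_power)
  have "qform (munit 1 1 (2 * c) + munit 2 2 (2 * c) + A) v =
     (2 * c + a) * (v $ 1 * cnj (v $ 1)) + (2 * c + d) * (v $ 2 * cnj (v $ 2)) + (t + cnj t)"
    unfolding t2[symmetric] unfolding t_def by (simp add: qform_def sum_2 munit_def A algebra_simps)
  also have "\<dots> = of_real ((2 * c + a) * x\<^sup>2 + (2 * c + d) * y\<^sup>2 + 2 * Re t)"
    unfolding vv by (simp add: complex_add_cnj)
  finally have eq: "qform (munit 1 1 (2 * c) + munit 2 2 (2 * c) + A) v =
     of_real ((2 * c + a) * x\<^sup>2 + (2 * c + d) * y\<^sup>2 + 2 * Re t)" .
  have c0: "c \<ge> 0" using assms(2)[of 1 1] norm_ge_zero order_trans by blast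
  have "\<bar>Re t\<bar> \<le> c * (x * y)"
  proof -
    have "\<bar>Re t\<bar> \<le> cmod t" by (rule abs_Re_le_cmod)
    also have "\<dots> = cmod (A $ 1 $ 2) * (x * y)" by (simp add: t_def x_def y_def norm_mult)
    also have "\<dots> \<le> c * (x * y)"
      using assms(2) by (intro mult_right_mono) (auto simp: x_def y_def)
    finally show ?thesis .
  qed
  moreover have "2 * (c * (x * y)) \<le> c * x\<^sup>2 + c * y\<^sup>2"
  proof -
    have "0 \<le> c * (x - y)\<^sup>2" using c0 by simp
    then show ?thesis by (simp add: power2_eq_square algebra_simps)
  qed
  moreover have "- (c * x\<^sup>2) \<le> a * x\<^sup>2" "- (c * y\<^sup>2) \<le> d * y\<^sup>2"
  proof -
    have "\<bar>a\<bar> \<le> c" "\<bar>d\<bar> \<le> c"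
      using assms(2)[of 1 1] assms(2)[of 2 2] A by auto
    then show "- (c * x\<^sup>2) \<le> a * x\<^sup>2" "- (c * y\<^sup>2) \<le> d * y\<^sup>2"
      using mult_right_mono[of "-c" a "x\<^sup>2"] mult_right_mono[of "-c" d "y\<^sup>2"] by auto
  qed
  ultimately have "0 \<le> (2 * c + a) * x\<^sup>2 + (2 * c + d) * y\<^sup>2 + 2 * Re t"
    by (simp add: algebra_simps)
  then show ?thesis unfolding eq by (simp del: of_real_add of_real_mult)
qed

definition cc :: "'a::topological_space set \<Rightarrow> ('a \<Rightarrow> 'b::real_normed_vector) \<Rightarrow> bool" where
  "cc X \<phi> \<longleftrightarrow> continuous_on UNIV \<phi> \<and> (\<exists>C. compact C \<and> C \<subseteq> X \<and> (\<forall>x. x \<notin> C \<longrightarrow> \<phi> x = 0))"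

abbreviation box :: "real \<Rightarrow> (complex \<times> complex) set" where
  "box r \<equiv> cball 0 r \<times> cball 0 r"

lemma cc_bidiscE:
  assumes "cc bidisc \<phi>"
  shows "\<exists>r. 0 < r \<and> r < 1 \<and> (\<forall>x. x \<notin> box r \<longrightarrow> \<phi> x = 0)"
proof -
  from assms obtain C where C: "compact C" "C \<subseteq> bidisc" "\<forall>x. x \<notin> C \<longrightarrow> \<phi> x = 0"
    by (auto simp: cc_def)
  obtain r where "0 < r" "r < 1" "C \<subseteq> box r" by (rule compact_in_bidisc[OF C(1,2)])
  with C(3) show ?thesis by blast
qed

lemma test_on_cc: "test_on U \<phi> \<Longrightarrow> cc U \<phi>"
  unfolding cc_def using test_onD[of U \<phi>] smooth_continuous not_in_supp by metis

lemma cc_linear: "cc X \<phi> \<Longrightarrow> bounded_linear L \<Longrightarrow> cc X (\<lambda>x. L (\<phi> x))"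
  unfolding cc_def
  by (auto simp: linear_simps intro: continuous_intros bounded_linear.continuous_on)

lemma cc_add: 
  assumes "cc X \<phi>" "cc X \<psi>"
  shows "cc X (\<lambda>x. \<phi> x + \<psi> x)"
proof -
  from assms obtain C D where "compact C" "C \<subseteq> X" "\<forall>x. x \<notin> C \<longrightarrow> \<phi> x = 0"
    "compact D" "D \<subseteq> X" "\<forall>x. x \<notin> D \<longrightarrow> \<psi> x = 0" by (auto simp: cc_def)
  then show ?thesis using assms unfolding cc_def
    by (intro conjI continuous_intros exI[of _ "C \<union> D"]) auto
qed

lemma elem_polynomial:
  fixes g :: "complex \<times> complex \<Rightarrow> complex"
  assumes "polynomial_function g"
  shows "elem S g"
proof -
  have "elem S (\<lambda>x. of_real ((Re \<circ> g) x) + \<i> * of_real ((Im \<circ> g) x))"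
    using assms bounded_linear_Re bounded_linear_Im unfolding polynomial_function_def
    by (intro elem_add elem_cmult elem_real_polynomial) blast+
  then show ?thesis by (simp add: complex_eq[symmetric])
qed

lemma test_on_munit: "test_on U \<psi> \<Longrightarrow> test_on U (\<lambda>x. munit j k (\<psi> x))"
  by (rule test_on_linear[OF _ bl_munit])

lemma test_on_cut:
  assumes "0 < r" "r < 1" "elem UNIV g"
  shows "test_on bidisc (\<lambda>x. of_real (cut r ((1 + r)/2) x) * g x)"
proof (rule test_onI[of _ "box ((1+r)/2)"])
  show "smooth (\<lambda>x. of_real (cut r ((1 + r)/2) x) * g x)"
    using assms by (intro elem_imp_smooth elem_mult elem_cut) auto
  show "of_real (cut r ((1 + r)/2) x) * g x = 0" if "x \<notin> box ((1+r)/2)" for x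
    using cut_0[OF _ that] assms by simp
qed (use compact_bidisc_cball[of "(1+r)/2"] assms in auto)

text \<open>A Weierstrass polynomial on the larger bidisc becomes a test function when multiplied by a
  cutoff.  The error does not grow, since \<open>\<psi>\<close> vanishes wherever the cutoff is not \<open>1\<close>.\<close>

lemma scalar_approx:
  fixes \<psi> :: "complex \<times> complex \<Rightarrow> complex"
  assumes "continuous_on UNIV \<psi>" "0 < r" "r < 1" "\<And>x. x \<notin> box r \<Longrightarrow> \<psi> x = 0" "e > 0"
  shows "\<exists>\<eta>. test_on bidisc \<eta> \<and> (\<forall>x. x \<notin> box ((1+r)/2) \<longrightarrow> \<eta> x = 0) \<and> (\<forall>x. cmod (\<eta> x - \<psi> x) \<le> e)"
proof -
  let ?s = "(1+r)/2"
  have "compact (box ?s)" by (rule compact_bidisc_cball[THEN conjunct1]) (use assms in auto)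
  from Stone_Weierstrass_polynomial_function[OF this continuous_on_subset[OF assms(1)] assms(5)]
  obtain g where g: "polynomial_function g" "\<And>x. x \<in> box ?s \<Longrightarrow> cmod (\<psi> x - g x) < e" by auto
  let ?\<eta> = "\<lambda>x. of_real (cut r ?s x) * g x"
  have "cmod (?\<eta> x - \<psi> x) \<le> e" for x
  proof -
    have eq: "?\<eta> x - \<psi> x = of_real (cut r ?s x) * (g x - \<psi> x)"
    proof (cases "x \<in> box r")
      case True
      then show ?thesis using cut_1[of r ?s x] assms by simp
    qed (use assms(4)[of x] in auto)
    show ?thesis
    proof (cases "x \<in> box ?s")
      case True
      have "cmod (?\<eta> x - \<psi> x) \<le> 1 * e"
        unfolding eq norm_mult using cut_range[of r ?s x] g(2)[OF True] assms
        by (intro mult_mono) (auto simp: norm_minus_commute)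
      then show ?thesis by simp
    next
      case False
      then show ?thesis unfolding eq using cut_0[of ?s x r] assms by simp
    qed
  qed
  moreover have "?\<eta> x = 0" if "x \<notin> box ?s" for x using cut_0[of ?s x r] that assms by simp
  ultimately show ?thesis using test_on_cut[OF assms(2,3) elem_polynomial[OF g(1)]] by blast
qed

lemma form_approx:
  fixes \<phi> :: form11
  assumes "continuous_on UNIV \<phi>" "0 < r" "r < 1" "\<And>x. x \<notin> box r \<Longrightarrow> \<phi> x = 0" "e > 0"
  shows "\<exists>\<eta>. test_on bidisc \<eta> \<and> (\<forall>x. x \<notin> box ((1+r)/2) \<longrightarrow> \<eta> x = 0) \<and> (\<forall>x. norm (\<eta> x - \<phi> x) \<le> e)"
proof -
  have "\<exists>\<eta>. test_on bidisc \<eta> \<and> (\<forall>x. x \<notin> box ((1+r)/2) \<longrightarrow> \<eta> x = 0) \<and>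
      (\<forall>x. cmod (\<eta> x - \<phi> x $ j $ k) \<le> e / 4)" for j k
    using assms by (intro scalar_approx) (auto intro!: continuous_intros)
  then obtain \<eta> where \<eta>: "\<And>j k. test_on bidisc (\<eta> j k)"
    "\<And>j k x. x \<notin> box ((1+r)/2) \<Longrightarrow> \<eta> j k x = 0" "\<And>j k x. cmod (\<eta> j k x - \<phi> x $ j $ k) \<le> e / 4"
    by metis
  have "test_on bidisc (\<lambda>x. \<chi> j k. \<eta> j k x)"
  proof -
    have "test_on bidisc (\<lambda>x. \<Sum>j\<in>UNIV. \<Sum>k\<in>UNIV. munit j k (\<eta> j k x))"
      by (intro test_on_sum test_on_munit \<eta>)
    moreover have "(\<Sum>j\<in>UNIV. \<Sum>k\<in>UNIV. munit j k (\<eta> j k x)) = (\<chi> j k. \<eta> j k x)" for x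
      using mat_decomp[of "\<chi> j k. \<eta> j k x"] by simp
    ultimately show ?thesis by simp
  qed
  moreover have "norm ((\<chi> j k. \<eta> j k x) - \<phi> x) \<le> e" for x
    using norm_le_entries[of "(\<chi> j k. \<eta> j k x) - \<phi> x" "e / 4"] \<eta>(3) by simp
  moreover have "(\<chi> j k. \<eta> j k x) = 0" if "x \<notin> box ((1+r)/2)" for x
    using \<eta>(2)[OF that] by (simp add: vec_eq_iff)
  ultimately show ?thesis by (intro exI[of _ "\<lambda>x. \<chi> j k. \<eta> j k x"]) blast
qed

locale pos_current =
  fixes T :: current11
  assumes pos: "positive_current bidisc T"
begin

lemma T_add: "test_on bidisc \<phi> \<Longrightarrow> test_on bidisc \<psi> \<Longrightarrow> T (\<lambda>p. \<phi> p + \<psi> p) = T \<phi> + T \<psi>"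
  using pos unfolding positive_current_def current_def by blast

lemma T_scale: "test_on bidisc \<phi> \<Longrightarrow> T (\<lambda>p. mscale c (\<phi> p)) = c * T \<phi>"
  using pos unfolding positive_current_def current_def mscale_def by blast

lemma T_pos: "test_on bidisc \<phi> \<Longrightarrow> (\<And>p v. qform (\<phi> p) v \<in> \<real>\<^sub>\<ge>\<^sub>0) \<Longrightarrow> T \<phi> \<in> \<real>\<^sub>\<ge>\<^sub>0"
  using pos unfolding positive_current_def positive_form_def qform_def by blast

lemma T_diff: "test_on bidisc \<phi> \<Longrightarrow> test_on bidisc \<psi> \<Longrightarrow> T (\<lambda>p. \<phi> p - \<psi> p) = T \<phi> - T \<psi>"
proof -
  assume a: "test_on bidisc \<phi>" "test_on bidisc \<psi>"
  have e: "mscale (-1) A = - A" for A by (simp add: mscale_def vec_eq_iff)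
  from T_add[OF a(1) test_on_linear[OF a(2) bl_mscale[of "-1"]]] T_scale[OF a(2), of "-1"]
  show ?thesis by (simp add: e)
qed

text \<open>The trace of \<open>T\<close> on a bidisc, smoothed at the boundary.\<close>

definition mass :: "real \<Rightarrow> real" where
  "mass r = Re (T (\<lambda>x. munit 1 1 (of_real (cut r ((1+r)/2) x)) + munit 2 2 (of_real (cut r ((1+r)/2) x))))"

text \<open>Both \<open>2 c \<kappa> id + \<phi>\<close> and \<open>2 c \<kappa> id - \<phi>\<close> are positive forms, for the cutoff \<open>\<kappa>\<close> that is
  \<open>1\<close> where \<open>\<phi>\<close> lives.\<close>

lemma order_zero_hermitian:
  assumes r: "0 < r" "r < 1" and \<phi>: "test_on bidisc \<phi>" "\<And>x. x \<notin> box r \<Longrightarrow> \<phi> x = 0"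
    and c: "\<And>x j k. cmod (\<phi> x $ j $ k) \<le> c" and h: "\<And>x. adj (\<phi> x) = \<phi> x"
  shows "T \<phi> \<in> \<real> \<and> cmod (T \<phi>) \<le> 2 * c * mass r \<and> 0 \<le> mass r"
proof -
  let ?\<kappa> = "cut r ((1+r)/2)"
  let ?I = "\<lambda>x. munit 1 1 (of_real (?\<kappa> x)) + munit 2 2 (of_real (?\<kappa> x))"
  have tI: "test_on bidisc ?I"
    using test_on_cut[OF r elem_const[of _ 1]]
    by (auto intro!: test_on_add test_on_munit)
  have k01: "0 \<le> ?\<kappa> x" for x using cut_range[of r "(1+r)/2" x] r by auto
  have TI: "T ?I \<in> \<real>\<^sub>\<ge>\<^sub>0"
  proof (rule T_pos[OF tI])
    fix p v
    have "qform (munit 1 1 (2 * (?\<kappa> p / 2)) + munit 2 2 (2 * (?\<kappa> p / 2)) + 0) v \<in> \<real>\<^sub>\<ge>\<^sub>0"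
      using qform_hermitian_nonneg[of 0 "?\<kappa> p / 2" v] k01[of p] by (simp add: adj_def vec_eq_iff)
    then show "qform (munit 1 1 (of_real (?\<kappa> p)) + munit 2 2 (of_real (?\<kappa> p))) v \<in> \<real>\<^sub>\<ge>\<^sub>0" by simp
  qed
  then have TI': "T ?I = of_real (mass r)" "mass r \<ge> 0"
    by (auto simp: mass_def complex_nonneg_Reals_iff complex_eq_iff)
  \<comment> \<open>positivity for both signs says that \<open>T \<phi>\<close> is real and gives the bound\<close>
  have key: "of_real (2 * c * mass r) + s * T \<phi> \<in> \<real>\<^sub>\<ge>\<^sub>0" if s: "s = 1 \<or> s = -1" for s :: complex
  proof -
    have "T (\<lambda>p. mscale (2 * c) (?I p) + mscale s (\<phi> p)) \<in> \<real>\<^sub>\<ge>\<^sub>0"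
    proof (rule T_pos)
      show "test_on bidisc (\<lambda>p. mscale (2 * c) (?I p) + mscale s (\<phi> p))"
        by (intro test_on_add test_on_linear[OF tI bl_mscale] test_on_linear[OF \<phi>(1) bl_mscale])
      fix p v
      have "cmod (mscale s (\<phi> p) $ j $ k) \<le> c * ?\<kappa> p" for j k
      proof (cases "p \<in> box r")
        case True
        then show ?thesis using cut_1[of r "(1+r)/2" p] r c[of p j k] s by (auto simp: mscale_def norm_mult)
      next
        case False
        have "c \<ge> 0" using c[of p 1 1] norm_ge_zero order_trans by blast
        then show ?thesis using \<phi>(2)[OF False] k01[of p] by (simp add: mscale_def)
      qed
      moreover have "adj (mscale s (\<phi> p)) = mscale s (\<phi> p)"
        using h[of p] s by (auto simp: adj_def mscale_def vec_eq_iff)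
      ultimately have "qform (munit 1 1 (2 * (c * ?\<kappa> p)) + munit 2 2 (2 * (c * ?\<kappa> p)) + mscale s (\<phi> p)) v \<in> \<real>\<^sub>\<ge>\<^sub>0"
        using qform_hermitian_nonneg[of "mscale s (\<phi> p)" "c * ?\<kappa> p" v] by simp
      moreover have "mscale (2 * c) (?I p) = munit 1 1 (2 * (c * ?\<kappa> p)) + munit 2 2 (2 * (c * ?\<kappa> p))"
        by (auto simp: mscale_def munit_def vec_eq_iff)
      ultimately show "qform (mscale (2 * c) (?I p) + mscale s (\<phi> p)) v \<in> \<real>\<^sub>\<ge>\<^sub>0" by simp
    qed
    moreover have "T (\<lambda>p. mscale (2 * c) (?I p) + mscale s (\<phi> p)) = 2 * c * T ?I + s * T \<phi>"
      using T_add[OF test_on_linear[OF tI bl_mscale] test_on_linear[OF \<phi>(1) bl_mscale]]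
        T_scale[OF tI] T_scale[OF \<phi>(1)] by metis
    ultimately show ?thesis using TI' by simp
  qed
  from key[of 1] key[of "-1"] TI'(2) show ?thesis
    by (auto simp: complex_nonneg_Reals_iff complex_is_Real_iff cmod_eq_Re)
qed

text \<open>Any form is \<open>h1 + \<i> h2\<close> with Hermitian \<open>h1\<close> and \<open>h2\<close>, on which \<open>T\<close> is real.\<close>

lemma T_adj_and_bound:
  assumes r: "0 < r" "r < 1" and \<phi>: "test_on bidisc \<phi>" "\<And>x. x \<notin> box r \<Longrightarrow> \<phi> x = 0"
    and c: "\<And>x j k. cmod (\<phi> x $ j $ k) \<le> c"
  shows "T (\<lambda>x. adj (\<phi> x)) = cnj (T \<phi>) \<and> cmod (T \<phi>) \<le> 4 * c * mass r"
proof -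
  define h1 where "h1 = (\<lambda>x. mscale (1/2) (\<phi> x + adj (\<phi> x)))"
  define h2 where "h2 = (\<lambda>x. mscale (-\<i>/2) (\<phi> x + mscale (-1) (adj (\<phi> x))))"
  note adjt = test_on_linear[OF \<phi>(1) bl_adj]
  have t1: "test_on bidisc h1" unfolding h1_def
    by (intro test_on_linear[OF test_on_add[OF \<phi>(1) adjt] bl_mscale])
  have t2: "test_on bidisc h2" unfolding h2_def
    by (intro test_on_linear[OF test_on_add[OF \<phi>(1) test_on_linear[OF adjt bl_mscale]] bl_mscale])
  have b: "cmod ((a + cnj d) / 2) \<le> c" "cmod (\<i> * (a - cnj d) / 2) \<le> c" if "cmod a \<le> c" "cmod d \<le> c" for a d
    using that norm_triangle_ineq[of a "cnj d"] norm_triangle_ineq4[of a "cnj d"]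
    by (auto simp: norm_divide norm_mult)
  have H1: "T h1 \<in> \<real> \<and> cmod (T h1) \<le> 2 * c * mass r \<and> 0 \<le> mass r"
  proof (rule order_zero_hermitian[OF r t1])
    show "cmod (h1 x $ j $ k) \<le> c" for x j k
      using b(1)[OF c[of x j k] c[of x k j]] by (simp add: h1_def mscale_def adj_def)
  qed (auto simp: h1_def \<phi>(2) adj_def mscale_def vec_eq_iff)
  have H2: "T h2 \<in> \<real> \<and> cmod (T h2) \<le> 2 * c * mass r \<and> 0 \<le> mass r"
  proof (rule order_zero_hermitian[OF r t2])
    show "cmod (h2 x $ j $ k) \<le> c" for x j k
      using b(2)[OF c[of x j k] c[of x k j]] by (simp add: h2_def mscale_def adj_def norm_mult norm_divide)
  qed (auto simp: h2_def \<phi>(2) adj_def mscale_def vec_eq_iff algebra_simps)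
  have e1: "\<phi> = (\<lambda>x. h1 x + mscale \<i> (h2 x))"
    by (auto simp: fun_eq_iff h1_def h2_def mscale_def adj_def vec_eq_iff field_simps)
  have e2: "(\<lambda>x. adj (\<phi> x)) = (\<lambda>x. h1 x + mscale (-\<i>) (h2 x))"
    by (auto simp: fun_eq_iff h1_def h2_def mscale_def adj_def vec_eq_iff field_simps)
  have T1: "T \<phi> = T h1 + \<i> * T h2"
    using T_add[OF t1 test_on_linear[OF t2 bl_mscale[of \<i>]]] T_scale[OF t2, of \<i>] e1 by metis
  have T2: "T (\<lambda>x. adj (\<phi> x)) = T h1 + (-\<i>) * T h2"
    unfolding e2 using T_add[OF t1 test_on_linear[OF t2 bl_mscale[of "-\<i>"]]] T_scale[OF t2, of "-\<i>"] by metis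
  have "cmod (T \<phi>) \<le> cmod (T h1) + cmod (T h2)"
    unfolding T1 by (rule order_trans[OF norm_triangle_ineq]) (simp add: norm_mult)
  with H1 H2 have "cmod (T \<phi>) \<le> 4 * c * mass r" by linarith
  moreover have "T (\<lambda>x. adj (\<phi> x)) = cnj (T \<phi>)"
    unfolding T1 T2 using H1 H2 by (auto simp: Reals_cnj_iff)
  ultimately show ?thesis by blast
qed

lemma mass_nonneg: "0 < r \<Longrightarrow> r < 1 \<Longrightarrow> 0 \<le> mass r"
  using order_zero_hermitian[of r "\<lambda>_. 0" 1] test_on_0[of bidisc]
  by (auto simp: adj_def vec_eq_iff)

lemma T_bound_norm:
  assumes r: "0 < r" "r < 1" and \<phi>: "test_on bidisc \<phi>" "\<And>x. x \<notin> box r \<Longrightarrow> \<phi> x = 0"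
    and c: "\<And>x. norm (\<phi> x) \<le> c"
  shows "cmod (T \<phi>) \<le> 4 * c * mass r"
  using T_adj_and_bound[OF r \<phi>] order_trans[OF entry_le_norm c] by blast

section \<open>Extension to continuous forms\<close>

lemma approximatesE:
  fixes \<phi> :: form11
  assumes "approximates bidisc \<psi> \<phi>"
  obtains r where "0 < r" "r < 1" "\<And>n. test_on bidisc (\<psi> n)" "\<And>n x. x \<notin> box r \<Longrightarrow> \<psi> n x = 0"
    "\<And>e. e > 0 \<Longrightarrow> \<exists>N. \<forall>n\<ge>N. \<forall>x. norm (\<psi> n x - \<phi> x) \<le> e"
proof -
  from assms obtain C where C: "compact C" "C \<subseteq> bidisc" "\<And>n. test_on bidisc (\<psi> n)" "\<And>n. supp (\<psi> n) \<subseteq> C"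
    and u: "uniform_limit UNIV \<psi> \<phi> sequentially" unfolding approximates_def by auto
  obtain r where r: "0 < r" "r < 1" "C \<subseteq> box r" by (rule compact_in_bidisc[OF C(1,2)])
  show ?thesis
  proof (rule that[OF r(1,2) C(3)])
    show "\<psi> n x = 0" if "x \<notin> box r" for n x
      using not_in_supp[of x "\<psi> n"] that C(4) r(3) by blast
    show "\<exists>N. \<forall>n\<ge>N. \<forall>x. norm (\<psi> n x - \<phi> x) \<le> e" if "e > 0" for e
      using uniform_limitD[OF u that] unfolding eventually_sequentially dist_norm
      by (meson UNIV_I less_imp_le)
  qed
qed

lemma approximatesI:
  fixes \<phi> :: form11
  assumes "r < 1" "\<And>n. test_on bidisc (\<psi> n)" "\<And>n x. x \<notin> box r \<Longrightarrow> \<psi> n x = 0"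
    "\<And>n x. norm (\<psi> n x - \<phi> x) \<le> e n" "e \<longlonglongrightarrow> 0"
  shows "approximates bidisc \<psi> \<phi>"
  unfolding approximates_def
proof
  have "supp (\<psi> n) \<subseteq> box r" for n
    by (rule supp_subset) (use assms compact_bidisc_cball[of r] compact_imp_closed in auto)
  then show "\<exists>C. compact C \<and> C \<subseteq> bidisc \<and> (\<forall>n. test_on bidisc (\<psi> n) \<and> supp (\<psi> n) \<subseteq> C)"
    using compact_bidisc_cball[OF assms(1)] assms(2) by blast
  show "uniform_limit UNIV \<psi> \<phi> sequentially"
    unfolding uniform_limit_iff
  proof (intro allI impI)
    fix d :: real assume "d > 0"
    then have "\<forall>\<^sub>F n in sequentially. e n < d" using assms(5) by (rule order_tendstoD(2)[rotated])
    then show "\<forall>\<^sub>F n in sequentially. \<forall>x\<in>UNIV. dist (\<psi> n x) (\<phi> x) < d"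
      by eventually_elim (use assms(4) in \<open>auto simp: dist_norm intro: le_less_trans\<close>)
  qed
qed

lemma approximates_exists:
  fixes \<phi> :: form11
  assumes "continuous_on UNIV \<phi>" "0 < r" "r < 1" "\<And>x. x \<notin> box r \<Longrightarrow> \<phi> x = 0"
  shows "\<exists>\<psi>. approximates bidisc \<psi> \<phi> \<and> (\<forall>n x. x \<notin> box ((1+r)/2) \<longrightarrow> \<psi> n x = 0) \<and>
    (\<forall>n x. norm (\<psi> n x - \<phi> x) \<le> inverse (real (Suc n))) \<and> (\<forall>n. test_on bidisc (\<psi> n))"
proof -
  have "\<forall>n. \<exists>\<eta>. test_on bidisc \<eta> \<and> (\<forall>x. x \<notin> box ((1+r)/2) \<longrightarrow> \<eta> x = 0) \<and>
     (\<forall>x. norm (\<eta> x - \<phi> x) \<le> inverse (real (Suc n)))"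
    using form_approx[OF assms] by simp
  then obtain \<psi> where \<psi>: "\<And>n. test_on bidisc (\<psi> n)" "\<And>n x. x \<notin> box ((1+r)/2) \<Longrightarrow> \<psi> n x = 0"
    "\<And>n x. norm (\<psi> n x - \<phi> x) \<le> inverse (real (Suc n))" by metis
  have "approximates bidisc \<psi> \<phi>"
    by (rule approximatesI[OF _ \<psi> LIMSEQ_inverse_real_of_nat]) (use assms in auto)
  then show ?thesis using \<psi> by blast
qed

lemma T_close:
  assumes r: "0 < r" "r < 1" and \<phi>: "test_on bidisc \<phi>" "\<And>x. x \<notin> box r \<Longrightarrow> \<phi> x = 0"
    and \<psi>: "test_on bidisc \<psi>" "\<And>x. x \<notin> box r \<Longrightarrow> \<psi> x = 0"
    and c: "\<And>x. norm (\<phi> x - \<psi> x) \<le> c"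
  shows "cmod (T \<phi> - T \<psi>) \<le> 4 * c * mass r"
proof -
  have "test_on bidisc (\<lambda>x. \<phi> x - \<psi> x)"
  proof -
    have "mscale (-1) A = - A" for A by (simp add: mscale_def vec_eq_iff)
    then show ?thesis using test_on_add[OF \<phi>(1) test_on_linear[OF \<psi>(1) bl_mscale[of "-1"]]] by simp
  qed
  from T_bound_norm[OF r this _ c] T_diff[OF \<phi>(1) \<psi>(1)] \<phi>(2) \<psi>(2) show ?thesis by simp
qed

lemma approximates_T_diff:
  assumes "approximates bidisc \<psi> \<phi>" "approximates bidisc \<psi>' \<phi>"
  shows "\<forall>e>0. \<exists>N. \<forall>m\<ge>N. \<forall>n\<ge>N. cmod (T (\<psi> m) - T (\<psi>' n)) < e"
proof (intro allI impI)
  fix e :: real assume e: "e > 0"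
  obtain r where r: "0 < r" "r < 1" "\<And>n. test_on bidisc (\<psi> n)" "\<And>n x. x \<notin> box r \<Longrightarrow> \<psi> n x = 0"
    "\<And>e. e > 0 \<Longrightarrow> \<exists>N. \<forall>n\<ge>N. \<forall>x. norm (\<psi> n x - \<phi> x) \<le> e"
    by (rule approximatesE[OF assms(1)]) blast
  obtain s where s: "0 < s" "s < 1" "\<And>n. test_on bidisc (\<psi>' n)" "\<And>n x. x \<notin> box s \<Longrightarrow> \<psi>' n x = 0"
    "\<And>e. e > 0 \<Longrightarrow> \<exists>N. \<forall>n\<ge>N. \<forall>x. norm (\<psi>' n x - \<phi> x) \<le> e"
    by (rule approximatesE[OF assms(2)]) blast
  let ?t = "max r s"
  have t: "0 < ?t" "?t < 1" using r s by auto
  have bx: "box r \<subseteq> box ?t" "box s \<subseteq> box ?t" by (auto intro: order_trans)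
  let ?d = "e / (8 * mass ?t + 8)"
  have m: "mass ?t \<ge> 0" by (rule mass_nonneg[OF t])
  then have d: "?d > 0" using e by simp
  obtain M N where M: "\<forall>n\<ge>M. \<forall>x. norm (\<psi> n x - \<phi> x) \<le> ?d" and N: "\<forall>n\<ge>N. \<forall>x. norm (\<psi>' n x - \<phi> x) \<le> ?d"
    using r(5)[OF d] s(5)[OF d] by blast
  have "cmod (T (\<psi> m) - T (\<psi>' n)) < e" if "m \<ge> max M N" "n \<ge> max M N" for m n
  proof -
    have "norm (\<psi> m x - \<psi>' n x) \<le> 2 * ?d" for x
    proof -
      have "norm (\<psi> m x - \<psi>' n x) \<le> norm (\<psi> m x - \<phi> x) + norm (\<psi>' n x - \<phi> x)"
        by (metis dist_norm dist_triangle2)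
      then show ?thesis using M N that by (smt (verit, best) max.bounded_iff)
    qed
    then have "cmod (T (\<psi> m) - T (\<psi>' n)) \<le> 4 * (2 * ?d) * mass ?t"
      using r(4) s(4) bx by (intro T_close[OF t r(3) _ s(3)]) blast+
    also have "\<dots> < e" using m e by (simp add: field_simps)
    finally show ?thesis .
  qed
  then show "\<exists>N. \<forall>m\<ge>N. \<forall>n\<ge>N. cmod (T (\<psi> m) - T (\<psi>' n)) < e" by blast
qed

text \<open>By the bound on \<open>T\<close>, its values along approximating sequences are Cauchy and the limit does
  not depend on the sequence.  So the definite description in \<open>cont_ext\<close> is satisfied.\<close>

lemma cont_ext_lim:
  assumes "approximates bidisc \<psi> \<phi>"
  shows "(\<lambda>n. T (\<psi> n)) \<longlonglongrightarrow> cont_ext bidisc T \<phi>"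
proof -
  have "Cauchy (\<lambda>n. T (\<psi> n))"
    using approximates_T_diff[OF assms assms] by (auto simp: Cauchy_def dist_norm)
  then obtain c where c: "(\<lambda>n. T (\<psi> n)) \<longlonglongrightarrow> c"
    using Cauchy_convergent convergent_def by blast
  have all: "(\<lambda>n. T (\<psi>' n)) \<longlonglongrightarrow> c" if "approximates bidisc \<psi>' \<phi>" for \<psi>'
  proof -
    have "(\<lambda>n. T (\<psi> n) - T (\<psi>' n)) \<longlonglongrightarrow> 0"
      using approximates_T_diff[OF assms that] unfolding LIMSEQ_iff by (metis diff_zero)
    from tendsto_diff[OF c this] show ?thesis by simp
  qed
  have "cont_ext bidisc T \<phi> = c"
    unfolding cont_ext_def
  proof (rule the_equality)
    show "\<forall>\<psi>. approximates bidisc \<psi> \<phi> \<longrightarrow> (\<lambda>n. T (\<psi> n)) \<longlonglongrightarrow> c" using all by blast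
    show "d = c" if "\<forall>\<psi>. approximates bidisc \<psi> \<phi> \<longrightarrow> (\<lambda>n. T (\<psi> n)) \<longlonglongrightarrow> d" for d
      using that assms c LIMSEQ_unique by blast
  qed
  then show ?thesis using c by simp
qed

abbreviation "TE \<equiv> cont_ext bidisc T"

lemma TE_test: "test_on bidisc \<phi> \<Longrightarrow> TE \<phi> = T \<phi>"
proof -
  assume t: "test_on bidisc \<phi>"
  have "approximates bidisc (\<lambda>_. \<phi>) \<phi>"
    using test_onD[OF t] t unfolding approximates_def
    by (auto intro!: exI[of _ "supp \<phi>"] uniform_limit_const)
  from cont_ext_lim[OF this] show ?thesis by (simp add: LIMSEQ_const_iff)
qed

lemma TE_bound:
  assumes "0 < r" "r < 1"
  shows "\<exists>M\<ge>0. \<forall>\<phi> c. continuous_on UNIV \<phi> \<longrightarrow> (\<forall>x. x \<notin> box r \<longrightarrow> \<phi> x = 0) \<longrightarrow>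
     (\<forall>x. norm (\<phi> x) \<le> c) \<longrightarrow> cmod (TE \<phi>) \<le> M * c"
proof (intro exI conjI allI impI)
  let ?s = "(1+r)/2"
  have s: "0 < ?s" "?s < 1" using assms by auto
  show "0 \<le> 4 * mass ?s" using mass_nonneg[OF s] by simp
  fix \<phi> :: form11 and c assume \<phi>: "continuous_on UNIV \<phi>" "\<forall>x. x \<notin> box r \<longrightarrow> \<phi> x = 0" "\<forall>x. norm (\<phi> x) \<le> c"
  obtain \<psi> where \<psi>: "approximates bidisc \<psi> \<phi>" "\<And>n x. x \<notin> box ?s \<Longrightarrow> \<psi> n x = 0"
    "\<And>n x. norm (\<psi> n x - \<phi> x) \<le> inverse (real (Suc n))" "\<And>n. test_on bidisc (\<psi> n)"
    using approximates_exists[OF \<phi>(1) assms \<phi>(2)[rule_format]] by blast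
  have "cmod (T (\<psi> n)) \<le> 4 * (c + inverse (real (Suc n))) * mass ?s" for n
  proof (rule T_bound_norm[OF s \<psi>(4) \<psi>(2)])
    show "norm (\<psi> n x) \<le> c + inverse (real (Suc n))" for x
      using \<psi>(3)[of n x] \<phi>(3) norm_triangle_sub[of "\<psi> n x" "\<phi> x"] by (smt (verit))
  qed
  moreover have "(\<lambda>n. 4 * (c + inverse (real (Suc n))) * mass ?s) \<longlonglongrightarrow> 4 * (c + 0) * mass ?s"
    by (intro tendsto_intros LIMSEQ_inverse_real_of_nat)
  ultimately have "cmod (TE \<phi>) \<le> 4 * (c + 0) * mass ?s"
    using tendsto_norm[OF cont_ext_lim[OF \<psi>(1)]] by (intro LIMSEQ_le) auto
  then show "cmod (TE \<phi>) \<le> 4 * mass ?s * c" by (simp add: mult_ac)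
qed

text \<open>The map \<open>R\<close> is arbitrary because the lemma also serves the adjoint, for which \<open>R\<close> is complex
  conjugation.\<close>

lemma TE_linear_gen:
  fixes \<phi> :: form11
  assumes "cc bidisc \<phi>" and L: "bounded_linear L"
    and *: "\<And>\<eta>. test_on bidisc \<eta> \<Longrightarrow> T (\<lambda>x. L (\<eta> x)) = R (T \<eta>)" and R: "\<And>z. isCont R z"
  shows "TE (\<lambda>x. L (\<phi> x)) = R (TE \<phi>)"
proof -
  obtain r where r: "0 < r" "r < 1" "\<And>x. x \<notin> box r \<Longrightarrow> \<phi> x = 0" using cc_bidiscE[OF assms(1)] by blast
  obtain \<psi> where \<psi>: "approximates bidisc \<psi> \<phi>" "\<And>n x. x \<notin> box ((1+r)/2) \<Longrightarrow> \<psi> n x = 0"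
    "\<And>n x. norm (\<psi> n x - \<phi> x) \<le> inverse (real (Suc n))" "\<And>n. test_on bidisc (\<psi> n)"
    using approximates_exists[OF conjunct1[OF assms(1)[unfolded cc_def]] r] by blast
  obtain B where B: "B > 0" "\<And>x. norm (L x) \<le> norm x * B" using bounded_linear.pos_bounded[OF L] by blast
  have "approximates bidisc (\<lambda>n x. L (\<psi> n x)) (\<lambda>x. L (\<phi> x))"
  proof (rule approximatesI[where e = "\<lambda>n. inverse (real (Suc n)) * B"])
    show "norm (L (\<psi> n x) - L (\<phi> x)) \<le> inverse (real (Suc n)) * B" for n x
    proof -
      have "norm (L (\<psi> n x) - L (\<phi> x)) \<le> norm (\<psi> n x - \<phi> x) * B"
        using B(2)[of "\<psi> n x - \<phi> x"] by (simp add: linear_diff[OF bounded_linear.linear[OF L]])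
      also have "\<dots> \<le> inverse (real (Suc n)) * B" using \<psi>(3) B(1) by (intro mult_right_mono) auto
      finally show ?thesis .
    qed
    show "(\<lambda>n. inverse (real (Suc n)) * B) \<longlonglongrightarrow> 0"
      using tendsto_mult_left_zero[OF LIMSEQ_inverse_real_of_nat] by blast
    show "(1+r)/2 < 1" using r by simp
    show "test_on bidisc (\<lambda>x. L (\<psi> n x))" for n by (rule test_on_linear[OF \<psi>(4) L])
    show "L (\<psi> n x) = 0" if "x \<notin> box ((1+r)/2)" for n x
      using \<psi>(2)[OF that] linear_0[OF bounded_linear.linear[OF L]] by simp
  qed
  from cont_ext_lim[OF this] have "(\<lambda>n. R (T (\<psi> n))) \<longlonglongrightarrow> TE (\<lambda>x. L (\<phi> x))" by (simp add: * \<psi>(4))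
  moreover have "(\<lambda>n. R (T (\<psi> n))) \<longlonglongrightarrow> R (TE \<phi>)"
    by (rule isCont_tendsto_compose[OF R cont_ext_lim[OF \<psi>(1)]])
  ultimately show ?thesis using LIMSEQ_unique by blast
qed

lemma TE_scale: "cc bidisc \<phi> \<Longrightarrow> TE (\<lambda>x. mscale c (\<phi> x)) = c * TE \<phi>"
  by (rule TE_linear_gen[OF _ bl_mscale]) (auto simp: T_scale)

lemma T_adj: "test_on bidisc \<phi> \<Longrightarrow> T (\<lambda>x. adj (\<phi> x)) = cnj (T \<phi>)"
proof -
  assume t: "test_on bidisc \<phi>"
  obtain r where r: "0 < r" "r < 1" "\<And>x. x \<notin> box r \<Longrightarrow> \<phi> x = 0" using cc_bidiscE[OF test_on_cc[OF t]] by blast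
  have "bounded (\<phi> ` box r)"
    using smooth_continuous[OF test_onD(1)[OF t]] compact_bidisc_cball[OF r(2)]
    by (intro compact_imp_bounded compact_continuous_image) auto
  then obtain c where c: "\<And>x. x \<in> box r \<Longrightarrow> norm (\<phi> x) \<le> c" "c > 0"
    unfolding bounded_pos by blast
  have "norm (\<phi> x) \<le> c" for x using c r(3)[of x] by (cases "x \<in> box r") auto
  then show ?thesis using T_adj_and_bound[OF r(1,2) t r(3)] order_trans[OF entry_le_norm] by blast
qed

lemma TE_adj: "cc bidisc \<phi> \<Longrightarrow> TE (\<lambda>x. adj (\<phi> x)) = cnj (TE \<phi>)"
  by (rule TE_linear_gen[OF _ bl_adj]) (auto simp: T_adj)

lemma TE_add:
  fixes \<phi> \<psi> :: form11
  assumes "cc bidisc \<phi>" "cc bidisc \<psi>"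
  shows "TE (\<lambda>x. \<phi> x + \<psi> x) = TE \<phi> + TE \<psi>"
proof -
  obtain r1 where r1: "0 < r1" "r1 < 1" "\<And>x. x \<notin> box r1 \<Longrightarrow> \<phi> x = 0" using cc_bidiscE[OF assms(1)] by blast
  obtain r2 where r2: "0 < r2" "r2 < 1" "\<And>x. x \<notin> box r2 \<Longrightarrow> \<psi> x = 0" using cc_bidiscE[OF assms(2)] by blast
  define r where "r = max r1 r2"
  have r: "0 < r" "r < 1" using r1 r2 by (auto simp: r_def)
  have bx: "box r1 \<subseteq> box r" "box r2 \<subseteq> box r" by (auto simp: r_def intro: order_trans)
  have r1': "\<And>x. x \<notin> box r \<Longrightarrow> \<phi> x = 0" and r2': "\<And>x. x \<notin> box r \<Longrightarrow> \<psi> x = 0"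
    using r1(3) r2(3) bx by blast+
  obtain a where a: "approximates bidisc a \<phi>" "\<And>n x. x \<notin> box ((1+r)/2) \<Longrightarrow> a n x = 0"
    "\<And>n x. norm (a n x - \<phi> x) \<le> inverse (real (Suc n))" "\<And>n. test_on bidisc (a n)"
    using approximates_exists[OF conjunct1[OF assms(1)[unfolded cc_def]] r r1'] by blast
  obtain b where b: "approximates bidisc b \<psi>" "\<And>n x. x \<notin> box ((1+r)/2) \<Longrightarrow> b n x = 0"
    "\<And>n x. norm (b n x - \<psi> x) \<le> inverse (real (Suc n))" "\<And>n. test_on bidisc (b n)"
    using approximates_exists[OF conjunct1[OF assms(2)[unfolded cc_def]] r r2'] by blast
  have "approximates bidisc (\<lambda>n x. a n x + b n x) (\<lambda>x. \<phi> x + \<psi> x)"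
  proof (rule approximatesI[where e = "\<lambda>n. inverse (real (Suc n)) + inverse (real (Suc n))"])
    show "norm (a n x + b n x - (\<phi> x + \<psi> x)) \<le> inverse (real (Suc n)) + inverse (real (Suc n))" for n x
      using norm_triangle_mono[OF a(3)[of n x] b(3)[of n x]] by (simp add: algebra_simps)
    show "(\<lambda>n. inverse (real (Suc n)) + inverse (real (Suc n))) \<longlonglongrightarrow> 0"
      using tendsto_add[OF LIMSEQ_inverse_real_of_nat LIMSEQ_inverse_real_of_nat] by simp
    show "(1+r)/2 < 1" using r by simp
    show "test_on bidisc (\<lambda>x. a n x + b n x)" for n by (rule test_on_add[OF a(4) b(4)])
  qed (use a(2) b(2) in auto)
  from cont_ext_lim[OF this] have "(\<lambda>n. T (a n) + T (b n)) \<longlonglongrightarrow> TE (\<lambda>x. \<phi> x + \<psi> x)"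
    by (simp add: T_add a(4) b(4))
  then show ?thesis using tendsto_add[OF cont_ext_lim[OF a(1)] cont_ext_lim[OF b(1)]] LIMSEQ_unique by blast
qed

text \<open>Approximating test functions need not be nonnegative; adding a small multiple of a cutoff
  to their real parts repairs this.\<close>

lemma TE_pos:
  fixes \<psi> :: "complex \<times> complex \<Rightarrow> real"
  assumes "cc bidisc \<psi>" "\<And>x. \<psi> x \<ge> 0"
  shows "TE (\<lambda>x. munit 1 1 (of_real (\<psi> x))) \<in> \<real>\<^sub>\<ge>\<^sub>0"
proof -
  obtain r where r: "0 < r" "r < 1" "\<And>x. x \<notin> box r \<Longrightarrow> \<psi> x = 0" using cc_bidiscE[OF assms(1)] by blast
  define s where "s = (1+r)/2"
  have s: "0 < s" "s < 1" using r by (auto simp: s_def)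
  have cont: "continuous_on UNIV (\<lambda>x. complex_of_real (\<psi> x))"
    using assms(1) by (auto simp: cc_def intro: continuous_intros)
  have "\<forall>n. \<exists>\<eta>. test_on bidisc \<eta> \<and> (\<forall>x. x \<notin> box s \<longrightarrow> \<eta> x = 0) \<and> (\<forall>x. cmod (\<eta> x - of_real (\<psi> x)) \<le> inverse (real (Suc n)))"
    unfolding s_def using scalar_approx[OF cont r(1,2)] r(3) by simp
  then obtain \<eta> where \<eta>: "\<And>n. test_on bidisc (\<eta> n)" "\<And>n x. x \<notin> box s \<Longrightarrow> \<eta> n x = 0"
     "\<And>n x. cmod (\<eta> n x - of_real (\<psi> x)) \<le> inverse (real (Suc n))" by metis
  let ?\<kappa> = "cut s ((1+s)/2)"
  define h where "h n x = Re (\<eta> n x) + inverse (real (Suc n)) * ?\<kappa> x" for n x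
  have hE: "complex_of_real (h n x) = of_real (Re (\<eta> n x)) + of_real (?\<kappa> x) * of_real (inverse (real (Suc n)))" for n x
    by (simp add: h_def)
  have "bounded_linear (\<lambda>z. complex_of_real (Re z))"
    by (rule bounded_linear_compose[OF bounded_linear_of_real bounded_linear_Re])
  then have th: "test_on bidisc (\<lambda>x. complex_of_real (h n x))" for n
    unfolding hE by (intro test_on_add test_on_linear[OF \<eta>(1)] test_on_cut[OF s] elem_const)
  have k01: "0 \<le> ?\<kappa> x \<and> ?\<kappa> x \<le> 1" for x using cut_range[of s "(1+s)/2" x] s by auto
  have hpos: "h n x \<ge> 0" for n x
  proof (cases "x \<in> box s")
    case True
    have "?\<kappa> x = 1" using cut_1[OF _ _ True, of "(1+s)/2"] s by simp
    moreover have "\<bar>Re (\<eta> n x) - \<psi> x\<bar> \<le> inverse (real (Suc n))"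
      using abs_Re_le_cmod[of "\<eta> n x - of_real (\<psi> x)"] \<eta>(3)[of n x] by simp
    ultimately show ?thesis unfolding h_def using assms(2)[of x] by simp
  next
    case False
    then show ?thesis using \<eta>(2)[OF False] k01 by (simp add: h_def)
  qed
  have "approximates bidisc (\<lambda>n x. munit 1 1 (of_real (h n x))) (\<lambda>x. munit 1 1 (of_real (\<psi> x)))"
  proof (rule approximatesI[where e = "\<lambda>n. 4 * (2 * inverse (real (Suc n)))"])
    show "(1+s)/2 < 1" using s by simp
    show "test_on bidisc (\<lambda>x. munit 1 1 (of_real (h n x)))" for n by (rule test_on_munit[OF th])
    show "munit 1 1 (complex_of_real (h n x)) = 0" if "x \<notin> box ((1+s)/2)" for n x
    proof -
      have "x \<notin> box s" using that s by (auto simp: not_le)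
      then have "h n x = 0" using \<eta>(2) cut_0[OF _ that, of s] s by (simp add: h_def)
      then show ?thesis by (simp add: munit_def vec_eq_iff)
    qed
    show "norm (munit 1 1 (complex_of_real (h n x)) - munit 1 1 (complex_of_real (\<psi> x))) \<le> 4 * (2 * inverse (real (Suc n)))" for n x
    proof (rule norm_le_entries)
      have "\<bar>Re (\<eta> n x) - \<psi> x\<bar> \<le> inverse (real (Suc n))"
        using abs_Re_le_cmod[of "\<eta> n x - of_real (\<psi> x)"] \<eta>(3)[of n x] by simp
      moreover have "0 \<le> inverse (real (Suc n)) * ?\<kappa> x" "inverse (real (Suc n)) * ?\<kappa> x \<le> inverse (real (Suc n)) * 1"
        using k01[of x] by (intro mult_nonneg_nonneg mult_left_mono; simp)+
      ultimately have "\<bar>h n x - \<psi> x\<bar> \<le> 2 * inverse (real (Suc n))" unfolding h_def by linarith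
      then show "cmod ((munit 1 1 (complex_of_real (h n x)) - munit 1 1 (complex_of_real (\<psi> x))) $ j $ k)
          \<le> 2 * inverse (real (Suc n))" for j k
        by (auto simp: munit_def simp flip: of_real_diff)
    qed
    show "(\<lambda>n. 4 * (2 * inverse (real (Suc n)))) \<longlonglongrightarrow> 0"
      using tendsto_mult_right_zero[OF tendsto_mult_right_zero[OF LIMSEQ_inverse_real_of_nat]] by blast
  qed
  from cont_ext_lim[OF this] have lim: "(\<lambda>n. T (\<lambda>x. munit 1 1 (of_real (h n x)))) \<longlonglongrightarrow> TE (\<lambda>x. munit 1 1 (of_real (\<psi> x)))" .
  have "T (\<lambda>x. munit 1 1 (of_real (h n x))) \<in> \<real>\<^sub>\<ge>\<^sub>0" for n
  proof (rule T_pos[OF test_on_munit[OF th]])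
    fix p v
    have "qform (munit 1 1 (of_real (h n p))) v = of_real (h n p * (cmod (v $ 1))\<^sup>2)"
      by (simp add: qform_def sum_2 munit_def complex_norm_square del: of_real_power)
    also have "\<dots> \<in> \<real>\<^sub>\<ge>\<^sub>0" using hpos by (simp del: of_real_mult of_real_power)
    finally show "qform (munit 1 1 (of_real (h n p))) v \<in> \<real>\<^sub>\<ge>\<^sub>0" .
  qed
  then show ?thesis
    using closed_sequentially[OF closed_nonneg_Reals_complex _ lim] by simp
qed

end

section \<open>The Riesz representation theorem\<close>

lemma cc_mult:
  fixes g h :: "'a::topological_space \<Rightarrow> real"
  assumes "cc X g" "continuous_on UNIV h"
  shows "cc X (\<lambda>x. h x * g x)"
  using assms unfolding cc_def by (auto intro!: continuous_intros)

lemma cc_scale: "cc X (g :: _ \<Rightarrow> real) \<Longrightarrow> cc X (\<lambda>x. c * g x)"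
  by (rule cc_mult) (auto intro: continuous_intros)

lemma cc_0: "cc X (\<lambda>_. 0)"
  unfolding cc_def by (auto intro!: exI[of _ "{}"])

lemma cc_sum: "(\<And>i. i \<in> A \<Longrightarrow> cc X (g i)) \<Longrightarrow> cc X (\<lambda>x. \<Sum>i\<in>A. g i x)"
  by (induction A rule: infinite_finite_induct) (auto intro: cc_0 cc_add)

lemma cc_compose:
  assumes "cc X g" "continuous_on UNIV h" "h 0 = 0"
  shows "cc X (\<lambda>x. h (g x))"
  using assms unfolding cc_def by (auto intro: continuous_on_compose2)

lemma cutoff_exists:
  fixes X :: "'a::heine_borel set"
  assumes "open X" "compact C" "C \<subseteq> X"
  shows "\<exists>u::'a \<Rightarrow> real. cc X u \<and> (\<forall>x. 0 \<le> u x \<and> u x \<le> 1) \<and> (\<forall>x\<in>C. u x = 1)"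
proof (cases "C = {}")
  case True
  then show ?thesis by (intro exI[of _ "\<lambda>_. 0"]) (auto intro: cc_0)
next
  case False
  obtain e where e: "e > 0" "{x. infdist x C \<le> e} \<subseteq> X"
    using compact_in_open_separated[OF False assms(2,1,3)] by blast
  let ?u = "\<lambda>x. max 0 (1 - infdist x C / e)"
  have "cc X ?u"
    unfolding cc_def
  proof (intro conjI exI[of _ "{x. infdist x C \<le> e}"])
    show "continuous_on UNIV ?u" using e by (intro continuous_intros) auto
    show "compact {x. infdist x C \<le> e}" by (rule compact_infdist_le[OF False assms(2) e(1)])
  qed (use e in \<open>auto simp: field_simps max_def\<close>)
  then show ?thesis using e(1) False
    by (intro exI[of _ ?u]) (auto simp: infdist_nonneg)
qed

text \<open>The outer measure below is defined with countable covers by functions rather than by the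
  values of \<open>\<Lambda>\<close> below open sets.  Then countable subadditivity is a matter of merging covers, and the
  representation of \<open>\<Lambda>\<close> comes without a discussion of regularity.\<close>

locale riesz =
  fixes X :: "'a::heine_borel set" and \<Lambda> :: "('a \<Rightarrow> real) \<Rightarrow> real"
  assumes open_X: "open X"
    and L_add: "cc X f \<Longrightarrow> cc X g \<Longrightarrow> \<Lambda> (\<lambda>x. f x + g x) = \<Lambda> f + \<Lambda> g"
    and L_scale: "cc X f \<Longrightarrow> \<Lambda> (\<lambda>x. c * f x) = c * \<Lambda> f"
    and L_pos: "cc X f \<Longrightarrow> (\<And>x. f x \<ge> 0) \<Longrightarrow> \<Lambda> f \<ge> 0"
begin

lemma L_0: "\<Lambda> (\<lambda>_. 0) = 0"
  using L_scale[OF cc_0, of 0] by simp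

lemma L_sum: "(\<And>i. i \<in> A \<Longrightarrow> cc X (g i)) \<Longrightarrow> \<Lambda> (\<lambda>x. \<Sum>i\<in>A. g i x) = (\<Sum>i\<in>A. \<Lambda> (g i))"
  by (induction A rule: infinite_finite_induct) (auto simp: L_0 L_add cc_sum)

lemma L_diff: "cc X f \<Longrightarrow> cc X g \<Longrightarrow> \<Lambda> (\<lambda>x. f x - g x) = \<Lambda> f - \<Lambda> g"
  using L_add[of f "\<lambda>x. (-1) * g x"] L_scale[of g "-1"] cc_scale[of X g "-1"] by simp

lemma cc_diff: "cc X f \<Longrightarrow> cc X g \<Longrightarrow> cc X (\<lambda>x. f x - g x :: real)"
  using cc_add[of X f "\<lambda>x. (-1) * g x"] cc_scale[of X g "-1"] by simp

lemma L_mono: "cc X f \<Longrightarrow> cc X g \<Longrightarrow> (\<And>x. f x \<le> g x) \<Longrightarrow> \<Lambda> f \<le> \<Lambda> g"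
  using L_pos[OF cc_diff, of g f] L_diff[of g f] by simp

definition covers :: "(nat \<Rightarrow> 'a \<Rightarrow> real) \<Rightarrow> 'a set \<Rightarrow> bool" where
  "covers g A \<longleftrightarrow> (\<forall>n. cc X (g n) \<and> (\<forall>x. g n x \<ge> 0)) \<and> (\<forall>x\<in>A \<inter> X. 1 \<le> (\<Sum>n. ennreal (g n x)))"

definition om :: "'a set \<Rightarrow> ennreal" where
  "om A = (INF g\<in>{g. covers g A}. \<Sum>n. ennreal (\<Lambda> (g n)))"

lemma om_le: "covers g A \<Longrightarrow> om A \<le> (\<Sum>n. ennreal (\<Lambda> (g n)))"
  unfolding om_def by (rule INF_lower) simp

lemma om_ge: "(\<And>g. covers g A \<Longrightarrow> c \<le> (\<Sum>n. ennreal (\<Lambda> (g n)))) \<Longrightarrow> c \<le> om A"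
  unfolding om_def by (rule INF_greatest) simp

lemma suminf_first: "(\<Sum>n::nat. if n = 0 then (a::ennreal) else 0) = a"
  using suminf_finite[of "{0::nat}" "\<lambda>n. if n = 0 then a else 0"] by simp

lemma om_le_single:
  assumes "cc X g" "\<And>x. g x \<ge> 0" "\<And>x. x \<in> A \<inter> X \<Longrightarrow> 1 \<le> g x"
  shows "om A \<le> ennreal (\<Lambda> g)"
proof -
  let ?g = "\<lambda>n::nat. if n = 0 then g else (\<lambda>_. 0)"
  have "ennreal (?g n x) = (if n = 0 then ennreal (g x) else 0)" for n x by simp
  then have "covers ?g A" using assms by (auto simp: covers_def suminf_first cc_0)
  moreover have "ennreal (\<Lambda> (?g n)) = (if n = 0 then ennreal (\<Lambda> g) else 0)" for n by (simp add: L_0)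
  ultimately show ?thesis using om_le[of ?g A] by (simp add: suminf_first)
qed

lemma om_empty: "om {} = 0"
  using om_le_single[OF cc_0, of "{}"] by (simp add: L_0)

lemma om_mono: "A \<subseteq> B \<Longrightarrow> om A \<le> om B"
  unfolding om_def by (rule INF_superset_mono) (auto simp: covers_def)

lemma om_outside: "om (- X) = 0"
  using om_le_single[OF cc_0, of "- X"] by (simp add: L_0)

text \<open>Enumerating a double sequence turns covers of the members of a sequence of sets into a cover
  of their union.\<close>

lemma covers_double:
  assumes "\<And>m n. cc X (g m n)" "\<And>m n x. g m n x \<ge> 0" "\<And>x. x \<in> A \<inter> X \<Longrightarrow> 1 \<le> (\<Sum>m. \<Sum>n. ennreal (g m n x))"
  shows "om A \<le> (\<Sum>m. \<Sum>n. ennreal (\<Lambda> (g m n)))"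
proof -
  let ?g = "\<lambda>i. case prod_decode i of (m, n) \<Rightarrow> g m n"
  have 1: "(\<Sum>i. ennreal (?g i x)) = (\<Sum>m. \<Sum>n. ennreal (g m n x))" for x
    using suminf_ennreal_2dimen[of "\<lambda>m. \<Sum>n. ennreal (g m n x)" "\<lambda>(m,n). ennreal (g m n x)"]
    by (simp add: o_def case_prod_beta)
  have 2: "(\<Sum>i. ennreal (\<Lambda> (?g i))) = (\<Sum>m. \<Sum>n. ennreal (\<Lambda> (g m n)))"
    using suminf_ennreal_2dimen[of "\<lambda>m. \<Sum>n. ennreal (\<Lambda> (g m n))" "\<lambda>(m,n). ennreal (\<Lambda> (g m n))"]
    by (simp add: o_def case_prod_beta)
  have "covers ?g A" using assms 1 by (auto simp: covers_def split: prod.splits)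
  from om_le[OF this] show ?thesis by (simp add: 2)
qed

lemma om_subadditive: "om (\<Union>i. A i) \<le> (\<Sum>i. om (A i))"
proof (rule ennreal_le_epsilon)
  fix e :: real assume lt: "(\<Sum>i. om (A i)) < top" and e: "0 < e"
  have fin: "om (A i) < top" for i by (rule ennreal_suminf_lessD[OF lt])
  have "\<exists>g. covers g (A i) \<and> (\<Sum>n. ennreal (\<Lambda> (g n))) \<le> om (A i) + ennreal (e * (1/2) ^ Suc i)" for i
  proof -
    have "om (A i) < om (A i) + ennreal (e * (1/2) ^ Suc i)"
      using fin[of i] e by (cases "om (A i)") (auto simp: ennreal_less_iff simp flip: ennreal_plus)
    then show ?thesis
      unfolding om_def[of "A i"] INF_less_iff by (auto intro: less_imp_le)
  qed
  then obtain g where g: "\<And>i. covers (g i) (A i)"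
    "\<And>i. (\<Sum>n. ennreal (\<Lambda> (g i n))) \<le> om (A i) + ennreal (e * (1/2) ^ Suc i)" by metis
  have "om (\<Union>i. A i) \<le> (\<Sum>i. \<Sum>n. ennreal (\<Lambda> (g i n)))"
  proof (rule covers_double)
    fix x assume "x \<in> (\<Union>i. A i) \<inter> X"
    then obtain i where i: "x \<in> A i \<inter> X" by auto
    then have "1 \<le> (\<Sum>n. ennreal (g i n x))" using g(1)[of i] by (auto simp: covers_def)
    also have "\<dots> = (\<Sum>k\<in>{i}. \<Sum>n. ennreal (g k n x))" by simp
    also have "\<dots> \<le> (\<Sum>k. \<Sum>n. ennreal (g k n x))" by (rule sum_le_suminf) auto
    finally show "1 \<le> (\<Sum>k. \<Sum>n. ennreal (g k n x))" .
  qed (use g in \<open>auto simp: covers_def\<close>)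
  also have "\<dots> \<le> (\<Sum>i. om (A i) + ennreal (e * (1/2) ^ Suc i))"
    by (intro suminf_le g) auto
  also have "\<dots> = (\<Sum>i. om (A i)) + (\<Sum>i. ennreal (e * (1/2) ^ Suc i))"
    by (rule suminf_add[symmetric]) auto
  also have "(\<Sum>i. ennreal (e * (1/2) ^ Suc i)) = ennreal e"
  proof -
    have "(\<lambda>i. e * (1/2) ^ Suc i) sums (e * 1)" by (intro sums_mult power_half_series)
    then show ?thesis using e by (subst suminf_ennreal_eq[of _ e]) auto
  qed
  finally show "om (\<Union>i. A i) \<le> (\<Sum>i. om (A i)) + ennreal e" .
qed

text \<open>Caratheodory's condition for open sets.  If \<open>h\<close> is positive exactly on \<open>A\<close>, then
  \<open>1 = (\<Sum>k<n. h (1 - h)^k) + (1 - h)^n\<close> splits a cover of \<open>E\<close>: the first part, as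
  \<open>n\<close> grows, covers \<open>A \<inter> E\<close>, and the second always covers \<open>E - A\<close>.\<close>

lemma om_open_split:
  assumes "open A"
  shows "om (A \<inter> E) + om ((UNIV - A) \<inter> E) \<le> om E"
proof (cases "A = UNIV")
  case True
  then show ?thesis by (simp add: om_empty)
next
  case False
  define h where "h x = min 1 (infdist x (- A))" for x
  have cl: "closed (- A)" and ne: "- A \<noteq> {}" using assms False by auto
  have h0: "0 \<le> h x" "h x \<le> 1" for x by (auto simp: h_def infdist_nonneg)
  have hpos: "h x > 0 \<longleftrightarrow> x \<in> A" for x
    using in_closed_iff_infdist_zero[OF cl ne, of x] infdist_nonneg[of x "- A"]
    by (auto simp: h_def)
  have hc: "continuous_on UNIV h" unfolding h_def by (intro continuous_intros)
  show ?thesis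
  proof (rule om_ge)
    fix g assume g: "covers g E"
    then have gc: "cc X (g j)" "g j x \<ge> 0" for j x by (auto simp: covers_def)
    have part: "(\<Sum>k<n. h x * (1 - h x) ^ k) + (1 - h x) ^ n = 1" for n x
      by (induction n) (auto simp: algebra_simps)
    have psi: "cc X (\<lambda>x. h x * (1 - h x) ^ k * g j x)" "cc X (\<lambda>x. (1 - h x) ^ k * g j x)" for k j
      by (intro cc_mult gc continuous_intros hc)+
    define S where "S k = (\<Sum>j. ennreal (\<Lambda> (\<lambda>x. h x * (1 - h x) ^ k * g j x)))" for k
    have R: "om ((UNIV - A) \<inter> E) \<le> (\<Sum>j. ennreal (\<Lambda> (\<lambda>x. (1 - h x) ^ n * g j x)))" for n
    proof (rule om_le)
      have "h x = 0" if "x \<notin> A" for x using hpos[of x] h0[of x] that by auto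
      then show "covers (\<lambda>j x. (1 - h x) ^ n * g j x) ((UNIV - A) \<inter> E)"
        using g psi h0 unfolding covers_def by auto
    qed
    have "om (A \<inter> E) \<le> (\<Sum>k. S k)"
      unfolding S_def
    proof (rule covers_double[OF psi(1)])
      show "h x * (1 - h x) ^ k * g j x \<ge> 0" for k j x using h0[of x] gc by simp
      fix x assume x: "x \<in> A \<inter> E \<inter> X"
      then have "(\<lambda>k. h x * (1 - h x) ^ k) sums (h x * (1 / (1 - (1 - h x))))"
        using hpos[of x] h0[of x] by (intro sums_mult geometric_sums) auto
      then have "(\<lambda>k. h x * (1 - h x) ^ k) sums 1" using hpos[of x] x by simp
      then have 1: "(\<Sum>k. ennreal (h x * (1 - h x) ^ k)) = 1"
        using h0 by (subst suminf_ennreal_eq[of _ 1]) auto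
      have "(\<Sum>k. \<Sum>j. ennreal (h x * (1 - h x) ^ k * g j x)) =
         (\<Sum>k. ennreal (h x * (1 - h x) ^ k)) * (\<Sum>j. ennreal (g j x))"
        using h0[of x] by (simp add: ennreal_mult gc)
      then show "1 \<le> (\<Sum>k. \<Sum>j. ennreal (h x * (1 - h x) ^ k * g j x))"
        using 1 g x by (auto simp: covers_def)
    qed
    moreover have "(\<Sum>k. S k) + om ((UNIV - A) \<inter> E) \<le> (\<Sum>j. ennreal (\<Lambda> (g j)))"
    proof (rule ennreal_suminf_bound_add)
      fix n
      have nn: "0 \<le> \<Lambda> (\<lambda>x. h x * (1 - h x) ^ k * g j x)" "0 \<le> \<Lambda> (\<lambda>x. (1 - h x) ^ k * g j x)" for k j
        using h0 gc by (intro L_pos psi; simp)+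
      have "(\<Sum>k<n. S k) + om ((UNIV - A) \<inter> E)
        \<le> (\<Sum>k<n. S k) + (\<Sum>j. ennreal (\<Lambda> (\<lambda>x. (1 - h x) ^ n * g j x)))"
        by (intro add_left_mono R)
      also have "\<dots> = (\<Sum>j. (\<Sum>k<n. ennreal (\<Lambda> (\<lambda>x. h x * (1 - h x) ^ k * g j x))) + ennreal (\<Lambda> (\<lambda>x. (1 - h x) ^ n * g j x)))"
        unfolding S_def by (simp add: suminf_sum suminf_add[symmetric])
      also have "\<dots> = (\<Sum>j. ennreal (\<Lambda> (g j)))"
      proof (rule suminf_cong)
        fix j
        have "\<Lambda> (g j) = \<Lambda> (\<lambda>x. (\<Sum>k<n. h x * (1 - h x) ^ k * g j x) + (1 - h x) ^ n * g j x)"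
          using part by (simp flip: sum_distrib_right distrib_right)
        also have "\<dots> = (\<Sum>k<n. \<Lambda> (\<lambda>x. h x * (1 - h x) ^ k * g j x)) + \<Lambda> (\<lambda>x. (1 - h x) ^ n * g j x)"
          by (simp add: L_add L_sum cc_sum psi)
        finally show "(\<Sum>k<n. ennreal (\<Lambda> (\<lambda>x. h x * (1 - h x) ^ k * g j x))) + ennreal (\<Lambda> (\<lambda>x. (1 - h x) ^ n * g j x)) = ennreal (\<Lambda> (g j))"
          using nn by (simp add: sum_nonneg)
      qed
      finally show "(\<Sum>k<n. S k) + om ((UNIV - A) \<inter> E) \<le> (\<Sum>j. ennreal (\<Lambda> (g j)))" .
    qed
    ultimately show "om (A \<inter> E) + om ((UNIV - A) \<inter> E) \<le> (\<Sum>j. ennreal (\<Lambda> (g j)))"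
      by (meson add_right_mono order_trans)
  qed
qed

text \<open>Dini's argument: on a compact set, finitely many functions of a countable cover already
  dominate \<open>g - e\<close>.\<close>

lemma L_le_om:
  assumes g: "cc X g" "\<And>x. g x \<le> 1" "\<And>x. x \<notin> A \<Longrightarrow> g x \<le> 0"
  shows "ennreal (\<Lambda> g) \<le> om A"
proof (rule om_ge)
  fix c assume c: "covers c A"
  then have cc: "cc X (c j)" "c j x \<ge> 0" for j x by (auto simp: covers_def)
  obtain C where C: "compact C" "C \<subseteq> X" "\<And>x. x \<notin> C \<Longrightarrow> g x = 0" using g(1) by (auto simp: cc_def)
  obtain u where u: "cc X u" "\<And>x. 0 \<le> u x" "\<And>x. x \<in> C \<Longrightarrow> u x = (1::real)"
    using cutoff_exists[OF open_X C(1,2)] by blast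
  show "ennreal (\<Lambda> g) \<le> (\<Sum>n. ennreal (\<Lambda> (c n)))"
  proof (rule ennreal_le_epsilon)
    fix d :: real assume "(\<Sum>n. ennreal (\<Lambda> (c n))) < top" and d: "0 < d"
    \<comment> \<open>the loss \<open>e\<close> on the support costs \<open>e \<Lambda> u\<close>, which has to be at most \<open>d\<close>\<close>
    define e where "e = d / (\<Lambda> u + 1)"
    have Lu: "\<Lambda> u \<ge> 0" using L_pos[OF u(1,2)] .
    have e: "e > 0" "e * \<Lambda> u \<le> d" using d Lu by (auto simp: e_def field_simps)
    define U where "U n = {x. g x - e < (\<Sum>i<n. c i x)}" for n
    have "open (U n)" for n
      unfolding U_def using g(1) cc(1) by (intro open_Collect_less continuous_intros) (auto simp: cc_def)
    moreover have "C \<subseteq> (\<Union>n. U n)"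
    proof
      fix x assume x: "x \<in> C"
      show "x \<in> (\<Union>n. U n)"
      proof (cases "x \<in> A")
        case True
        then have 1: "1 \<le> (\<Sum>n. ennreal (c n x))" using c x C by (auto simp: covers_def)
        have "\<exists>n. ennreal (1 - e) < (\<Sum>i<n. ennreal (c i x))"
        proof (rule ccontr)
          assume "\<not> ?thesis"
          then have "(\<Sum>n. ennreal (c n x)) \<le> ennreal (1 - e)"
            by (intro suminf_le_const) (auto simp: not_less)
          with 1 have "1 \<le> ennreal (1 - e)" by (rule order_trans)
          then show False using e(1) ennreal_le_iff2[of 1 "1 - e"] by simp
        qed
        then obtain n where "ennreal (1 - e) < ennreal (\<Sum>i<n. c i x)"
          using cc(2) by auto
        then have "1 - e < (\<Sum>i<n. c i x)"
          by (metis ennreal_leI not_less)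
        then show ?thesis using g(2)[of x] by (auto simp: U_def intro!: exI[of _ n])
      next
        case False
        then show ?thesis using g(3)[OF False] e by (auto simp: U_def intro!: exI[of _ 0])
      qed
    qed
    ultimately obtain F where F: "finite F" "C \<subseteq> (\<Union>n\<in>F. U n)"
      using compactE_image[OF C(1), of UNIV U] by metis
    define N where "N = Max (insert 0 F)"
    have "g x \<le> (\<Sum>i<N. c i x) + e * u x" for x
    proof (cases "x \<in> C")
      case True
      then obtain n where n: "n \<in> F" "x \<in> U n" using F by auto
      then have "(\<Sum>i<n. c i x) \<le> (\<Sum>i<N. c i x)"
        using F cc(2) by (intro sum_mono2) (auto simp: N_def intro: order_less_le_trans)
      then show ?thesis using n u(3)[OF True] by (auto simp: U_def)
    next
      case False
      have "0 \<le> (\<Sum>i<N. c i x) + e * u x" using cc(2) u(2) e by (simp add: sum_nonneg)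
      then show ?thesis using C(3)[OF False] by simp
    qed
    then have "\<Lambda> g \<le> \<Lambda> (\<lambda>x. (\<Sum>i<N. c i x) + e * u x)"
      by (intro L_mono g cc_add cc_sum cc cc_scale u)
    also have "\<dots> = (\<Sum>i<N. \<Lambda> (c i)) + e * \<Lambda> u"
      by (simp add: L_add L_sum L_scale cc_sum cc cc_scale u)
    finally have "\<Lambda> g \<le> (\<Sum>i<N. \<Lambda> (c i)) + d" using e by simp
    then have "ennreal (\<Lambda> g) \<le> ennreal ((\<Sum>i<N. \<Lambda> (c i)) + d)" by (rule ennreal_leI)
    also have "\<dots> = (\<Sum>i<N. ennreal (\<Lambda> (c i))) + ennreal d"
      using d L_pos[OF cc] by (simp add: sum_nonneg)
    also have "\<dots> \<le> (\<Sum>n. ennreal (\<Lambda> (c n))) + ennreal d"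
      by (intro add_right_mono sum_le_suminf) auto
    finally show "ennreal (\<Lambda> g) \<le> (\<Sum>n. ennreal (\<Lambda> (c n))) + ennreal d" .
  qed
qed

definition \<nu> :: "'a measure" where
  "\<nu> = measure_of UNIV (sets borel) om"

lemma sets_nu: "sets \<nu> = sets borel" and space_nu: "space \<nu> = UNIV"
  using sets.sigma_sets_eq[of "borel :: 'a measure"] by (auto simp: \<nu>_def)

lemma emeasure_nu: "A \<in> sets borel \<Longrightarrow> emeasure \<nu> A = om A"
proof -
  assume A: "A \<in> sets borel"
  have oms: "outer_measure_space (Pow UNIV) om"
    unfolding outer_measure_space_def
    by (auto simp: positive_def om_empty increasing_def om_mono countably_subadditive_def om_subadditive)
  interpret P: sigma_algebra "UNIV :: 'a set" "Pow UNIV" by (rule sigma_algebra_Pow)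
  let ?L = "lambda_system UNIV (Pow UNIV) om"
  have ms: "measure_space UNIV ?L om" by (rule P.caratheodory_lemma[OF oms])
  have "B \<in> ?L" if "open B" for B
  proof -
    have "om (B \<inter> E) + om ((UNIV - B) \<inter> E) = om E" for E
    proof (rule antisym[OF om_open_split[OF that]])
      have "om E \<le> om (\<Union>i::nat. if i = 0 then B \<inter> E else if i = 1 then (UNIV - B) \<inter> E else {})"
        by (rule om_mono) (auto split: if_splits)
      also have "\<dots> \<le> (\<Sum>i::nat. om (if i = 0 then B \<inter> E else if i = 1 then (UNIV - B) \<inter> E else {}))"
        by (rule om_subadditive)
      also have "\<dots> = (\<Sum>i\<in>{0,1::nat}. om (if i = 0 then B \<inter> E else if i = 1 then (UNIV - B) \<inter> E else {}))"
        by (rule suminf_finite) (auto simp: om_empty)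
      finally show "om E \<le> om (B \<inter> E) + om ((UNIV - B) \<inter> E)" by simp
    qed
    then show ?thesis by (simp add: lambda_system_def)
  qed
  then have "sigma_sets UNIV {B. open B} \<subseteq> ?L"
    using ms by (intro sigma_algebra.sigma_sets_subset) (auto simp: measure_space_def)
  then have sub: "sets borel \<subseteq> ?L" by (simp add: borel_def)
  show ?thesis
    unfolding \<nu>_def
  proof (rule emeasure_measure_of_sigma)
    show "sigma_algebra UNIV (sets (borel :: 'a measure))"
      using sets.sigma_algebra_axioms[of "borel :: 'a measure"] by simp
    show "positive (sets borel) om" by (simp add: positive_def om_empty)
    show "countably_additive (sets borel) om"
      using ms sub by (auto simp: measure_space_def countably_additive_def)
  qed (rule A)
qed

lemma emeasure_nu_finite: "compact C \<Longrightarrow> C \<subseteq> X \<Longrightarrow> emeasure \<nu> C < top"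
proof -
  assume C: "compact C" "C \<subseteq> X"
  obtain u where u: "cc X u" "\<And>x. 0 \<le> u x" "\<And>x. x \<in> C \<Longrightarrow> u x = (1::real)"
    using cutoff_exists[OF open_X C] by blast
  have "emeasure \<nu> C \<le> ennreal (\<Lambda> u)"
    using om_le_single[OF u(1,2), of C] u(3) C by (simp add: emeasure_nu compact_imp_closed)
  then show ?thesis using le_less_trans ennreal_less_top by blast
qed

lemma cc_measurable: "cc X f \<Longrightarrow> f \<in> borel_measurable \<nu>" for f :: "'a \<Rightarrow> real"
  using borel_measurable_continuous_onI[of f] measurable_cong_sets[OF sets_nu refl] by (auto simp: cc_def)

lemma cc_integrable: "cc X (f :: 'a \<Rightarrow> real) \<Longrightarrow> integrable \<nu> f"
proof -
  assume f: "cc X f"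
  then obtain C where C: "compact C" "C \<subseteq> X" "\<And>x. x \<notin> C \<Longrightarrow> f x = 0" by (auto simp: cc_def)
  have "bounded (f ` C)"
    using f C by (intro compact_imp_bounded compact_continuous_image) (auto simp: cc_def intro: continuous_on_subset)
  then obtain B where B: "\<And>x. x \<in> C \<Longrightarrow> norm (f x) \<le> B" "B > 0" unfolding bounded_pos by blast
  have "C \<in> sets \<nu>" using C by (simp add: sets_nu compact_imp_closed)
  then have "integrable \<nu> (\<lambda>x. B * indicator C x)"
    using emeasure_nu_finite[OF C(1,2)] by simp
  then show ?thesis
  proof (rule Bochner_Integration.integrable_bound)
    show "AE x in \<nu>. norm (f x) \<le> norm (B * indicator C x)"
      using B C(3) by (auto simp: indicator_def)
  qed (rule cc_measurable[OF f])
qed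

text \<open>Slicing \<open>f\<close> into layers of height \<open>d\<close> squeezes both \<open>\<Lambda> f\<close> and the integral between
  two Riemann sums, of \<open>d \<nu>{f > i d}\<close>, whose difference telescopes to at most \<open>d \<nu>{f > 0}\<close>.\<close>

lemma L_eq_integral_nonneg:
  assumes f: "cc X f" "\<And>x. 0 \<le> f x"
  shows "\<Lambda> f = (LINT x|\<nu>. f x)"
proof -
  obtain C where C: "compact C" "C \<subseteq> X" "\<And>x. x \<notin> C \<Longrightarrow> f x = 0" using f(1) by (auto simp: cc_def)
  have "bounded (f ` C)"
    using f C by (intro compact_imp_bounded compact_continuous_image) (auto simp: cc_def intro: continuous_on_subset)
  then obtain B where B: "\<And>x. x \<in> C \<Longrightarrow> norm (f x) \<le> B" "B > 0" unfolding bounded_pos by blast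
  have fB: "f x \<le> B" for x using B(1)[of x] B(2) C(3)[of x] by (cases "x \<in> C") auto
  define mu where "mu t = measure \<nu> {x. f x > t}" for t
  have fm: "{x. f x > t} \<in> sets \<nu>" for t
    using f(1) unfolding sets_nu cc_def by (auto intro!: borel_open open_Collect_less continuous_intros)
  have fin: "emeasure \<nu> {x. f x > t} < top" if "t \<ge> 0" for t
  proof -
    have "{x. f x > t} \<subseteq> C" using C(3) that by force
    then have "emeasure \<nu> {x. f x > t} \<le> emeasure \<nu> C"
      using C(1) by (intro emeasure_mono) (auto simp: sets_nu compact_imp_closed)
    then show ?thesis using emeasure_nu_finite[OF C(1,2)] le_less_trans by blast
  qed
  have layer: "d * mu (t + d) \<le> \<Lambda> (\<lambda>x. min (max (f x - t) 0) d) \<and> \<Lambda> (\<lambda>x. min (max (f x - t) 0) d) \<le> d * mu t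
      \<and> d * mu (t + d) \<le> (LINT x|\<nu>. min (max (f x - t) 0) d) \<and> (LINT x|\<nu>. min (max (f x - t) 0) d) \<le> d * mu t"
    (is "?a \<and> ?b \<and> ?c \<and> ?d")
    if t: "t \<ge> 0" and d: "d > 0" for t d
  proof -
    let ?g = "\<lambda>x. min (max (f x - t) 0) d"
    have g: "cc X ?g" using t d by (intro cc_compose[OF f(1), of "\<lambda>s. min (max (s - t) 0) d"] continuous_intros) auto
    have gd: "cc X (\<lambda>x. (1/d) * ?g x)" by (rule cc_scale[OF g])
    have Ld: "\<Lambda> (\<lambda>x. (1/d) * ?g x) = \<Lambda> ?g / d" using L_scale[OF g, of "1/d"] by simp
    have "om {x. f x > t + d} \<le> ennreal (\<Lambda> (\<lambda>x. (1/d) * ?g x))"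
      using d by (intro om_le_single[OF gd]) (auto simp: field_simps)
    then have "ennreal (mu (t + d)) \<le> ennreal (\<Lambda> ?g / d)"
      using fm[of "t+d"] fin[of "t+d"] t d
      unfolding mu_def Ld by (simp add: emeasure_eq_ennreal_measure emeasure_nu[symmetric] sets_nu)
    moreover have "0 \<le> \<Lambda> ?g" using d by (intro L_pos g) auto
    ultimately have a: ?a using d by (simp add: field_simps)
    have "ennreal (\<Lambda> (\<lambda>x. (1/d) * ?g x)) \<le> om {x. f x > t}"
      using d by (intro L_le_om[OF gd]) (auto simp: field_simps)
    then have "ennreal (\<Lambda> ?g / d) \<le> ennreal (mu t)"
      using fm[of t] fin[of t] t
      unfolding mu_def Ld by (simp add: emeasure_eq_ennreal_measure emeasure_nu[symmetric] sets_nu)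
    then have b: ?b using d by (simp add: field_simps mu_def)
    have int: "integrable \<nu> (\<lambda>x. d * indicator {x. f x > s} x)" if "s \<ge> 0" for s
      using fm[of s] fin[OF that] by simp
    have val: "(LINT x|\<nu>. d * indicator {x. f x > s} x) = d * mu s" if "s \<ge> 0" for s
      using fm[of s] by (simp add: mu_def)
    have "(LINT x|\<nu>. d * indicator {x. f x > t + d} x) \<le> (LINT x|\<nu>. ?g x)"
      using t d by (intro integral_mono int cc_integrable g) (auto simp: indicator_def)
    moreover have "(LINT x|\<nu>. ?g x) \<le> (LINT x|\<nu>. d * indicator {x. f x > t} x)"
      using t d by (intro integral_mono int cc_integrable g) (auto simp: indicator_def)
    ultimately show ?thesis using a b val[of t] val[of "t+d"] t d by simp
  qed
  have bound: "\<bar>\<Lambda> f - (LINT x|\<nu>. f x)\<bar> \<le> d * mu 0" if d: "d > 0" for d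
  proof -
    obtain m :: nat where m: "B \<le> of_nat m * d" using d by (metis reals_Archimedean3 less_imp_le)
    let ?g = "\<lambda>i x. min (max (f x - of_nat i * d) 0) d"
    have gc: "cc X (?g i)" for i
      using d by (intro cc_compose[OF f(1), of "\<lambda>s. min (max (s - of_nat i * d) 0) d"] continuous_intros) auto
    have part: "(\<Sum>i<n. ?g i x) = min (f x) (of_nat n * d)" for n x
      using f(2)[of x] d by (induction n) (auto simp: algebra_simps min_def max_def)
    have feq: "f x = (\<Sum>i<m. ?g i x)" for x
      unfolding part using fB[of x] m by simp
    have fe: "f = (\<lambda>x. \<Sum>i<m. ?g i x)" by (rule ext) (rule feq)
    have "\<Lambda> f = \<Lambda> (\<lambda>x. \<Sum>i<m. ?g i x)" by (rule arg_cong[OF fe])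
    then have L: "\<Lambda> f = (\<Sum>i<m. \<Lambda> (?g i))" by (simp add: L_sum gc)
    have "(LINT x|\<nu>. f x) = (LINT x|\<nu>. (\<Sum>i<m. ?g i x))" by (rule arg_cong[OF fe])
    then have I: "(LINT x|\<nu>. f x) = (\<Sum>i<m. LINT x|\<nu>. ?g i x)" by (simp add: cc_integrable gc)
    have lay: "d * mu (of_nat (Suc i) * d) \<le> \<Lambda> (?g i) \<and> \<Lambda> (?g i) \<le> d * mu (of_nat i * d)
      \<and> d * mu (of_nat (Suc i) * d) \<le> (LINT x|\<nu>. ?g i x) \<and> (LINT x|\<nu>. ?g i x) \<le> d * mu (of_nat i * d)" for i
      using layer[of "of_nat i * d" d] d by (simp add: algebra_simps)
    have step: "\<bar>\<Lambda> (?g i) - (LINT x|\<nu>. ?g i x)\<bar> \<le> d * mu (of_nat i * d) - d * mu (of_nat (Suc i) * d)" for i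
      using lay[of i] by linarith
    have "\<bar>\<Lambda> f - (LINT x|\<nu>. f x)\<bar> = \<bar>\<Sum>i<m. \<Lambda> (?g i) - (LINT x|\<nu>. ?g i x)\<bar>"
      unfolding L I by (simp only: sum_subtractf)
    also have "\<dots> \<le> (\<Sum>i<m. d * mu (of_nat i * d) - d * mu (of_nat (Suc i) * d))"
      by (rule order_trans[OF sum_abs sum_mono[OF step]])
    also have "\<dots> = d * mu 0 - d * mu (of_nat m * d)"
      using sum_lessThan_telescope'[of "\<lambda>i. d * mu (of_nat i * d)" m] by simp
    also have "\<dots> \<le> d * mu 0" using d by (simp add: mu_def)
    finally show ?thesis .
  qed
  have "\<bar>\<Lambda> f - (LINT x|\<nu>. f x)\<bar> \<le> 0"
  proof (rule field_le_epsilon)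
    fix e :: real assume "e > 0"
    have "\<bar>\<Lambda> f - (LINT x|\<nu>. f x)\<bar> \<le> e / (mu 0 + 1) * mu 0"
      using \<open>e > 0\<close> by (intro bound divide_pos_pos) (auto simp: mu_def add_nonneg_pos)
    also have "\<dots> \<le> e"
    proof -
      have "mu 0 \<ge> 0" by (simp add: mu_def)
      then show ?thesis using \<open>e > 0\<close> by (simp add: divide_simps algebra_simps)
    qed
    finally show "\<bar>\<Lambda> f - (LINT x|\<nu>. f x)\<bar> \<le> 0 + e" by simp
  qed
  then show ?thesis by simp
qed

lemma L_eq_integral:
  assumes f: "cc X f"
  shows "\<Lambda> f = (LINT x|\<nu>. f x)"
proof -
  let ?p = "\<lambda>x. max (f x) 0" and ?m = "\<lambda>x. max (- f x) 0"
  have 1: "cc X ?p" "cc X ?m"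
    by (rule cc_compose[OF f, of "\<lambda>t. max t 0"] cc_compose[OF f, of "\<lambda>t. max (- t) 0"];
        auto intro!: continuous_intros)+
  have eq: "f = (\<lambda>x. ?p x - ?m x)" by (auto simp: fun_eq_iff max_def)
  have "\<Lambda> f = \<Lambda> (\<lambda>x. ?p x - ?m x)" by (rule arg_cong[OF eq])
  also have "\<dots> = \<Lambda> ?p - \<Lambda> ?m" by (rule L_diff[OF 1])
  also have "\<dots> = (LINT x|\<nu>. ?p x) - (LINT x|\<nu>. ?m x)"
    by (simp add: L_eq_integral_nonneg 1)
  also have "\<dots> = (LINT x|\<nu>. ?p x - ?m x)" by (simp add: cc_integrable 1)
  also have "\<dots> = (LINT x|\<nu>. f x)" by (rule arg_cong[OF eq[symmetric]])
  finally show ?thesis .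
qed

end

section \<open>Distances between the leaves\<close>

text \<open>Schwarz's lemma for \<open>P\<close> followed by the Moebius map that takes the half plane to the disc
  and \<open>P 0\<close> to \<open>0\<close>.\<close>

lemma schwarz_half_plane:
  assumes P: "P holomorphic_on ball 0 1" "\<And>z. z \<in> ball 0 1 \<Longrightarrow> Re (P z) > 0"
  shows "cmod z < 1 \<Longrightarrow> \<bar>Re (P z) - Re (P 0)\<bar> \<le> cmod z * (Re (P z) + Re (P 0))"
    and "cmod (deriv P 0) \<le> 2 * Re (P 0)"
proof -
  \<comment> \<open>the Moebius map \<open>\<zeta> \<mapsto> (\<zeta> - P 0) / (\<zeta> + cnj (P 0))\<close> after \<open>P\<close>\<close>
  define Q where "Q z = (P z - P 0) / (P z + cnj (P 0))" for z
  have pos0: "Re (P 0) > 0" using P(2)[of 0] by simp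
  have nz: "P z + cnj (P 0) \<noteq> 0" if "z \<in> ball 0 1" for z
    using P(2)[OF that] pos0 by (auto simp: complex_eq_iff)
  have hQ: "Q holomorphic_on ball 0 1"
    unfolding Q_def by (intro holomorphic_intros P nz)
  have Q0: "Q 0 = 0" by (simp add: Q_def)
  have sq: "(cmod (P z + cnj (P 0)))\<^sup>2 - (cmod (P z - P 0))\<^sup>2 = 4 * Re (P z) * Re (P 0)" for z
    unfolding cmod_power2 by (simp add: power2_eq_square algebra_simps)
  have Q1: "cmod (Q z) < 1" if "cmod z < 1" for z
  proof -
    have "(cmod (P z - P 0))\<^sup>2 < (cmod (P z + cnj (P 0)))\<^sup>2"
      using sq[of z] P(2)[of z] pos0 that by (smt (verit) mem_ball_0 mult_pos_pos)
    then have "cmod (P z - P 0) < cmod (P z + cnj (P 0))"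
      using power_less_imp_less_base norm_ge_zero by blast
    then show ?thesis using nz[of z] that by (simp add: Q_def norm_divide divide_less_eq)
  qed
  note S = Schwarz_Lemma[OF hQ Q0 Q1]
  show "\<bar>Re (P z) - Re (P 0)\<bar> \<le> cmod z * (Re (P z) + Re (P 0))" if z: "cmod z < 1"
  proof -
    define x x0 t r where "x = Re (P z)" and "x0 = Re (P 0)" and "t = Im (P z) - Im (P 0)" and "r = cmod z"
    have "cmod (P z - P 0) \<le> r * cmod (P z + cnj (P 0))"
      using S(1)[OF _ z] nz[of z] z by (simp add: Q_def norm_divide divide_le_eq r_def)
    then have "(cmod (P z - P 0))\<^sup>2 \<le> (r * cmod (P z + cnj (P 0)))\<^sup>2"
      by (intro power_mono) auto
    then have "(x - x0)\<^sup>2 + t\<^sup>2 \<le> r\<^sup>2 * ((x + x0)\<^sup>2 + t\<^sup>2)"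
      by (simp add: power_mult_distrib cmod_power2 x_def x0_def t_def)
    moreover have "r\<^sup>2 * t\<^sup>2 \<le> 1 * t\<^sup>2"
      using z by (intro mult_right_mono) (auto simp: r_def power_le_one)
    ultimately have "(x - x0)\<^sup>2 \<le> (r * (x + x0))\<^sup>2"
      using distrib_left[of "r\<^sup>2" "(x + x0)\<^sup>2" "t\<^sup>2"]
      unfolding power_mult_distrib mult_1 by linarith
    moreover have "0 \<le> r * (x + x0)"
      using P(2)[of z] pos0 z by (simp add: r_def x_def x0_def)
    ultimately show ?thesis
      unfolding x_def x0_def r_def using abs_le_square_iff[of "x - x0" "r * (x + x0)"]
      by (simp add: x_def x0_def r_def)
  qed
  have "(P has_field_derivative deriv P 0) (at 0)"
    by (rule holomorphic_derivI[OF P(1)]) auto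
  moreover have c: "P 0 + cnj (P 0) = of_real (2 * Re (P 0))" by (simp add: complex_add_cnj)
  ultimately have "(Q has_field_derivative (deriv P 0 / of_real (2 * Re (P 0)))) (at 0)"
    unfolding Q_def using pos0
    by (auto intro!: derivative_eq_intros simp: c[simplified] field_simps power2_eq_square)
  then have "deriv Q 0 = deriv P 0 / of_real (2 * Re (P 0))" by (rule DERIV_imp_deriv)
  then show "cmod (deriv P 0) \<le> 2 * Re (P 0)"
    using S(2)[of 0] pos0 by (simp add: norm_divide divide_le_eq norm_mult)
qed

text \<open>The estimate at the centre, applied on the disc of radius \<open>1 - |z|\<close> about \<open>z\<close>.\<close>

lemma half_plane_deriv:
  assumes P: "P holomorphic_on ball 0 1" "\<And>z. z \<in> ball 0 1 \<Longrightarrow> Re (P z) > 0" and z: "cmod z < 1"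
  shows "cmod (deriv P z) * (1 - cmod z) \<le> 2 * Re (P z)"
proof -
  define \<rho> where "\<rho> = 1 - cmod z"
  have r: "\<rho> > 0" using z by (simp add: \<rho>_def)
  have in_b: "z + of_real \<rho> * u \<in> ball 0 1" if "u \<in> ball 0 1" for u
  proof -
    have "cmod (z + of_real \<rho> * u) \<le> cmod z + \<rho> * cmod u"
      using norm_triangle_ineq[of z "of_real \<rho> * u"] r by (simp add: norm_mult)
    also have "\<dots> < cmod z + \<rho> * 1" using that r by (intro add_strict_left_mono mult_strict_left_mono) auto
    finally show ?thesis by (simp add: \<rho>_def)
  qed
  let ?R = "\<lambda>u. P (z + of_real \<rho> * u)"
  have "?R holomorphic_on ball 0 1"
    by (rule holomorphic_on_compose_gen[OF _ P(1), unfolded o_def])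
       (use in_b in \<open>auto intro!: holomorphic_intros\<close>)
  from schwarz_half_plane(2)[OF this] have 1: "cmod (deriv ?R 0) \<le> 2 * Re (P z)"
    using P(2)[OF in_b] by simp
  have "(P has_field_derivative deriv P z) (at (z + of_real \<rho> * 0))"
    using holomorphic_derivI[OF P(1)] z by auto
  moreover have "((\<lambda>u. z + of_real \<rho> * u) has_field_derivative of_real \<rho>) (at 0)"
    by (auto intro!: derivative_eq_intros)
  ultimately have "(?R has_field_derivative (deriv P z * of_real \<rho>)) (at 0)"
    by (rule DERIV_chain2)
  then have "deriv ?R 0 = deriv P z * of_real \<rho>" by (rule DERIV_imp_deriv)
  with 1 have "cmod (deriv P z) * \<rho> \<le> 2 * Re (P z)" using r by (simp add: norm_mult)
  then show ?thesis by (simp add: \<rho>_def)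
qed

text \<open>The function \<open>- log h\<close> maps the disc to the right half plane.  Harnack's inequality bounds
  its real parts at \<open>z\<close> and at \<open>0\<close> by multiples of each other, which after exponentiation are
  powers; the bound on its derivative is the one on \<open>h'/h\<close>.\<close>

lemma nonvanishing_bounds:
  assumes h: "h holomorphic_on ball 0 1" "\<And>z. z \<in> ball 0 1 \<Longrightarrow> h z \<noteq> 0 \<and> cmod (h z) < 1"
    and z: "cmod z \<le> r" and r: "r < 1" and N: "(1 + r) / (1 - r) \<le> of_nat N"
  shows "cmod (h 0) ^ N \<le> cmod (h z)" "cmod (h z) ^ N \<le> cmod (h 0)"
    and "cmod (deriv h z) \<le> 2 / (1 - r) * (cmod (h z) * ln (1 / cmod (h z)))"
proof -
  have zb: "z \<in> ball 0 1" "0 \<in> ball (0::complex) 1" using z r by auto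
  obtain g where g: "g holomorphic_on ball 0 1" "\<And>z. z \<in> ball 0 1 \<Longrightarrow> h z = exp (g z)"
    using contractible_imp_holomorphic_log[OF h(1)] h(2) convex_imp_contractible[OF convex_ball] by blast
  define P where "P z = - g z" for z
  have P: "P holomorphic_on ball 0 1" unfolding P_def by (intro holomorphic_intros g)
  have hP: "h z = exp (- P z)" if "z \<in> ball 0 1" for z using g(2)[OF that] by (simp add: P_def)
  have ReP: "Re (P z) = ln (1 / cmod (h z))" if "z \<in> ball 0 1" for z
    using hP[OF that] by (simp add: ln_div)
  have nrm: "cmod (h z) = exp (- Re (P z))" if "z \<in> ball 0 1" for z
    using hP[OF that] by simp
  have pos: "Re (P z) > 0" if "z \<in> ball 0 1" for z
    using h(2)[OF that] unfolding nrm[OF that] by simp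
  define x x0 where "x = Re (P z)" and "x0 = Re (P 0)"
  have xp: "x > 0" "x0 > 0" using pos zb by (auto simp: x_def x0_def)
  have "\<bar>x - x0\<bar> \<le> cmod z * (x + x0)"
    using schwarz_half_plane(1)[OF P pos, of z] zb by (simp add: x_def x0_def)
  also have "\<dots> \<le> r * (x + x0)" using z xp by (intro mult_right_mono) auto
  finally have ab: "x * (1 - r) \<le> x0 * (1 + r)" "x0 * (1 - r) \<le> x * (1 + r)" by (auto simp: algebra_simps abs_le_iff)
  have N': "1 + r \<le> of_nat N * (1 - r)" using N r by (simp add: divide_le_eq)
  have "x0 * (1 + r) \<le> x0 * (of_nat N * (1 - r))" "x * (1 + r) \<le> x * (of_nat N * (1 - r))"
    using N' xp by (intro mult_left_mono; simp)+
  with ab have "x * (1 - r) \<le> (of_nat N * x0) * (1 - r)" "x0 * (1 - r) \<le> (of_nat N * x) * (1 - r)"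
    by (simp_all only: mult.left_commute[of x0] mult.left_commute[of x] mult.assoc)
  then have le: "x \<le> of_nat N * x0" "x0 \<le> of_nat N * x"
    using r by (auto dest: mult_right_le_imp_le)
  show "cmod (h 0) ^ N \<le> cmod (h z)" "cmod (h z) ^ N \<le> cmod (h 0)"
    using le zb by (auto simp: nrm x_def x0_def exp_of_nat_mult[symmetric])
  have "(h has_field_derivative (deriv h z)) (at z)"
    using holomorphic_derivI[OF h(1)] zb by auto
  moreover have "(h has_field_derivative (exp (- P z) * (- deriv P z))) (at z)"
  proof (rule has_field_derivative_transform_within_open[where S="ball 0 1"])
    have "(P has_field_derivative deriv P z) (at z)" using holomorphic_derivI[OF P] zb by auto
    then show "((\<lambda>z. exp (- P z)) has_field_derivative (exp (- P z) * (- deriv P z))) (at z)"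
      by (auto intro!: derivative_eq_intros)
  qed (use zb hP in auto)
  ultimately have "deriv h z = exp (- P z) * (- deriv P z)" by (rule DERIV_unique)
  then have "cmod (deriv h z) = cmod (h z) * cmod (deriv P z)" using hP zb by (simp add: norm_mult)
  moreover have "cmod (deriv P z) * (1 - r) \<le> 2 * Re (P z)"
  proof -
    have "cmod (deriv P z) * (1 - r) \<le> cmod (deriv P z) * (1 - cmod z)" using z by (intro mult_left_mono) auto
    also have "\<dots> \<le> 2 * Re (P z)" using half_plane_deriv[OF P pos] zb by simp
    finally show ?thesis .
  qed
  then have "cmod (deriv P z) \<le> 2 / (1 - r) * ln (1 / cmod (h z))"
    using r ReP[OF zb(1)] by (simp add: field_simps)
  ultimately show "cmod (deriv h z) \<le> 2 / (1 - r) * (cmod (h z) * ln (1 / cmod (h z)))"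
    using mult_left_mono[of "cmod (deriv P z)" "2 / (1 - r) * ln (1 / cmod (h z))" "cmod (h z)"]
    by (simp add: mult_ac)
qed

lemma ln_inverse_sqrt_bound:
  assumes "0 < y" "y < (1::real)"
  shows "y * ln (1 / y) \<le> 2 * sqrt y"
proof -
  have "ln (1 / y) = 2 * ln (1 / sqrt y)" using assms by (simp add: ln_div ln_sqrt)
  also have "\<dots> \<le> 2 * (1 / sqrt y)" using ln_bound[of "1 / sqrt y"] assms by simp
  finally have "y * ln (1 / y) \<le> y * (2 * (1 / sqrt y))" using assms by (intro mult_left_mono) auto
  also have "\<dots> = 2 * sqrt y" using assms by (simp add: real_div_sqrt field_simps)
  finally show ?thesis .
qed

text \<open>The half plane estimate for \<open>1 - u g\<close>, where the unimodular \<open>u\<close> turns \<open>g z\<close> or \<open>g 0\<close> into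
  its modulus.\<close>

lemma disc_growth:
  assumes g: "g holomorphic_on ball 0 1" "\<And>z. z \<in> ball 0 1 \<Longrightarrow> cmod (g z) < 1"
    and z: "cmod z \<le> r" and r: "r < 1"
  shows "(1 - cmod (g 0)) * (1 - r) \<le> (1 - cmod (g z)) * (1 + r)"
    and "(1 - cmod (g z)) * (1 - r) \<le> (1 - cmod (g 0)) * (1 + r)"
proof -
  have zb: "z \<in> ball 0 1" "0 \<in> ball (0::complex) 1" using z r by auto
  have key: "Re (1 - u * g z) * (1 - r) \<le> Re (1 - u * g 0) * (1 + r)"
     "Re (1 - u * g 0) * (1 - r) \<le> Re (1 - u * g z) * (1 + r)" if u: "cmod u = 1" for u
  proof -
    have pos: "Re (1 - u * g z) > 0" if "z \<in> ball 0 1" for z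
      using g(2)[OF that] complex_Re_le_cmod[of "u * g z"] u by (simp add: norm_mult)
    have "\<bar>Re (1 - u * g z) - Re (1 - u * g 0)\<bar> \<le> cmod z * (Re (1 - u * g z) + Re (1 - u * g 0))"
      by (rule schwarz_half_plane(1)[of "\<lambda>z. 1 - u * g z"]) (use pos zb in \<open>auto intro!: holomorphic_intros g\<close>)
    also have "\<dots> \<le> r * (Re (1 - u * g z) + Re (1 - u * g 0))"
      using z pos[OF zb(1)] pos[OF zb(2)] by (intro mult_right_mono) auto
    finally show "Re (1 - u * g z) * (1 - r) \<le> Re (1 - u * g 0) * (1 + r)"
     "Re (1 - u * g 0) * (1 - r) \<le> Re (1 - u * g z) * (1 + r)" by (auto simp: algebra_simps abs_le_iff)
  qed
  have dir: "\<exists>u. cmod u = 1 \<and> u * w = of_real (cmod w)" for w :: complex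
  proof (cases "w = 0")
    case False
    have "cnj w / of_real (cmod w) * w = (w * cnj w) / of_real (cmod w)" by simp
    also have "\<dots> = of_real (cmod w)"
      using False complex_norm_square[of w] by (simp add: power2_eq_square divide_eq_eq)
    finally show ?thesis using False
      by (intro exI[of _ "cnj w / of_real (cmod w)"]) (simp add: norm_divide)
  qed (auto intro: exI[of _ 1])
  have low: "1 - cmod w \<le> Re (1 - u * w)" if "cmod u = 1" for u w
    using complex_Re_le_cmod[of "u * w"] that by (simp add: norm_mult)
  have r1: "1 - r \<ge> 0" "1 + r \<ge> 0" using r z norm_ge_zero[of z] by linarith+
  obtain u where u: "cmod u = 1" "u * g z = of_real (cmod (g z))" using dir by blast
  show "(1 - cmod (g 0)) * (1 - r) \<le> (1 - cmod (g z)) * (1 + r)"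
    using key(2)[OF u(1)] mult_right_mono[OF low[OF u(1), of "g 0"] r1(1)] u(2) by simp
  obtain v where v: "cmod v = 1" "v * g 0 = of_real (cmod (g 0))" using dir by blast
  show "(1 - cmod (g z)) * (1 - r) \<le> (1 - cmod (g 0)) * (1 + r)"
    using key(1)[OF v(1)] mult_right_mono[OF low[OF v(1), of "g z"] r1(1)] v(2) by simp
qed

lemma tendsto_power_0:
  assumes "(\<lambda>n. d n) \<longlonglongrightarrow> 0" "eventually (\<lambda>n. (y n :: real) ^ N \<le> d n \<and> 0 \<le> y n) sequentially"
  shows "y \<longlonglongrightarrow> 0"
proof (rule tendstoI)
  fix e :: real assume e: "e > 0"
  then have "eventually (\<lambda>n. d n < e ^ N) sequentially"
    by (intro order_tendstoD(2)[OF assms(1)]) simp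
  then show "eventually (\<lambda>n. dist (y n) 0 < e) sequentially"
    using assms(2)
  proof eventually_elim
    case (elim n)
    then have "y n ^ N < e ^ N" by linarith
    then have "y n < e" by (rule power_less_imp_less_base) (use e in simp)
    then show ?case using elim by simp
  qed
qed

lemma eventually_radius:
  assumes "z \<longlonglongrightarrow> z0" "cmod z0 < 1"
  shows "eventually (\<lambda>n. cmod (z n) \<le> (1 + cmod z0) / 2) sequentially"
proof -
  have "(\<lambda>n. cmod (z n)) \<longlonglongrightarrow> cmod z0" by (intro tendsto_intros assms)
  then have "eventually (\<lambda>n. cmod (z n) < (1 + cmod z0) / 2) sequentially"
    by (rule order_tendstoD(2)) (use assms(2) in simp)
  then show ?thesis by eventually_elim auto
qed

locale lamination =
  fixes K :: "(complex \<times> complex) set" and f :: "complex \<Rightarrow> complex \<Rightarrow> complex"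
  assumes closed_K: "closedin (top_of_set bidisc) K" and lam: "laminated_by K f"
begin

abbreviation "I \<equiv> indices K"

lemma leaf_holo: "\<alpha> \<in> I \<Longrightarrow> f \<alpha> holomorphic_on ball 0 1"
  and leaf_0: "\<alpha> \<in> I \<Longrightarrow> f \<alpha> 0 = \<alpha>"
  and leaf_lt_1: "\<alpha> \<in> I \<Longrightarrow> cmod z < 1 \<Longrightarrow> cmod (f \<alpha> z) < 1"
  and leaf_disjoint: "\<alpha> \<in> I \<Longrightarrow> \<beta> \<in> I \<Longrightarrow> cmod z < 1 \<Longrightarrow> f \<alpha> z = f \<beta> z \<Longrightarrow> \<alpha> = \<beta>"
proof -
  show "\<alpha> \<in> I \<Longrightarrow> f \<alpha> holomorphic_on ball 0 1" "\<alpha> \<in> I \<Longrightarrow> f \<alpha> 0 = \<alpha>"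
    "\<alpha> \<in> I \<Longrightarrow> cmod z < 1 \<Longrightarrow> cmod (f \<alpha> z) < 1"
    using lam by (auto simp: laminated_by_def)
  assume a: "\<alpha> \<in> I" "\<beta> \<in> I" "cmod z < 1" "f \<alpha> z = f \<beta> z"
  then have "(z, f \<alpha> z) \<in> graph (f \<alpha>) \<inter> graph (f \<beta>)" by (auto simp: graph_def)
  then show "\<alpha> = \<beta>" using lam a unfolding laminated_by_def by blast
qed

lemma K_iff: "p \<in> K \<longleftrightarrow> cmod (fst p) < 1 \<and> (\<exists>\<alpha>\<in>I. snd p = f \<alpha> (fst p))"
proof -
  have "K = (\<Union>\<alpha>\<in>I. graph (f \<alpha>))" using lam by (simp add: laminated_by_def)
  then have "p \<in> K \<longleftrightarrow> p \<in> (\<Union>\<alpha>\<in>I. graph (f \<alpha>))" by simp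
  then show ?thesis by (cases p) (force simp: graph_def)
qed

text \<open>The description is definite for points of \<open>K\<close>, because distinct leaves are disjoint; elsewhere
  the values of \<open>leaf\<close> and \<open>slope\<close> are arbitrary.\<close>

definition leaf :: "complex \<times> complex \<Rightarrow> complex" where
  "leaf p = (THE \<alpha>. \<alpha> \<in> I \<and> snd p = f \<alpha> (fst p))"

definition slope :: "complex \<times> complex \<Rightarrow> complex" where
  "slope p = deriv (f (leaf p)) (fst p)"

lemma leaf_eq: "\<alpha> \<in> I \<Longrightarrow> cmod z < 1 \<Longrightarrow> leaf (z, f \<alpha> z) = \<alpha>"
  unfolding leaf_def using leaf_disjoint by (intro the_equality) auto

lemma leafI: "p \<in> K \<Longrightarrow> leaf p \<in> I \<and> f (leaf p) (fst p) = snd p \<and> cmod (fst p) < 1"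
  using leaf_eq by (cases p) (auto simp: K_iff)

lemma graph_in_K: "\<alpha> \<in> I \<Longrightarrow> cmod z < 1 \<Longrightarrow> (z, f \<alpha> z) \<in> K"
  by (auto simp: K_iff)

text \<open>Half the difference of two leaves has no zero and is bounded by \<open>1\<close>.  These are the
  estimates for holomorphic motions: Hoelder dependence on the label in both directions, and a
  logarithmic modulus of continuity of the slope across the leaves.\<close>

lemma leaves_bounds:
  assumes "\<alpha> \<in> I" "\<beta> \<in> I" "cmod z \<le> r" "r < 1" "(1 + r) / (1 - r) \<le> of_nat N"
  defines "y \<equiv> cmod (f \<alpha> z - f \<beta> z) / 2"
  shows "(cmod (\<alpha> - \<beta>) / 2) ^ N \<le> y" "y ^ N \<le> cmod (\<alpha> - \<beta>) / 2"
    "cmod (deriv (f \<alpha>) z - deriv (f \<beta>) z) / 2 \<le> 2 / (1 - r) * (y * ln (1 / y))"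
    "cmod (deriv (f \<alpha>) z - deriv (f \<beta>) z) / 2 \<le> 4 / (1 - r) * sqrt y"
proof -
  have r0: "r \<ge> 0" using assms(3) norm_ge_zero order_trans by blast
  have zb: "cmod z < 1" "z \<in> ball 0 1" using assms by auto
  have "N > 0" using assms(4,5) r0 by (cases N) (auto simp: divide_le_0_iff)
  have D: "(f a has_field_derivative deriv (f a) z) (at z)" if "a \<in> I" for a
    using holomorphic_derivI[OF leaf_holo[OF that]] zb by auto
  have all: "(cmod (\<alpha> - \<beta>) / 2) ^ N \<le> y \<and> y ^ N \<le> cmod (\<alpha> - \<beta>) / 2 \<and>
    cmod (deriv (f \<alpha>) z - deriv (f \<beta>) z) / 2 \<le> 2 / (1 - r) * (y * ln (1 / y)) \<and>
    cmod (deriv (f \<alpha>) z - deriv (f \<beta>) z) / 2 \<le> 4 / (1 - r) * sqrt y"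
  proof (cases "\<alpha> = \<beta>")
    case True
    then show ?thesis using \<open>N > 0\<close> by (simp add: y_def zero_power)
  next
    case False
    define h where "h z = (f \<alpha> z - f \<beta> z) / 2" for z
    have hh: "h holomorphic_on ball 0 1" unfolding h_def by (intro holomorphic_intros leaf_holo assms) auto
    have h1: "h z \<noteq> 0 \<and> cmod (h z) < 1" if "z \<in> ball 0 1" for z
      using leaf_disjoint[OF assms(1,2), of z] False leaf_lt_1[OF assms(1), of z] leaf_lt_1[OF assms(2), of z]
        norm_triangle_ineq4[of "f \<alpha> z" "f \<beta> z"] that by (auto simp: h_def norm_divide)
    have h0: "cmod (h 0) = cmod (\<alpha> - \<beta>) / 2" using assms by (simp add: h_def leaf_0 norm_divide)
    have hz: "cmod (h z) = y" by (simp add: h_def y_def norm_divide)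
    have "(h has_field_derivative (deriv (f \<alpha>) z - deriv (f \<beta>) z) / 2) (at z)"
      unfolding h_def using D assms by (auto intro!: derivative_eq_intros)
    then have hd: "cmod (deriv h z) = cmod (deriv (f \<alpha>) z - deriv (f \<beta>) z) / 2"
      by (simp add: DERIV_imp_deriv norm_divide)
    note B = nonvanishing_bounds[OF hh h1 assms(3,4,5), unfolded h0 hz hd]
    have y01: "0 < y" "y < 1" using h1[OF zb(2)] hz by auto
    have "2 / (1 - r) * (y * ln (1 / y)) \<le> 2 / (1 - r) * (2 * sqrt y)"
      using ln_inverse_sqrt_bound[OF y01] assms(4) by (intro mult_left_mono) auto
    then show ?thesis using B by auto
  qed
  then show "(cmod (\<alpha> - \<beta>) / 2) ^ N \<le> y" "y ^ N \<le> cmod (\<alpha> - \<beta>) / 2"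
    "cmod (deriv (f \<alpha>) z - deriv (f \<beta>) z) / 2 \<le> 2 / (1 - r) * (y * ln (1 / y))"
    "cmod (deriv (f \<alpha>) z - deriv (f \<beta>) z) / 2 \<le> 4 / (1 - r) * sqrt y" by auto
qed

lemma leaf_isCont:
  assumes "\<alpha> \<in> I" "cmod z < 1"
  shows "isCont (f \<alpha>) z \<and> isCont (deriv (f \<alpha>)) z"
proof -
  have z: "z \<in> ball 0 1" using assms by simp
  have c1: "continuous_on (ball 0 1) (f \<alpha>)"
    by (rule holomorphic_on_imp_continuous_on[OF leaf_holo[OF assms(1)]])
  have c2: "continuous_on (ball 0 1) (deriv (f \<alpha>))"
    by (rule holomorphic_on_imp_continuous_on[OF holomorphic_deriv[OF leaf_holo[OF assms(1)] open_ball]])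
  show ?thesis
    using bspec[OF iffD1[OF continuous_on_eq_continuous_at[OF open_ball] c1] z]
      bspec[OF iffD1[OF continuous_on_eq_continuous_at[OF open_ball] c2] z] by (rule conjI)
qed

lemma leaf_cont_at: "\<alpha> \<in> I \<Longrightarrow> cmod z0 < 1 \<Longrightarrow> z \<longlonglongrightarrow> z0 \<Longrightarrow> (\<lambda>n. f \<alpha> (z n)) \<longlonglongrightarrow> f \<alpha> z0"
  by (rule isCont_tendsto_compose[OF conjunct1[OF leaf_isCont]])

lemma cont_leaf: "continuous_on K leaf"
  unfolding continuous_on_sequentially
proof (intro allI ballI impI)
  fix p q assume q: "q \<in> K" and "(\<forall>n. p n \<in> K) \<and> p \<longlonglongrightarrow> q"
  then have p: "\<And>n. p n \<in> K" and lim: "p \<longlonglongrightarrow> q" by auto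
  have z: "(\<lambda>n. fst (p n)) \<longlonglongrightarrow> fst q" and w: "(\<lambda>n. snd (p n)) \<longlonglongrightarrow> snd q"
    using lim by (auto intro: tendsto_fst tendsto_snd)
  define r where "r = (1 + cmod (fst q)) / 2"
  have r: "r < 1" using leafI[OF q] by (simp add: r_def)
  obtain N :: nat where N: "(1 + r) / (1 - r) \<le> of_nat N" using real_arch_simple by blast
  have "(\<lambda>n. cmod (snd (p n) - f (leaf q) (fst (p n))) / 2) \<longlonglongrightarrow> cmod (snd q - f (leaf q) (fst q)) / 2"
    using leafI[OF q] by (intro tendsto_intros z w leaf_cont_at) auto
  then have d: "(\<lambda>n. cmod (snd (p n) - f (leaf q) (fst (p n))) / 2) \<longlonglongrightarrow> 0" using leafI[OF q] by simp
  have "eventually (\<lambda>n. (cmod (leaf (p n) - leaf q) / 2) ^ N \<le> cmod (snd (p n) - f (leaf q) (fst (p n))) / 2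
     \<and> 0 \<le> cmod (leaf (p n) - leaf q) / 2) sequentially"
    using eventually_radius[OF z conjunct2[OF conjunct2[OF leafI[OF q]]]]
  proof eventually_elim
    case (elim n)
    then show ?case
      using leaves_bounds(1)[OF _ _ _ r N, of "leaf (p n)" "leaf q" "fst (p n)"] leafI[OF p[of n]] leafI[OF q]
      by (simp add: r_def)
  qed
  from tendsto_power_0[OF d this] have "(\<lambda>n. 2 * (cmod (leaf (p n) - leaf q) / 2)) \<longlonglongrightarrow> 2 * 0"
    by (intro tendsto_intros)
  then have "(\<lambda>n. leaf (p n) - leaf q) \<longlonglongrightarrow> 0" by (simp add: tendsto_norm_zero_iff)
  then show "(leaf \<circ> p) \<longlonglongrightarrow> leaf q" by (simp add: LIM_zero_iff o_def)
qed

lemma cont_slope: "continuous_on K slope"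
  unfolding continuous_on_sequentially
proof (intro allI ballI impI)
  fix p q assume q: "q \<in> K" and "(\<forall>n. p n \<in> K) \<and> p \<longlonglongrightarrow> q"
  then have p: "\<And>n. p n \<in> K" and lim: "p \<longlonglongrightarrow> q" by auto
  have z: "(\<lambda>n. fst (p n)) \<longlonglongrightarrow> fst q" and w: "(\<lambda>n. snd (p n)) \<longlonglongrightarrow> snd q"
    using lim by (auto intro: tendsto_fst tendsto_snd)
  define r where "r = (1 + cmod (fst q)) / 2"
  have r: "r < 1" using leafI[OF q] by (simp add: r_def)
  obtain N :: nat where N: "(1 + r) / (1 - r) \<le> of_nat N" using real_arch_simple by blast
  let ?g = "f (leaf q)"
  have gI: "leaf q \<in> I" "cmod (fst q) < 1" using leafI[OF q] by auto
  have "(\<lambda>n. cmod (snd (p n) - ?g (fst (p n))) / 2) \<longlonglongrightarrow> cmod (snd q - ?g (fst q)) / 2"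
    using gI by (intro tendsto_intros z w leaf_cont_at) auto
  then have d: "(\<lambda>n. cmod (snd (p n) - ?g (fst (p n))) / 2) \<longlonglongrightarrow> 0" using leafI[OF q] by simp
  have "(\<lambda>n. 2 * (4 / (1 - r) * sqrt (cmod (snd (p n) - ?g (fst (p n))) / 2))) \<longlonglongrightarrow> 2 * (4 / (1 - r) * sqrt 0)"
    by (intro tendsto_intros d)
  then have b: "(\<lambda>n. 2 * (4 / (1 - r) * sqrt (cmod (snd (p n) - ?g (fst (p n))) / 2))) \<longlonglongrightarrow> 0" by simp
  have "eventually (\<lambda>n. norm (slope (p n) - deriv ?g (fst (p n))) \<le> 2 * (4 / (1 - r) * sqrt (cmod (snd (p n) - ?g (fst (p n))) / 2))) sequentially"
    using eventually_radius[OF z gI(2)]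
  proof eventually_elim
    case (elim n)
    then show ?case
      using leaves_bounds(4)[OF _ _ _ r N, of "leaf (p n)" "leaf q" "fst (p n)"] leafI[OF p[of n]] gI
      by (simp add: r_def slope_def)
  qed
  then have 1: "(\<lambda>n. slope (p n) - deriv ?g (fst (p n))) \<longlonglongrightarrow> 0"
    by (rule Lim_null_comparison[OF _ b])
  have "isCont (deriv ?g) (fst q)" using leaf_isCont gI by blast
  from tendsto_add[OF 1 isCont_tendsto_compose[OF this z]]
  show "(slope \<circ> p) \<longlonglongrightarrow> slope q" by (simp add: o_def slope_def)
qed

lemma cont_graph: "continuous_on (ball 0 1 \<times> I) (\<lambda>(z, \<alpha>). f \<alpha> z)"
  unfolding continuous_on_sequentially
proof (intro allI ballI impI)
  fix p and q :: "complex \<times> complex" assume q: "q \<in> ball 0 1 \<times> I" and "(\<forall>n. p n \<in> ball 0 1 \<times> I) \<and> p \<longlonglongrightarrow> q"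
  then have p: "\<And>n. p n \<in> ball 0 1 \<times> I" and lim: "p \<longlonglongrightarrow> q" by auto
  have z: "(\<lambda>n. fst (p n)) \<longlonglongrightarrow> fst q" and a: "(\<lambda>n. snd (p n)) \<longlonglongrightarrow> snd q"
    using lim by (auto intro: tendsto_fst tendsto_snd)
  define r where "r = (1 + cmod (fst q)) / 2"
  have gI: "snd q \<in> I" "cmod (fst q) < 1" using q by auto
  have r: "r < 1" using gI by (simp add: r_def)
  obtain N :: nat where N: "(1 + r) / (1 - r) \<le> of_nat N" using real_arch_simple by blast
  have "(\<lambda>n. cmod (snd (p n) - snd q) / 2) \<longlonglongrightarrow> cmod (snd q - snd q) / 2" by (intro tendsto_intros a) simp
  then have d: "(\<lambda>n. cmod (snd (p n) - snd q) / 2) \<longlonglongrightarrow> 0" by simp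
  have "eventually (\<lambda>n. (cmod (f (snd (p n)) (fst (p n)) - f (snd q) (fst (p n))) / 2) ^ N \<le> cmod (snd (p n) - snd q) / 2
     \<and> 0 \<le> cmod (f (snd (p n)) (fst (p n)) - f (snd q) (fst (p n))) / 2) sequentially"
    using eventually_radius[OF z gI(2)]
  proof eventually_elim
    case (elim n)
    then show ?case
      using leaves_bounds(2)[OF _ _ _ r N, of "snd (p n)" "snd q" "fst (p n)"] p[of n] gI
      by (auto simp: r_def)
  qed
  from tendsto_power_0[OF d this] have "(\<lambda>n. 2 * (cmod (f (snd (p n)) (fst (p n)) - f (snd q) (fst (p n))) / 2)) \<longlonglongrightarrow> 2 * 0"
    by (intro tendsto_intros)
  then have "(\<lambda>n. f (snd (p n)) (fst (p n)) - f (snd q) (fst (p n))) \<longlonglongrightarrow> 0" by (simp add: tendsto_norm_zero_iff)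
  from tendsto_add[OF this leaf_cont_at[OF gI z]]
  show "((\<lambda>(z, \<alpha>). f \<alpha> z) \<circ> p) \<longlonglongrightarrow> (case q of (z, \<alpha>) \<Rightarrow> f \<alpha> z)"
    by (simp add: o_def case_prod_beta)
qed

text \<open>A leaf that meets \<open>cball 0 s\<close>, over \<open>0\<close> or over a point of \<open>cball 0 r\<close>, stays bounded away
  from the unit circle at the other place; the constant is that of \<open>disc_growth\<close>.\<close>

definition rad :: "real \<Rightarrow> real \<Rightarrow> real" where
  "rad r s = 1 - (1 - s) * (1 - r) / (1 + r)"

lemma rad_less: "0 \<le> r \<Longrightarrow> r < 1 \<Longrightarrow> s < 1 \<Longrightarrow> rad r s < 1"
  by (simp add: rad_def)

lemma rad_bounds:
  assumes "\<alpha> \<in> I" "cmod z \<le> r" "r < 1"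
  shows "cmod \<alpha> \<le> s \<Longrightarrow> cmod (f \<alpha> z) \<le> rad r s" "cmod (f \<alpha> z) \<le> s \<Longrightarrow> cmod \<alpha> \<le> rad r s"
proof -
  have r0: "0 \<le> r" using assms(2) norm_ge_zero order_trans by blast
  note G = disc_growth[OF leaf_holo[OF assms(1)] _ assms(2,3), unfolded leaf_0[OF assms(1)]]
  have l: "cmod (f \<alpha> z) < 1" if "z \<in> ball 0 1" for z using leaf_lt_1[OF assms(1)] that by simp
  have q: "a \<le> rad r s" if "(1 - b) * (1 - r) \<le> (1 - a) * (1 + r)" "b \<le> s" for a b
  proof -
    have "(1 - s) * (1 - r) \<le> (1 - b) * (1 - r)" using that assms by (intro mult_right_mono) auto
    then have "(1 - s) * (1 - r) / (1 + r) \<le> 1 - a" using that(1) r0 by (simp add: divide_le_eq)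
    then show ?thesis by (simp add: rad_def)
  qed
  show "cmod \<alpha> \<le> s \<Longrightarrow> cmod (f \<alpha> z) \<le> rad r s" by (rule q[OF G(1)]) (use l in auto)
  show "cmod (f \<alpha> z) \<le> s \<Longrightarrow> cmod \<alpha> \<le> rad r s" by (rule q[OF G(2)]) (use l in auto)
qed

lemma slope_bound:
  assumes "\<alpha> \<in> I" "cmod z \<le> r" "r < 1"
  shows "cmod (deriv (f \<alpha>) z) \<le> 2 / (1 - r)"
proof -
  let ?d = "(1 - r) / 2"
  have sub: "cball z ?d \<subseteq> ball 0 1"
  proof
    fix u assume "u \<in> cball z ?d"
    then have "cmod (u - z) \<le> ?d" by (simp add: dist_norm norm_minus_commute)
    then show "u \<in> ball 0 1" using norm_triangle_sub[of u z] assms by (auto simp: field_simps)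
  qed
  have "cmod ((deriv ^^ 1) (f \<alpha>) z) \<le> fact 1 * 1 / ?d ^ 1"
  proof (rule Cauchy_inequality)
    show "f \<alpha> holomorphic_on ball z ?d" "continuous_on (cball z ?d) (f \<alpha>)"
      using leaf_holo[OF assms(1)] sub ball_subset_cball
      by (meson holomorphic_on_subset order_trans holomorphic_on_imp_continuous_on)+
    show "cmod (f \<alpha> x) \<le> 1" if "cmod (z - x) = ?d" for x
      using leaf_lt_1[OF assms(1), of x] sub that by (force simp: dist_norm)
  qed (use assms in auto)
  then show ?thesis by simp
qed

end

section \<open>The measure of a weakly directed current\<close>

lemma smooth_frechet:
  assumes "smooth f"
  shows "smooth (\<lambda>p. frechet_derivative f (at p) v)"
proof -
  have "iter_deriv vs (\<lambda>p. frechet_derivative f (at p) v) = iter_deriv (vs @ [v]) f" for vs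
    by (induction vs) auto
  then show ?thesis using assms by (simp add: smooth_def)
qed

lemma frechet_outside_supp: "p \<notin> supp f \<Longrightarrow> frechet_derivative f (at p) v = 0"
proof -
  assume p: "p \<notin> supp f"
  have "open (- supp f)" by (simp add: supp_def open_Compl)
  then have "(f has_derivative (\<lambda>_. 0)) (at p)"
    using p by (intro has_derivative_transform_within_open[OF has_derivative_const[of 0]])
       (auto simp: not_in_supp)
  then show ?thesis by (metis frechet_derivative_at)
qed

lemma test_on_frechet: "test_on U f \<Longrightarrow> test_on U (\<lambda>p. frechet_derivative f (at p) v)"
  by (rule test_onI[OF smooth_frechet, of f "supp f"]) (auto dest: test_onD simp: frechet_outside_supp)

lemma test_on_d_zbar: "test_on U a \<Longrightarrow> test_on U (d_zbar k a)"
  and test_on_d_z: "test_on U a \<Longrightarrow> test_on U (d_z k a)"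
proof -
  assume a: "test_on U a"
  have L: "bounded_linear (\<lambda>x::complex. c * x)" for c by (rule bounded_linear_mult_right)
  note t = test_on_add[OF test_on_linear[OF test_on_frechet[OF a] L] test_on_linear[OF test_on_frechet[OF a] L]]
  have eq: "d_zbar k a = (\<lambda>p. (1/2) * frechet_derivative a (at p) (along k 1) + (\<i>/2) * frechet_derivative a (at p) (along k \<i>))"
    "d_z k a = (\<lambda>p. (1/2) * frechet_derivative a (at p) (along k 1) + (-\<i>/2) * frechet_derivative a (at p) (along k \<i>))"
    by (auto simp: d_zbar_def d_z_def fun_eq_iff field_simps)
  show "test_on U (d_zbar k a)" unfolding eq(1) by (rule t)
  show "test_on U (d_z k a)" unfolding eq(2) by (rule t)
qed

lemma frechet_via_wirtinger:
  assumes "a differentiable at p"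
  shows "frechet_derivative a (at p) (c, d) =
     c * d_z 1 a p + d * d_z 2 a p + cnj c * d_zbar 1 a p + cnj d * d_zbar 2 a p"
proof -
  let ?D = "frechet_derivative a (at p)"
  have lin: "linear ?D"
    using assms by (simp add: frechet_derivative_works has_derivative_linear)
  have eq: "(c, d) = Re c *\<^sub>R (1, 0) + Im c *\<^sub>R (\<i>, 0) + Re d *\<^sub>R (0, 1) + Im d *\<^sub>R (0, \<i>)"
    by (auto simp: complex_eq_iff)
  have "?D (c, d) = Re c *\<^sub>R ?D (1, 0) + Im c *\<^sub>R ?D (\<i>, 0) + Re d *\<^sub>R ?D (0, 1) + Im d *\<^sub>R ?D (0, \<i>)"
    unfolding eq linear_add[OF lin] linear_scale[OF lin] ..
  moreover have "(2::2) \<noteq> 1" by simp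
  ultimately show ?thesis
    by (simp add: d_z_def d_zbar_def along_def complex_eq_iff scaleR_conv_of_real field_simps)
qed

lemma cc_mult_on:
  fixes \<psi> G :: "'a::t2_space \<Rightarrow> complex"
  assumes "cc U \<psi>" "continuous_on U G" "open U"
  shows "cc U (\<lambda>p. G p * \<psi> p)"
proof -
  from assms obtain C where C: "compact C" "C \<subseteq> U" "\<forall>x. x \<notin> C \<longrightarrow> \<psi> x = 0" "continuous_on UNIV \<psi>"
    by (auto simp: cc_def)
  have "continuous_on (U \<union> - C) (\<lambda>p. G p * \<psi> p)"
  proof (rule continuous_on_open_Un)
    show "continuous_on U (\<lambda>p. G p * \<psi> p)"
      using assms C by (intro continuous_intros) (auto intro: continuous_on_subset)
    have "continuous_on (- C) (\<lambda>p. 0 :: complex)" by simp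
    then show "continuous_on (- C) (\<lambda>p. G p * \<psi> p)"
      by (rule continuous_on_eq) (use C in auto)
  qed (use assms C in \<open>auto intro: compact_imp_closed\<close>)
  moreover have "U \<union> - C = UNIV" using C by auto
  ultimately show ?thesis unfolding cc_def using C by (intro conjI exI[of _ C]) auto
qed

lemma open_bidisc: "open bidisc"
  by (simp add: bidisc_def open_Times)

lemma qform_tangent: "qform A (vector [1, g]) = A $ 1 $ 1 + g * A $ 2 $ 1 + cnj g * A $ 1 $ 2 + cnj g * (g * A $ 2 $ 2)"
  by (simp add: qform_def sum_2 algebra_simps)

context pos_current
begin

text \<open>The coefficient of \<open>T\<close> that will determine all the others.\<close>

definition \<Lambda> :: "(complex \<times> complex \<Rightarrow> real) \<Rightarrow> real" where
  "\<Lambda> \<psi> = Re (TE (\<lambda>x. munit 1 1 (of_real (\<psi> x))))"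

lemma cc_munit: "cc bidisc \<psi> \<Longrightarrow> cc bidisc (\<lambda>x. munit j k (\<psi> x))"
  by (rule cc_linear[OF _ bl_munit])

lemma cc_of_real: "cc X \<psi> \<Longrightarrow> cc X (\<lambda>x. complex_of_real (\<psi> x))"
  by (rule cc_linear[OF _ bounded_linear_of_real])

lemma TE_munit_add:
  assumes "cc bidisc \<psi>" "cc bidisc \<psi>'"
  shows "TE (\<lambda>x. munit j k (\<psi> x + \<psi>' x)) = TE (\<lambda>x. munit j k (\<psi> x)) + TE (\<lambda>x. munit j k (\<psi>' x))"
  using TE_add[OF cc_munit[OF assms(1)] cc_munit[OF assms(2)]]
  by (simp add: linear_add[OF bounded_linear.linear[OF bl_munit]])

lemma munit_scale: "munit j k (c * z) = mscale c (munit j k z)"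
  by (simp add: munit_def mscale_def vec_eq_iff)

lemma TE_munit_scale:
  assumes "cc bidisc \<psi>"
  shows "TE (\<lambda>x. munit j k (c * \<psi> x)) = c * TE (\<lambda>x. munit j k (\<psi> x))"
  unfolding munit_scale by (rule TE_scale[OF cc_munit[OF assms]])

sublocale R: riesz bidisc \<Lambda>
proof
  fix f g :: "complex \<times> complex \<Rightarrow> real" and c :: real
  show "cc bidisc f \<Longrightarrow> cc bidisc g \<Longrightarrow> \<Lambda> (\<lambda>x. f x + g x) = \<Lambda> f + \<Lambda> g"
    using TE_munit_add[OF cc_of_real cc_of_real, of f g 1 1] by (simp add: \<Lambda>_def)
  show "cc bidisc f \<Longrightarrow> \<Lambda> (\<lambda>x. c * f x) = c * \<Lambda> f"
    using TE_munit_scale[OF cc_of_real, of f 1 1 "of_real c"] by (simp add: \<Lambda>_def)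
  show "cc bidisc f \<Longrightarrow> (\<And>x. 0 \<le> f x) \<Longrightarrow> 0 \<le> \<Lambda> f"
    using TE_pos[of f] by (simp add: \<Lambda>_def complex_nonneg_Reals_iff)
qed (rule open_bidisc)

lemma TE_real: 
  assumes "cc bidisc \<psi>"
  shows "TE (\<lambda>x. munit 1 1 (of_real (\<psi> x))) = of_real (LINT x|R.\<nu>. \<psi> x)"
proof -
  let ?p = "\<lambda>x. max (\<psi> x) 0" and ?m = "\<lambda>x. max (- \<psi> x) 0"
  have 1: "cc bidisc ?p" "cc bidisc ?m"
    by (rule cc_compose[OF assms, of "\<lambda>t. max t 0"] cc_compose[OF assms, of "\<lambda>t. max (- t) 0"];
        auto intro!: continuous_intros)+
  have eq: "complex_of_real (\<psi> x) = of_real (?p x) + (-1) * of_real (?m x)" for x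
    by (auto simp: max_def)
  have "TE (\<lambda>x. munit 1 1 (of_real (\<psi> x))) = TE (\<lambda>x. munit 1 1 (of_real (?p x))) + (-1) * TE (\<lambda>x. munit 1 1 (of_real (?m x)))"
    unfolding eq
    by (subst TE_munit_add[OF cc_of_real[OF 1(1)] cc_linear[OF cc_of_real[OF 1(2)] bounded_linear_mult_right]])
       (simp only: TE_munit_scale[OF cc_of_real[OF 1(2)]])
  then have "TE (\<lambda>x. munit 1 1 (of_real (\<psi> x))) \<in> \<real>"
    using TE_pos[OF 1(1)] TE_pos[OF 1(2)] by (auto simp: complex_nonneg_Reals_iff complex_is_Real_iff)
  then have "TE (\<lambda>x. munit 1 1 (of_real (\<psi> x))) = of_real (\<Lambda> \<psi>)"
    by (simp add: \<Lambda>_def)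
  then show ?thesis by (simp add: R.L_eq_integral[OF assms])
qed

lemma cc_integrable_complex: 
  fixes \<psi> :: "complex \<times> complex \<Rightarrow> complex"
  shows "cc bidisc \<psi> \<Longrightarrow> integrable R.\<nu> \<psi>"
proof -
  assume \<psi>: "cc bidisc \<psi>"
  have "integrable R.\<nu> (\<lambda>x. of_real (Re (\<psi> x)) + \<i> * of_real (Im (\<psi> x)))"
    using R.cc_integrable[OF cc_linear[OF \<psi> bounded_linear_Re]] R.cc_integrable[OF cc_linear[OF \<psi> bounded_linear_Im]]
    by (intro Bochner_Integration.integrable_add integrable_mult_right integrable_of_real)
  then show ?thesis by (simp add: complex_eq[symmetric])
qed

lemma TE_11:
  fixes \<psi> :: "complex \<times> complex \<Rightarrow> complex"
  assumes \<psi>: "cc bidisc \<psi>"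
  shows "TE (\<lambda>x. munit 1 1 (\<psi> x)) = (LINT x|R.\<nu>. \<psi> x)"
proof -
  note c = cc_linear[OF \<psi> bounded_linear_Re] cc_linear[OF \<psi> bounded_linear_Im]
  have "TE (\<lambda>x. munit 1 1 (of_real (Re (\<psi> x)) + \<i> * of_real (Im (\<psi> x)))) =
     of_real (LINT x|R.\<nu>. Re (\<psi> x)) + \<i> * of_real (LINT x|R.\<nu>. Im (\<psi> x))"
    by (subst TE_munit_add[OF cc_of_real[OF c(1)] cc_linear[OF cc_of_real[OF c(2)] bounded_linear_mult_right]])
       (simp only: TE_munit_scale[OF cc_of_real[OF c(2)]] TE_real[OF c(1)] TE_real[OF c(2)])
  also have "\<dots> = (LINT x|R.\<nu>. \<psi> x)"
    using cc_integrable_complex[OF \<psi>] by (simp add: complex_eq_iff)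
  finally show ?thesis by (simp add: complex_eq[symmetric])
qed

end

locale lam_current = lamination K f + pos_current T for K f T +
  assumes supported: "supported_on bidisc T K"
begin

lemma borel_K: "K \<in> sets borel"
proof -
  obtain C where "closed C" "K = bidisc \<inter> C"
    using closed_K by (auto simp: closedin_closed)
  then show ?thesis using open_bidisc by auto
qed

lemma open_complement: "open (bidisc - K)"
proof -
  obtain C where "closed C" "K = bidisc \<inter> C"
    using closed_K by (auto simp: closedin_closed)
  then have "bidisc - K = bidisc \<inter> - C" by auto
  then show ?thesis using open_bidisc \<open>closed C\<close> by (simp add: open_Int open_Compl)
qed

lemma elem_dist_bump:
  "elem S (\<lambda>x. of_real (flat 1 (d\<^sup>2 - (cmod (fst x - fst p))\<^sup>2 - (cmod (snd x - snd p))\<^sup>2)))"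
proof -
  have "elem S (\<lambda>x. of_real (flat 1 (Re (of_real (d\<^sup>2) - of_real ((cmod (fst x - fst p))\<^sup>2) - of_real ((cmod (snd x - snd p))\<^sup>2)))))"
    by (intro elem_flat elem_diff elem_const elem_norm_sq elem_fst elem_snd)
  then show ?thesis by simp
qed

text \<open>Every point of the bidisc off \<open>K\<close> has a null neighbourhood, on which a smooth bump function is
  positive; by the Lindeloef property countably many of these suffice.\<close>

lemma AE_K: "AE p in R.\<nu>. p \<in> K"
proof -
  have local_null: "\<exists>d>0. emeasure R.\<nu> (ball p d) = 0" if p: "p \<in> bidisc - K" for p
  proof -
    obtain d where d: "d > 0" "cball p d \<subseteq> bidisc - K"
      using open_complement p by (meson open_contains_cball)
    define \<psi> where "\<psi> x = flat 1 (d\<^sup>2 - (cmod (fst x - fst p))\<^sup>2 - (cmod (snd x - snd p))\<^sup>2)" for x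
    have dist: "(dist x p)\<^sup>2 = (cmod (fst x - fst p))\<^sup>2 + (cmod (snd x - snd p))\<^sup>2" for x
      by (simp add: dist_prod_def dist_norm)
    have in_ball: "\<psi> x > 0 \<longleftrightarrow> x \<in> ball p d" for x
    proof -
      have "\<psi> x > 0 \<longleftrightarrow> (dist x p)\<^sup>2 < d\<^sup>2" unfolding \<psi>_def flat_pos dist by linarith
      then show ?thesis using d(1) by (auto simp: dist_commute intro: power2_less_imp_less power_strict_mono)
    qed
    have nn: "\<psi> x \<ge> 0" for x by (simp add: \<psi>_def flat_nonneg)
    have "test_on (bidisc - K) (\<lambda>x. complex_of_real (\<psi> x))"
    proof (rule test_onI[of _ "cball p d"])
      show "smooth (\<lambda>x. complex_of_real (\<psi> x))" unfolding \<psi>_def by (intro elem_imp_smooth elem_dist_bump)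
      show "complex_of_real (\<psi> x) = 0" if "x \<notin> cball p d" for x
        using in_ball[of x] nn[of x] that by (auto simp: less_le)
    qed (use d in auto)
    then have t: "test_on (bidisc - K) (\<lambda>x. munit 1 1 (of_real (\<psi> x)))" "test_on bidisc (\<lambda>x. complex_of_real (\<psi> x))"
      by (rule test_on_munit) (use \<open>test_on (bidisc - K) (\<lambda>x. complex_of_real (\<psi> x))\<close> in \<open>auto simp: test_on_def\<close>)
    have cc: "cc bidisc \<psi>"
      using cc_linear[OF test_on_cc[OF t(2)] bounded_linear_Re] by simp
    have "T (\<lambda>x. munit 1 1 (of_real (\<psi> x))) = 0" using supported t(1) by (auto simp: supported_on_def)
    then have "(LINT x|R.\<nu>. \<psi> x) = 0"
      using TE_real[OF cc] TE_test[OF test_on_munit[OF t(2)], of 1 1] by simp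
    then have "AE x in R.\<nu>. \<psi> x = 0"
      using integral_nonneg_eq_0_iff_AE[OF R.cc_integrable[OF cc]] nn by simp
    then have "AE x in R.\<nu>. x \<notin> ball p d" by eventually_elim (use in_ball in force)
    then have "emeasure R.\<nu> (ball p d) = 0"
      by (subst (asm) AE_iff_measurable[where N="ball p d"]) (auto simp: R.sets_nu R.space_nu)
    then show ?thesis using d by blast
  qed
  then obtain d where d: "\<And>p. p \<in> bidisc - K \<Longrightarrow> d p > 0 \<and> emeasure R.\<nu> (ball p (d p)) = 0" by metis
  let ?F = "(\<lambda>p. ball p (d p)) ` (bidisc - K)"
  obtain F' where F': "F' \<subseteq> ?F" "countable F'" "\<Union>F' = \<Union>?F"
    using Lindelof[of ?F] by auto
  have sub: "bidisc - K \<subseteq> \<Union>F'" unfolding F'(3) using d by force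
  have "(\<Union>S\<in>F'. S) \<in> null_sets R.\<nu>"
    using F'(1) d by (intro null_sets_UN'[OF F'(2)]) (auto simp: null_sets_def R.sets_nu)
  then have n1: "AE p in R.\<nu>. p \<notin> \<Union>F'" using AE_not_in by fastforce
  have "- bidisc \<in> null_sets R.\<nu>"
    using R.om_outside open_bidisc by (auto simp: null_sets_def R.sets_nu R.emeasure_nu)
  then have n2: "AE p in R.\<nu>. p \<notin> - bidisc" by (rule AE_not_in)
  from n1 n2 show ?thesis by eventually_elim (use sub in auto)
qed

definition N :: "(complex \<times> complex) measure" where
  "N = restrict_space R.\<nu> K"

lemma sets_N: "sets N = sets (restrict_space borel K)" and space_N: "space N = K"
  by (auto simp: N_def R.sets_nu R.space_nu sets_restrict_space space_restrict_space)

lemma N_integral: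
  fixes g :: "complex \<times> complex \<Rightarrow> complex"
  assumes "integrable R.\<nu> g"
  shows "integrable N g" "(LINT p|N. g p) = (LINT p|R.\<nu>. g p)"
proof -
  have K: "K \<inter> space R.\<nu> \<in> sets R.\<nu>" using borel_K by (simp add: R.sets_nu R.space_nu)
  have ae: "AE p in R.\<nu>. indicator K p *\<^sub>R g p = g p" using AE_K by eventually_elim simp
  have m: "g \<in> borel_measurable R.\<nu>" using assms by auto
  have "integrable R.\<nu> (\<lambda>p. indicator K p *\<^sub>R g p)"
    using K by (intro integrable_mult_indicator[OF _ assms]) (simp add: R.space_nu)
  then show "integrable N g" unfolding N_def using K by (simp add: integrable_restrict_space)
  have "(LINT p|N. g p) = (LINT p|R.\<nu>. indicator K p *\<^sub>R g p)"
    unfolding N_def using K by (simp add: integral_restrict_space)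
  also have "\<dots> = (LINT p|R.\<nu>. g p)"
    using K m ae by (intro integral_cong_AE borel_measurable_scaleR borel_measurable_indicator) (simp_all add: R.space_nu)
  finally show "(LINT p|N. g p) = (LINT p|R.\<nu>. g p)" .
qed

lemma N_finite: "r < 1 \<Longrightarrow> emeasure N (K \<inter> box r) < top"
proof -
  assume r: "r < 1"
  have K: "K \<inter> space R.\<nu> \<in> sets R.\<nu>" using borel_K by (simp add: R.sets_nu R.space_nu)
  have "emeasure N (K \<inter> box r) = emeasure R.\<nu> (K \<inter> box r)"
    unfolding N_def by (rule emeasure_restrict_space[OF K]) auto
  also have "\<dots> \<le> emeasure R.\<nu> (box r)"
    by (rule emeasure_mono) (auto simp: R.sets_nu intro!: borel_closed closed_Times)
  also have "\<dots> < top" using compact_bidisc_cball[OF r] by (intro R.emeasure_nu_finite) auto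
  finally show ?thesis .
qed

end

locale wd_current = lam_current +
  assumes wd: "weakly_directed K f T"
begin

lemma slope_extension: "\<exists>G. continuous_on bidisc G \<and> (\<forall>p\<in>K. G p = slope p)"
  using Tietze_unbounded[OF cont_slope closed_K] by metis

text \<open>Weak directedness speaks of forms that are continuous on the whole bidisc, so the slope is
  extended by Tietze's theorem.\<close>

definition G :: "complex \<times> complex \<Rightarrow> complex" where
  "G = (SOME G. continuous_on bidisc G \<and> (\<forall>p\<in>K. G p = slope p))"

lemma G: "continuous_on bidisc G" "p \<in> K \<Longrightarrow> G p = slope p"
  using someI_ex[OF slope_extension] unfolding G_def by auto

text \<open>This is weak directedness for \<open>\<lambda> = dw - G dz\<close>, paired with \<open>\<psi> d(cnj z\<^sub>k)\<close>.\<close>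

lemma TE_2k_test:
  assumes \<psi>: "test_on bidisc \<psi>"
  shows "TE (\<lambda>x. munit 2 k (\<psi> x)) = TE (\<lambda>x. munit 1 k (G x * \<psi> x))"
proof -
  define l :: coform where "l p = (\<chi> j. if j = 1 then - G p else 1)" for p
  define b :: coform where "b p = (\<chi> i. if i = k then \<psi> p else 0)" for p
  have "continuous_on bidisc l"
  proof -
    have "continuous_on bidisc (\<lambda>p. if j = 1 then - G p else 1)" for j :: 2
      using G(1) by (cases "j = 1") (auto intro: continuous_intros)
    then show ?thesis unfolding l_def by (intro continuous_on_vec_lambda)
  qed
  moreover have "\<forall>\<alpha>\<in>I. \<forall>z\<in>ball 0 1. \<exists>c. c \<noteq> 0 \<and> l (z, f \<alpha> z) $ 1 = - c * deriv (f \<alpha>) z \<and> l (z, f \<alpha> z) $ 2 = c"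
    using G(2)[OF graph_in_K] leaf_eq by (auto simp: l_def slope_def)
  moreover have "test_on bidisc b"
  proof -
    have "bounded_linear (\<lambda>c. (\<chi> i. if i = k then c else 0) :: complex^2)"
      by (intro linear_conv_bounded_linear[THEN iffD1] linearI) (auto simp: vec_eq_iff)
    from test_on_linear[OF \<psi> this] show ?thesis by (simp add: b_def[abs_def])
  qed
  ultimately have "wedge_current bidisc l T b = 0" using wd unfolding weakly_directed_def by blast
  moreover have "wedge l b = (\<lambda>p. mscale (-2 * \<i>) (munit 2 k (\<psi> p) + munit 1 k ((-1) * (G p * \<psi> p))))"
  proof -
    have "(2::2) \<noteq> 1" by simp
    then show ?thesis
      using exhaust_2 by (auto simp: wedge_def l_def b_def mscale_def munit_def vec_eq_iff fun_eq_iff)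
  qed
  ultimately have 0: "TE (\<lambda>p. mscale (-2 * \<i>) (munit 2 k (\<psi> p) + munit 1 k ((-1) * (G p * \<psi> p)))) = 0"
    by (simp add: wedge_current_def)
  note c1 = cc_munit[OF test_on_cc[OF \<psi>], of 2 k]
  note cG = cc_mult_on[OF test_on_cc[OF \<psi>] G(1) open_bidisc]
  note c2 = cc_munit[OF cc_linear[OF cG bounded_linear_mult_right[of "-1"]], of 1 k]
  have "(-2 * \<i>) * (TE (\<lambda>x. munit 2 k (\<psi> x)) + (-1) * TE (\<lambda>x. munit 1 k (G x * \<psi> x))) = 0"
    using 0 unfolding TE_scale[OF cc_add[OF c1 c2]] TE_add[OF c1 c2] TE_munit_scale[OF cG] .
  then show ?thesis by simp
qed

text \<open>The relation passes to continuous functions by approximation.  This is needed for the last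
  coefficient, where it is applied to a multiple of \<open>G\<close>.\<close>

lemma TE_2k:
  fixes \<psi> :: "complex \<times> complex \<Rightarrow> complex"
  assumes \<psi>: "cc bidisc \<psi>"
  shows "TE (\<lambda>x. munit 2 k (\<psi> x)) = TE (\<lambda>x. munit 1 k (G x * \<psi> x))"
proof -
  obtain r where r: "0 < r" "r < 1" "\<And>x. x \<notin> box r \<Longrightarrow> \<psi> x = 0" using cc_bidiscE[OF \<psi>] by blast
  define s where "s = (1 + r) / 2"
  have s: "0 < s" "s < 1" "r \<le> s" using r by (auto simp: s_def)
  obtain M where M: "M \<ge> 0" "\<And>\<phi> c. continuous_on UNIV \<phi> \<Longrightarrow> (\<forall>x. x \<notin> box s \<longrightarrow> \<phi> x = 0) \<Longrightarrow>
     (\<forall>x. norm (\<phi> x) \<le> c) \<Longrightarrow> cmod (TE \<phi>) \<le> M * c" using TE_bound[OF s(1,2)] by blast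
  have "compact (G ` box s)"
    using compact_bidisc_cball[OF s(2)] G(1) by (intro compact_continuous_image) (auto intro: continuous_on_subset)
  from compact_imp_bounded[OF this, unfolded bounded_pos]
  obtain B where B: "B > 0" "\<And>x. x \<in> box s \<Longrightarrow> cmod (G x) \<le> B" by blast
  have small: "cmod (TE (\<lambda>x. munit 2 k (\<psi> x)) - TE (\<lambda>x. munit 1 k (G x * \<psi> x))) \<le> M * (4 * e) + M * (4 * (B * e))" if e: "e > 0" for e
  proof -
    obtain \<eta> where \<eta>: "test_on bidisc \<eta>" "\<And>x. x \<notin> box s \<Longrightarrow> \<eta> x = 0" "\<And>x. cmod (\<eta> x - \<psi> x) \<le> e"
      using scalar_approx[OF conjunct1[OF \<psi>[unfolded cc_def]] r e] unfolding s_def by blast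
    define d where "d x = \<psi> x + (-1) * \<eta> x" for x
    have cm: "cc bidisc (\<lambda>x. (-1) * \<eta> x)" by (rule cc_linear[OF test_on_cc[OF \<eta>(1)] bounded_linear_mult_right])
    have ccd: "cc bidisc d" unfolding d_def by (rule cc_add[OF \<psi> cm])
    have ccG: "cc bidisc (\<lambda>x. G x * d x)" by (rule cc_mult_on[OF ccd G(1) open_bidisc])
    have bxs: "x \<notin> box r" if "x \<notin> box s" for x using that s by (auto)
    have d0: "d x = 0" if "x \<notin> box s" for x using r(3)[OF bxs[OF that]] \<eta>(2)[OF that] by (simp add: d_def)
    have de: "cmod (d x) \<le> e" for x using \<eta>(3)[of x] by (simp add: d_def norm_minus_commute)
    have un: "norm (munit j k z) \<le> 4 * c" if "cmod z \<le> c" for j z c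
      using that order_trans[OF norm_ge_zero that] by (intro norm_le_entries) (simp add: munit_def)
    have z0: "munit j k 0 = 0" for j by (simp add: munit_def vec_eq_iff)
    have "cmod (TE (\<lambda>x. munit 2 k (d x))) \<le> M * (4 * e)"
      using cc_munit[OF ccd, of 2 k] d0 de by (intro M(2)) (auto simp: z0 cc_def intro: un)
    moreover have "cmod (TE (\<lambda>x. munit 1 k (G x * d x))) \<le> M * (4 * (B * e))"
    proof (rule M(2))
      show "continuous_on UNIV (\<lambda>x. munit 1 k (G x * d x))" using cc_munit[OF ccG, of 1 k] by (simp add: cc_def)
      show "\<forall>x. x \<notin> box s \<longrightarrow> munit 1 k (G x * d x) = 0" using d0 by (simp add: z0)
      have "cmod (G x * d x) \<le> B * e" for x
      proof (cases "x \<in> box s")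
        case True
        then show ?thesis using B de[of x] by (auto simp: norm_mult intro: mult_mono)
      qed (use d0 B e in simp)
      then show "\<forall>x. norm (munit 1 k (G x * d x)) \<le> 4 * (B * e)" using un by blast
    qed
    moreover have "TE (\<lambda>x. munit 2 k (d x)) = TE (\<lambda>x. munit 2 k (\<psi> x)) - TE (\<lambda>x. munit 2 k (\<eta> x))"
      unfolding d_def TE_munit_add[OF \<psi> cm] TE_munit_scale[OF test_on_cc[OF \<eta>(1)]] by simp
    moreover have "TE (\<lambda>x. munit 1 k (G x * d x)) = TE (\<lambda>x. munit 1 k (G x * \<psi> x)) - TE (\<lambda>x. munit 1 k (G x * \<eta> x))"
    proof -
      note g1 = cc_mult_on[OF \<psi> G(1) open_bidisc] and g2 = cc_mult_on[OF test_on_cc[OF \<eta>(1)] G(1) open_bidisc]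
      have "G x * d x = G x * \<psi> x + (-1) * (G x * \<eta> x)" for x by (simp add: d_def algebra_simps)
      then show ?thesis
        using TE_munit_add[OF g1 cc_linear[OF g2 bounded_linear_mult_right[of "-1"]], of 1 k] TE_munit_scale[OF g2, of 1 k "-1"]
        by simp
    qed
    ultimately show ?thesis
      using TE_2k_test[OF \<eta>(1), of k] norm_triangle_ineq4[of "TE (\<lambda>x. munit 2 k (d x))" "TE (\<lambda>x. munit 1 k (G x * d x))"]
      by simp
  qed
  have "cmod (TE (\<lambda>x. munit 2 k (\<psi> x)) - TE (\<lambda>x. munit 1 k (G x * \<psi> x))) \<le> 0"
  proof (rule field_le_epsilon)
    fix e :: real assume e: "e > 0"
    define q where "q = 4 * M + 4 * M * B + 1"
    have q: "q > 0" "4 * M + 4 * M * B \<le> q" using M B by (simp_all add: q_def add_nonneg_pos)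
    have "M * (4 * (e / q)) + M * (4 * (B * (e / q))) = e * ((4 * M + 4 * M * B) / q)"
      by (simp add: add_divide_distrib algebra_simps)
    also have "\<dots> \<le> e * 1" using q e by (intro mult_left_mono) auto
    finally show "cmod (TE (\<lambda>x. munit 2 k (\<psi> x)) - TE (\<lambda>x. munit 1 k (G x * \<psi> x))) \<le> 0 + e"
      using small[of "e / q"] e q by simp
  qed
  then show ?thesis by simp
qed

text \<open>The remaining off-diagonal coefficient is the conjugate of the other one, as \<open>T\<close> is real.\<close>

lemma TE_12:
  fixes \<psi> :: "complex \<times> complex \<Rightarrow> complex"
  assumes \<psi>: "cc bidisc \<psi>"
  shows "TE (\<lambda>x. munit 1 2 (\<psi> x)) = (LINT x|R.\<nu>. cnj (G x) * \<psi> x)"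
proof -
  have c: "cc bidisc (\<lambda>x. cnj (\<psi> x))" by (rule cc_linear[OF \<psi> bounded_linear_cnj])
  have "(\<lambda>x. munit 1 2 (\<psi> x)) = (\<lambda>x. adj (munit 2 1 (cnj (\<psi> x))))"
    by (auto simp: fun_eq_iff munit_def adj_def vec_eq_iff)
  then have "TE (\<lambda>x. munit 1 2 (\<psi> x)) = cnj (TE (\<lambda>x. munit 2 1 (cnj (\<psi> x))))"
    using TE_adj[OF cc_munit[OF c], of 2 1] by simp
  also have "\<dots> = cnj (LINT x|R.\<nu>. G x * cnj (\<psi> x))"
    unfolding TE_2k[OF c] TE_11[OF cc_mult_on[OF c G(1) open_bidisc]] ..
  also have "\<dots> = (LINT x|R.\<nu>. cnj (G x * cnj (\<psi> x)))" by (rule Bochner_Integration.integral_cnj[symmetric])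
  finally show ?thesis by simp
qed

text \<open>In terms of the first coefficient measure, the coefficients of \<open>T\<close> have the densities \<open>1\<close>,
  \<open>G\<close>, \<open>cnj G\<close> and \<open>|G|\<^sup>2\<close>; these are the products of the components of \<open>(1, G)\<close> and their
  conjugates.\<close>

lemma TE_representation:
  assumes \<phi>: "cc bidisc \<phi>"
  shows "integrable N (\<lambda>p. qform (\<phi> p) (vector [1, slope p]))"
    and "TE \<phi> = (LINT p|N. qform (\<phi> p) (vector [1, slope p]))"
proof -
  have e: "cc bidisc (\<lambda>p. \<phi> p $ j $ k)" for j k by (rule cc_linear[OF \<phi> bl_entry])
  have G': "continuous_on bidisc (\<lambda>p. cnj (G p))" using G(1) by (intro continuous_intros)
  note m = cc_mult_on[OF _ G(1) open_bidisc] cc_mult_on[OF _ G' open_bidisc]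
  note i = cc_integrable_complex[OF e] cc_integrable_complex[OF m(1)[OF e]] cc_integrable_complex[OF m(2)[OF e]]
     cc_integrable_complex[OF m(2)[OF m(1)[OF e]]]
  have "\<phi> = (\<lambda>p. munit 1 1 (\<phi> p $ 1 $ 1) + munit 2 1 (\<phi> p $ 2 $ 1) + munit 1 2 (\<phi> p $ 1 $ 2) + munit 2 2 (\<phi> p $ 2 $ 2))"
  proof
    show "\<phi> p = munit 1 1 (\<phi> p $ 1 $ 1) + munit 2 1 (\<phi> p $ 2 $ 1) + munit 1 2 (\<phi> p $ 1 $ 2) + munit 2 2 (\<phi> p $ 2 $ 2)" for p
      by (subst mat_decomp) (simp add: sum_2 add_ac)
  qed
  from arg_cong[OF this, of TE]
  have "TE \<phi> = TE (\<lambda>p. munit 1 1 (\<phi> p $ 1 $ 1)) + TE (\<lambda>p. munit 2 1 (\<phi> p $ 2 $ 1))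
      + TE (\<lambda>p. munit 1 2 (\<phi> p $ 1 $ 2)) + TE (\<lambda>p. munit 2 2 (\<phi> p $ 2 $ 2))"
    by (simp only: TE_add cc_add cc_munit e)
  also have "\<dots> = (LINT p|R.\<nu>. \<phi> p $ 1 $ 1) + (LINT p|R.\<nu>. G p * \<phi> p $ 2 $ 1) + (LINT p|R.\<nu>. cnj (G p) * \<phi> p $ 1 $ 2)
      + (LINT p|R.\<nu>. cnj (G p) * (G p * \<phi> p $ 2 $ 2))"
    unfolding TE_2k[OF e] TE_11[OF e] TE_11[OF m(1)[OF e]] TE_12[OF e] TE_12[OF m(1)[OF e]] ..
  also have "\<dots> = (LINT p|R.\<nu>. qform (\<phi> p) (vector [1, G p]))"
    unfolding qform_tangent using i by simp
  finally have 1: "TE \<phi> = (LINT p|R.\<nu>. qform (\<phi> p) (vector [1, G p]))" .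
  have int: "integrable R.\<nu> (\<lambda>p. qform (\<phi> p) (vector [1, G p]))"
    unfolding qform_tangent using i by (intro Bochner_Integration.integrable_add)
  have s: "qform (\<phi> p) (vector [1, G p]) = qform (\<phi> p) (vector [1, slope p])" if "p \<in> space N" for p
    using G(2)[of p] that by (simp add: space_N)
  show "integrable N (\<lambda>p. qform (\<phi> p) (vector [1, slope p]))"
    using N_integral(1)[OF int] s by (simp cong: Bochner_Integration.integrable_cong)
  show "TE \<phi> = (LINT p|N. qform (\<phi> p) (vector [1, slope p]))"
    unfolding 1 N_integral(2)[OF int, symmetric] using s by (rule Bochner_Integration.integral_cong[OF refl])
qed

end

locale closed_wd_current = wd_current +
  assumes closed: "closed_current bidisc T"
begin

text \<open>The \<open>(1,1)\<close> parts of \<open>d(a dz)\<close> and \<open>d(a d(cnj z))\<close>, evaluated on \<open>(1, slope)\<close>, are up to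
  constants the derivatives of \<open>a\<close> along the leaf in the direction of \<open>d/d(cnj z)\<close> and \<open>d/dz\<close>.\<close>

lemma leafwise_derivative:
  fixes a :: "complex \<times> complex \<Rightarrow> complex"
  assumes a: "test_on bidisc a"
  shows "integrable N (\<lambda>p. frechet_derivative a (at p) (e, slope p * e))"
    and "(LINT p|N. frechet_derivative a (at p) (e, slope p * e)) = 0"
proof -
  have ne: "(2::2) \<noteq> 1" by simp
  define u :: "complex \<Rightarrow> complex^2" where "u c = (\<chi> i. if i = 1 then c else 0)" for c
  have "bounded_linear u"
    unfolding u_def by (intro linear_conv_bounded_linear[THEN iffD1] linearI) (auto simp: vec_eq_iff)
  then have tu: "test_on bidisc (\<lambda>p. u (a p))" by (rule test_on_linear[OF a])
  have t0: "test_on bidisc (\<lambda>_. 0 :: complex^2)" by (rule test_on_0)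
  have z: "d_z j (\<lambda>_. 0) p = 0" "d_zbar j (\<lambda>_. 0) p = 0" for j p
    by (simp_all add: d_z_def d_zbar_def frechet_derivative_const)
  have u1: "(\<lambda>q. u (a q) $ 1) = a" "(\<lambda>q. u (a q) $ 2) = (\<lambda>_. 0)" by (simp_all add: u_def)
  define X where "X = ext_deriv11 (\<lambda>p. u (a p)) (\<lambda>_. 0)"
  define Y where "Y = ext_deriv11 (\<lambda>_. 0) (\<lambda>p. u (a p))"
  have Xe: "X p = (\<Sum>k\<in>UNIV. munit 1 k (2 * \<i> * d_zbar k a p))" for p
    by (simp add: X_def ext_deriv11_def munit_def vec_eq_iff forall_2 sum_2 z u1)
  have Ye: "Y p = (\<Sum>j\<in>UNIV. munit j 1 (- 2 * \<i> * d_z j a p))" for p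
    by (simp add: Y_def ext_deriv11_def munit_def vec_eq_iff forall_2 sum_2 z u1)
  have tX: "test_on bidisc X"
    unfolding Xe[abs_def] using test_on_d_zbar[OF a]
    by (intro test_on_sum test_on_munit test_on_linear[OF _ bounded_linear_mult_right])
  have tY: "test_on bidisc Y"
    unfolding Ye[abs_def] using test_on_d_z[OF a]
    by (intro test_on_sum test_on_munit test_on_linear[OF _ bounded_linear_mult_right])
  have TX: "T X = 0" and TY: "T Y = 0"
    using closed tu t0 unfolding closed_current_def X_def Y_def by blast+
  have qX: "qform (X p) (vector [1, g]) = 2 * \<i> * (d_zbar 1 a p + cnj g * d_zbar 2 a p)" for p g
    by (simp add: qform_tangent Xe munit_def sum_2 algebra_simps)
  have qY: "qform (Y p) (vector [1, g]) = - 2 * \<i> * (d_z 1 a p + g * d_z 2 a p)" for p g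
    by (simp add: qform_tangent Ye munit_def sum_2 algebra_simps)
  have diff: "a differentiable at p" for p by (rule smooth_differentiable[OF test_onD(1)[OF a]])
  have eq: "frechet_derivative a (at p) (e, slope p * e) =
     (cnj e / (2 * \<i>)) * qform (X p) (vector [1, slope p]) + (e / (- 2 * \<i>)) * qform (Y p) (vector [1, slope p])" for p
  proof -
    have c: "(c / d) * (d * x) = c * x" if "d \<noteq> 0" for c d x :: complex using that by simp
    have i: "2 * \<i> \<noteq> 0" "- 2 * \<i> \<noteq> 0" by simp_all
    show ?thesis unfolding frechet_via_wirtinger[OF diff] qX qY c[OF i(1)] c[OF i(2)] by (simp add: algebra_simps)
  qed
  note rX = TE_representation[OF test_on_cc[OF tX]] and rY = TE_representation[OF test_on_cc[OF tY]]
  show "integrable N (\<lambda>p. frechet_derivative a (at p) (e, slope p * e))"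
    unfolding eq by (intro Bochner_Integration.integrable_add integrable_mult_right rX rY)
  show "(LINT p|N. frechet_derivative a (at p) (e, slope p * e)) = 0"
    unfolding eq using rX rY TX TY TE_test[OF tX] TE_test[OF tY] by simp
qed

end

section \<open>Leafwise almost constant functions\<close>

text \<open>The logarithm is at most \<open>ln (1/\<epsilon>)\<close> unless \<open>y < \<epsilon>\<close>, and then the surplus
  \<open>ln (\<epsilon>/y) \<le> \<epsilon>/y\<close> is absorbed by \<open>\<epsilon>\<^sup>2\<close>.\<close>

lemma y_sq_ln_bound:
  assumes "0 \<le> y" "y < 1" "0 < \<epsilon>" "\<epsilon> \<le> (1::real)"
  shows "y\<^sup>2 * ln (1 / y) \<le> (1 + ln (1 / \<epsilon>)) * (\<epsilon>\<^sup>2 + y\<^sup>2)"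
proof (cases "y = 0")
  case True
  have "0 \<le> ln (1 / \<epsilon>)" using assms by (simp add: ln_div)
  then show ?thesis using True by simp
next
  case False
  then have y: "y > 0" using assms by simp
  have le: "0 \<le> ln (1 / \<epsilon>)" using assms by (simp add: ln_div)
  show ?thesis
  proof (cases "\<epsilon> \<le> y")
    case True
    then have "ln \<epsilon> \<le> ln y" using assms y by simp
    moreover have "ln (1 / y) = - ln y" "ln (1 / \<epsilon>) = - ln \<epsilon>" using assms y by (simp_all add: ln_div)
    ultimately have "ln (1 / y) \<le> 1 + ln (1 / \<epsilon>)" by linarith
    then have "y\<^sup>2 * ln (1 / y) \<le> y\<^sup>2 * (1 + ln (1 / \<epsilon>))" by (intro mult_left_mono) auto
    also have "\<dots> \<le> (1 + ln (1 / \<epsilon>)) * (\<epsilon>\<^sup>2 + y\<^sup>2)" using le by (simp add: algebra_simps)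
    finally show ?thesis .
  next
    case False
    have "ln (1 / y) = ln (\<epsilon> / y) + ln (1 / \<epsilon>)" using assms y by (simp add: ln_div)
    also have "\<dots> \<le> \<epsilon> / y + ln (1 / \<epsilon>)" using ln_bound[of "\<epsilon> / y"] assms y by simp
    finally have "y\<^sup>2 * ln (1 / y) \<le> y\<^sup>2 * (\<epsilon> / y + ln (1 / \<epsilon>))" by (intro mult_left_mono) auto
    also have "\<dots> = \<epsilon> * y + y\<^sup>2 * ln (1 / \<epsilon>)" using y by (simp add: field_simps power2_eq_square)
    also have "\<dots> \<le> \<epsilon>\<^sup>2 + (\<epsilon>\<^sup>2 + y\<^sup>2) * ln (1 / \<epsilon>)"
      using False assms y le by (intro add_mono mult_right_mono) (auto simp: power2_eq_square)
    also have "\<dots> \<le> (1 + ln (1 / \<epsilon>)) * (\<epsilon>\<^sup>2 + y\<^sup>2)" by (simp add: algebra_simps)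
    finally show ?thesis .
  qed
qed

text \<open>The average does not change its distance to \<open>c\<close> when \<open>c\<close> is subtracted from all values,
  so its derivative is controlled by the average of \<open>|g i - c|\<close>, times twice the bound \<open>Q\<close> for the
  logarithmic derivatives of the weights.\<close>

lemma weighted_average:
  fixes \<rho> :: "'i \<Rightarrow> real \<Rightarrow> real" and g :: "'i \<Rightarrow> complex"
  assumes A: "finite A" "A \<noteq> {}" and pos: "\<And>i. i \<in> A \<Longrightarrow> \<rho> i 0 > 0"
    and d: "\<And>i. i \<in> A \<Longrightarrow> (\<rho> i has_real_derivative \<rho>' i) (at 0)"
    and Q: "\<And>i. i \<in> A \<Longrightarrow> \<bar>\<rho>' i\<bar> \<le> Q * \<rho> i 0"
    and B: "(\<Sum>i\<in>A. cmod (g i - c) * \<rho> i 0) \<le> B * (\<Sum>i\<in>A. \<rho> i 0)"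
  shows "cmod ((\<Sum>i\<in>A. g i * of_real (\<rho> i 0)) / of_real (\<Sum>i\<in>A. \<rho> i 0) - c) \<le> B"
    and "\<exists>D. ((\<lambda>t. (\<Sum>i\<in>A. g i * of_real (\<rho> i t)) / of_real (\<Sum>i\<in>A. \<rho> i t)) has_vector_derivative D) (at 0)
           \<and> cmod D \<le> 2 * Q * B"
proof -
  let ?R = "\<lambda>t. \<Sum>i\<in>A. \<rho> i t" and ?S = "\<lambda>t. \<Sum>i\<in>A. g i * of_real (\<rho> i t)"
  have R: "?R 0 > 0" using A pos by (intro sum_pos)
  have Sc: "(\<Sum>i\<in>A. g i * of_real (r i)) - c * of_real (\<Sum>i\<in>A. r i) = (\<Sum>i\<in>A. (g i - c) * of_real (r i))" for r
    by (simp add: sum_distrib_left sum_subtractf algebra_simps)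
  have b1: "cmod (\<Sum>i\<in>A. (g i - c) * of_real (\<rho> i 0)) \<le> B * ?R 0"
  proof -
    have "cmod (\<Sum>i\<in>A. (g i - c) * of_real (\<rho> i 0)) \<le> (\<Sum>i\<in>A. cmod (g i - c) * \<rho> i 0)"
      using pos by (intro order_trans[OF norm_sum] sum_mono) (auto simp: norm_mult less_imp_le)
    then show ?thesis using B by simp
  qed
  have "?S 0 / of_real (?R 0) - c = (\<Sum>i\<in>A. (g i - c) * of_real (\<rho> i 0)) / of_real (?R 0)"
    unfolding Sc[symmetric] using R by (simp add: diff_divide_distrib del: of_real_sum)
  then show "cmod (?S 0 / of_real (?R 0) - c) \<le> B"
    using b1 R by (simp add: norm_divide divide_le_eq del: of_real_sum)
  let ?S' = "\<Sum>i\<in>A. g i * of_real (\<rho>' i)" and ?R' = "\<Sum>i\<in>A. \<rho>' i"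
  have dR: "(?R has_real_derivative ?R') (at 0)" using d by (intro DERIV_sum)
  have dv: "((\<lambda>t. complex_of_real (\<rho> i t)) has_vector_derivative of_real (\<rho>' i)) (at 0)" if "i \<in> A" for i
    using d[OF that] by (intro has_vector_derivative_of_real) (simp add: has_real_derivative_iff_has_vector_derivative)
  have dS: "(?S has_vector_derivative ?S') (at 0)"
    using dv by (intro has_vector_derivative_sum has_vector_derivative_mult_right)
  have dI: "((\<lambda>t. complex_of_real (inverse (?R t))) has_vector_derivative of_real (- (inverse (?R 0) * ?R' * inverse (?R 0)))) (at 0)"
    using DERIV_inverse'[OF dR] R
    by (intro has_vector_derivative_of_real) (simp add: has_real_derivative_iff_has_vector_derivative)
  let ?D = "?S 0 * of_real (- (inverse (?R 0) * ?R' * inverse (?R 0))) + ?S' * of_real (inverse (?R 0))"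
  have "((\<lambda>t. ?S t * complex_of_real (inverse (?R t))) has_vector_derivative ?D) (at 0)"
    by (rule has_vector_derivative_mult[OF dS dI])
  then have dd: "((\<lambda>t. ?S t / of_real (?R t)) has_vector_derivative ?D) (at 0)"
    by (simp add: divide_inverse)
  have "?D = ((\<Sum>i\<in>A. (g i - c) * of_real (\<rho>' i)) * of_real (?R 0) - (\<Sum>i\<in>A. (g i - c) * of_real (\<rho> i 0)) * of_real ?R') / (of_real (?R 0))\<^sup>2"
    unfolding Sc[symmetric] using R by (simp add: divide_simps power2_eq_square of_real_sum[symmetric] del: of_real_sum)
      (simp add: algebra_simps)
  also have "cmod \<dots> \<le> (Q * B * ?R 0 * ?R 0 + B * ?R 0 * (Q * ?R 0)) / (?R 0)\<^sup>2"
  proof -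
    have Qp: "0 \<le> Q"
    proof -
      obtain i where "i \<in> A" using A by auto
      then have "0 \<le> Q * \<rho> i 0" using Q[of i] by linarith
      then show ?thesis using pos[OF \<open>i \<in> A\<close>] by (simp add: zero_le_mult_iff)
    qed
    have b2: "cmod (\<Sum>i\<in>A. (g i - c) * of_real (\<rho>' i)) \<le> Q * B * ?R 0"
    proof -
      have "cmod (\<Sum>i\<in>A. (g i - c) * of_real (\<rho>' i)) \<le> (\<Sum>i\<in>A. Q * (cmod (g i - c) * \<rho> i 0))"
      proof (intro order_trans[OF norm_sum] sum_mono)
        fix i assume i: "i \<in> A"
        have "cmod ((g i - c) * of_real (\<rho>' i)) = cmod (g i - c) * \<bar>\<rho>' i\<bar>" by (simp add: norm_mult)
        also have "\<dots> \<le> cmod (g i - c) * (Q * \<rho> i 0)" using Q[OF i] by (intro mult_left_mono) auto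
        finally show "cmod ((g i - c) * of_real (\<rho>' i)) \<le> Q * (cmod (g i - c) * \<rho> i 0)" by (simp add: mult_ac)
      qed
      also have "\<dots> \<le> Q * (B * ?R 0)"
        unfolding sum_distrib_left[symmetric] using B Qp by (intro mult_left_mono) auto
      finally show ?thesis by (simp add: mult_ac)
    qed
    have b3: "\<bar>?R'\<bar> \<le> Q * ?R 0"
      using order_trans[OF sum_abs sum_mono[OF Q], of A] by (simp add: sum_distrib_left)
    have "cmod ((\<Sum>i\<in>A. (g i - c) * of_real (\<rho>' i)) * of_real (?R 0) - (\<Sum>i\<in>A. (g i - c) * of_real (\<rho> i 0)) * of_real ?R')
      \<le> cmod (\<Sum>i\<in>A. (g i - c) * of_real (\<rho>' i)) * ?R 0 + cmod (\<Sum>i\<in>A. (g i - c) * of_real (\<rho> i 0)) * \<bar>?R'\<bar>"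
      using R by (intro order_trans[OF norm_triangle_ineq4]) (simp add: norm_mult del: of_real_sum)
    also have "\<dots> \<le> Q * B * ?R 0 * ?R 0 + B * ?R 0 * (Q * ?R 0)"
    proof (intro add_mono mult_mono b1 b2 b3)
      show "0 \<le> B * ?R 0" using b1 norm_ge_zero order_trans by blast
      show "0 \<le> Q * B * ?R 0" using b2 norm_ge_zero order_trans by blast
    qed (use R in auto)
    finally show ?thesis using R by (simp add: norm_divide norm_power divide_right_mono del: of_real_sum)
  qed
  also have "\<dots> = 2 * Q * B" using R by (simp add: power2_eq_square)
  finally show "\<exists>D. ((\<lambda>t. ?S t / of_real (?R t)) has_vector_derivative D) (at 0) \<and> cmod D \<le> 2 * Q * B"
    using dd by blast
qed

text \<open>Put \<open>k = j^N\<close>, \<open>\<epsilon> = k^(-2)\<close> and \<open>M = 2 N + 1\<close>.  Indices with \<open>y i \<le> 1/k\<close> have \<open>d i \<le> 1/j\<close>.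
  Each of the others has weight at most \<open>k^(2 M)\<close>, there are at most \<open>9 k^(4 N)\<close> of them, and the
  weight of \<open>i0\<close> is at least \<open>(k^4/2)^M\<close>.  The exponent \<open>M\<close> is chosen such that
  \<open>4 N + 2 M < 4 M\<close>: concentration beats the number of indices.\<close>

lemma concentrated_average:
  fixes y d :: "'i \<Rightarrow> real"
  assumes A: "finite A" "card A \<le> 9 * (j ^ N) ^ (4 * N)" and j: "j \<ge> 1" and N: "N \<ge> 1"
    and yd: "\<And>i. i \<in> A \<Longrightarrow> 0 \<le> y i \<and> 0 \<le> d i \<and> d i \<le> 1 \<and> d i ^ N \<le> y i"
    and i0: "i0 \<in> A" "y i0 \<le> 1 / (real j ^ N)\<^sup>2"
  defines "\<rho> \<equiv> \<lambda>i. inverse (((1 / (real j ^ N)\<^sup>2)\<^sup>2 + (y i)\<^sup>2) ^ (2 * N + 1))"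
  shows "(\<Sum>i\<in>A. d i * \<rho> i) \<le> ((1 + 9 * 2 ^ (2 * N + 1)) / j) * (\<Sum>i\<in>A. \<rho> i)"
proof -
  define k where "k = real j ^ N"
  define M where "M = 2 * N + 1"
  have k: "k \<ge> 1" "k \<ge> j"
  proof -
    show "k \<ge> 1" using j by (simp add: k_def)
    have "real j ^ 1 \<le> real j ^ N" using j N by (intro power_increasing) auto
    then show "k \<ge> j" by (simp add: k_def)
  qed
  have \<rho>: "\<rho> i = inverse (((1 / k\<^sup>2)\<^sup>2 + (y i)\<^sup>2) ^ M)" for i by (simp add: \<rho>_def k_def M_def)
  have base: "(1 / k\<^sup>2)\<^sup>2 + (y i)\<^sup>2 > 0" for i using k by (intro add_pos_nonneg) auto
  have \<rho>p: "\<rho> i > 0" for i unfolding \<rho> using base by simp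
  have near: "d i \<le> 1 / j" if "i \<in> A" "y i \<le> 1 / k" for i
  proof -
    have "d i ^ N \<le> (1 / j) ^ N" using yd[OF that(1)] that(2) by (simp add: k_def power_divide)
    then show ?thesis using N j by (intro power_le_imp_le_base[of "d i" "N - 1"]) auto
  qed
  have R0: "(k ^ 4 / 2) ^ M \<le> \<rho> i0"
  proof -
    have "(1 / k\<^sup>2)\<^sup>2 + (y i0)\<^sup>2 \<le> (1 / k\<^sup>2)\<^sup>2 + (1 / k\<^sup>2)\<^sup>2"
      using i0 yd[OF i0(1)] by (intro add_left_mono power_mono) (auto simp: k_def)
    also have "\<dots> = inverse (k ^ 4 / 2)" using k by (simp add: field_simps power2_eq_square power4_eq_xxxx)
    finally have "((1 / k\<^sup>2)\<^sup>2 + (y i0)\<^sup>2) ^ M \<le> inverse (k ^ 4 / 2) ^ M"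
      using base[of i0] by (intro power_mono) auto
    then have "inverse (inverse (k ^ 4 / 2) ^ M) \<le> \<rho> i0"
      unfolding \<rho> using base[of i0] by (intro le_imp_inverse_le) auto
    then show ?thesis by (simp only: power_inverse inverse_inverse_eq)
  qed
  have far: "\<rho> i \<le> (k\<^sup>2) ^ M" if "y i > 1 / k" for i
  proof -
    have "(1 / k)\<^sup>2 \<le> (y i)\<^sup>2" using that k by (intro power_mono) auto
    also have "\<dots> \<le> (1 / k\<^sup>2)\<^sup>2 + (y i)\<^sup>2" by simp
    finally have "((1 / k)\<^sup>2) ^ M \<le> ((1 / k\<^sup>2)\<^sup>2 + (y i)\<^sup>2) ^ M" by (intro power_mono) auto
    then have "\<rho> i \<le> inverse (((1 / k)\<^sup>2) ^ M)"
      unfolding \<rho> using k by (intro le_imp_inverse_le) auto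
    also have "\<dots> = (k\<^sup>2) ^ M" using k by (simp add: power_divide)
    finally show ?thesis .
  qed
  let ?F = "{i\<in>A. y i > 1 / k}" and ?R = "\<Sum>i\<in>A. \<rho> i"
  have Rge: "\<rho> i0 \<le> ?R" using A i0 \<rho>p by (intro member_le_sum) (auto intro: less_imp_le)
  have "d i * \<rho> i \<le> 1 / j * \<rho> i + (if i \<in> ?F then (k\<^sup>2) ^ M else 0)" if i: "i \<in> A" for i
  proof (cases "y i > 1 / k")
    case True
    have "d i * \<rho> i \<le> 1 * (k\<^sup>2) ^ M" using yd[OF i] far[OF True] \<rho>p[of i] by (intro mult_mono) auto
    moreover have "0 \<le> 1 / j * \<rho> i" using \<rho>p[of i] by simp
    ultimately show ?thesis using True i by simp
  next
    case False
    then have "d i * \<rho> i \<le> 1 / j * \<rho> i" using near[OF i] \<rho>p[of i] by (intro mult_right_mono) auto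
    then show ?thesis using False by simp
  qed
  then have "(\<Sum>i\<in>A. d i * \<rho> i) \<le> (\<Sum>i\<in>A. 1 / j * \<rho> i + (if i \<in> ?F then (k\<^sup>2) ^ M else 0))" by (rule sum_mono)
  also have "\<dots> = 1 / j * ?R + real (card ?F) * (k\<^sup>2) ^ M"
    using A by (simp add: sum.distrib sum_distrib_left sum.If_cases Int_def)
  also have "real (card ?F) * (k\<^sup>2) ^ M \<le> (9 * 2 ^ M / j) * ?R"
  proof -
    have "real (card ?F) \<le> real (9 * (j ^ N) ^ (4 * N))"
      using A(2) card_mono[OF A(1), of ?F] by (intro of_nat_mono) auto
    then have "real (card ?F) * (k\<^sup>2) ^ M \<le> (9 * k ^ (4 * N)) * (k\<^sup>2) ^ M"
      by (intro mult_right_mono) (auto simp: k_def)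
    also have "\<dots> = (9 * 2 ^ M / k\<^sup>2) * (k ^ 4 / 2) ^ M"
    proof -
      have "k ^ (4 * N) * (k\<^sup>2) ^ M * k\<^sup>2 = (k ^ 4) ^ M"
      proof -
        have "4 * N + 2 * M + 2 = 4 * M" by (simp add: M_def)
        then show ?thesis by (metis power_add power_mult)
      qed
      then show ?thesis using k by (simp add: field_simps power_divide)
    qed
    also have "\<dots> \<le> (9 * 2 ^ M / j) * ?R"
    proof (intro mult_mono frac_le)
      have "real j * 1 \<le> k * k" using k by (intro mult_mono) auto
      then show "real j \<le> k\<^sup>2" by (simp add: power2_eq_square)
      show "(k ^ 4 / 2) ^ M \<le> ?R" using R0 Rge by simp
    qed (use j in auto)
    finally show ?thesis .
  qed
  finally show ?thesis using j by (simp add: M_def field_simps)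
qed

text \<open>The net consists of one point of \<open>I\<close> for every cell of a square grid that meets \<open>I\<close>.  Its
  points lie in \<open>I\<close>, as they have to be labels of leaves.\<close>

lemma grid_net:
  fixes I :: "complex set"
  assumes I: "I \<subseteq> ball 0 1" and m: "m \<ge> (1::nat)"
  shows "\<exists>A. finite A \<and> A \<subseteq> I \<and> card A \<le> 9 * m ^ 2 \<and> (\<forall>\<beta>\<in>I. \<exists>\<alpha>\<in>A. cmod (\<alpha> - \<beta>) / 2 \<le> 1 / m)"
proof -
  define c where "c \<beta> = (\<lfloor>real m * Re \<beta>\<rfloor>, \<lfloor>real m * Im \<beta>\<rfloor>)" for \<beta>
  let ?S = "{- int m..int m} \<times> {- int m..int m}"
  have cI: "c ` I \<subseteq> ?S"
  proof
    fix q assume "q \<in> c ` I"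
    then obtain \<beta> where b: "\<beta> \<in> I" "q = c \<beta>" by auto
    have ab: "\<bar>Re \<beta>\<bar> < 1" "\<bar>Im \<beta>\<bar> < 1"
      using I b(1) abs_Re_le_cmod[of \<beta>] abs_Im_le_cmod[of \<beta>] by auto
    have k: "- real m \<le> real m * x \<and> real m * x < real m + 1" if "\<bar>x\<bar> < 1" for x
    proof -
      have "-1 \<le> x" "x \<le> 1" using that by auto
      from mult_left_mono[OF this(1), of "real m"] mult_left_mono[OF this(2), of "real m"]
      show ?thesis by simp
    qed
    have "- int m \<le> \<lfloor>real m * x\<rfloor> \<and> \<lfloor>real m * x\<rfloor> \<le> int m" if "\<bar>x\<bar> < 1" for x
      using k[OF that] by (simp add: le_floor_iff floor_le_iff)
    then show "q \<in> ?S" using ab b by (auto simp: c_def)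
  qed
  define A where "A = (\<lambda>q. SOME \<beta>. \<beta> \<in> I \<and> c \<beta> = q) ` (c ` I)"
  have sel: "(SOME \<beta>'. \<beta>' \<in> I \<and> c \<beta>' = c \<beta>) \<in> I \<and> c (SOME \<beta>'. \<beta>' \<in> I \<and> c \<beta>' = c \<beta>) = c \<beta>" if "\<beta> \<in> I" for \<beta>
    using someI[of "\<lambda>\<beta>'. \<beta>' \<in> I \<and> c \<beta>' = c \<beta>" \<beta>] that by simp
  have fin: "finite (c ` I)" using cI finite_subset by blast
  have "card A \<le> card (c ` I)" unfolding A_def by (rule card_image_le[OF fin])
  also have "\<dots> \<le> card ?S" by (rule card_mono[OF _ cI]) simp
  also have "\<dots> = (2 * m + 1) ^ 2" by (simp add: card_cartesian_product power2_eq_square nat_add_distrib nat_mult_distrib algebra_simps)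
  also have "\<dots> \<le> (3 * m) ^ 2" using m by (intro power_mono) auto
  finally have "card A \<le> 9 * m ^ 2" by (simp add: power_mult_distrib)
  moreover have "\<exists>\<alpha>\<in>A. cmod (\<alpha> - \<beta>) / 2 \<le> 1 / m" if b: "\<beta> \<in> I" for \<beta>
  proof -
    define \<alpha> where "\<alpha> = (SOME \<beta>'. \<beta>' \<in> I \<and> c \<beta>' = c \<beta>)"
    have a: "c \<alpha> = c \<beta>" "\<alpha> \<in> A" using sel[OF b] b by (auto simp: \<alpha>_def A_def)
    have "\<bar>x - x'\<bar> \<le> 1 / m" if "\<lfloor>real m * x\<rfloor> = \<lfloor>real m * x'\<rfloor>" for x x'
    proof -
      have "\<bar>real m * x - real m * x'\<bar> \<le> 1" using that by linarith
      then have "real m * \<bar>x - x'\<bar> \<le> 1" by (simp add: abs_mult flip: right_diff_distrib)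
      then show ?thesis using m by (simp add: field_simps)
    qed
    then have "\<bar>Re (\<alpha> - \<beta>)\<bar> \<le> 1 / m" "\<bar>Im (\<alpha> - \<beta>)\<bar> \<le> 1 / m" using a(1) by (auto simp: c_def)
    then have "cmod (\<alpha> - \<beta>) / 2 \<le> 1 / m" using cmod_le[of "\<alpha> - \<beta>"] by simp
    then show ?thesis using a by blast
  qed
  moreover have "A \<subseteq> I" using sel by (auto simp: A_def)
  ultimately show ?thesis using fin by (auto simp: A_def intro!: exI[of _ A])
qed

lemma smooth_derivative_bounded:
  fixes a :: "'a::euclidean_space \<Rightarrow> 'b::real_normed_vector"
  assumes "smooth a" "compact C"
  shows "\<exists>B\<ge>0. \<forall>p\<in>C. \<forall>v. norm (frechet_derivative a (at p) v) \<le> B * norm v"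
proof -
  have "\<exists>B. \<forall>p\<in>C. norm (frechet_derivative a (at p) b) \<le> B" for b
  proof -
    have "bounded ((\<lambda>p. frechet_derivative a (at p) b) ` C)"
      by (intro compact_imp_bounded compact_continuous_image smooth_continuous smooth_frechet assms)
    then show ?thesis unfolding bounded_iff by auto
  qed
  then obtain B where B: "\<And>b p. p \<in> C \<Longrightarrow> norm (frechet_derivative a (at p) b) \<le> B b" by metis
  have "norm (frechet_derivative a (at p) v) \<le> (\<Sum>b\<in>Basis. \<bar>B b\<bar>) * norm v" if p: "p \<in> C" for p v
  proof -
    have lin: "linear (frechet_derivative a (at p))"
      by (rule has_derivative_linear[OF frechet_derivative_works[THEN iffD1, OF smooth_differentiable[OF assms(1)]]])
    have "frechet_derivative a (at p) v = frechet_derivative a (at p) (\<Sum>b\<in>Basis. (v \<bullet> b) *\<^sub>R b)"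
      by (simp add: euclidean_representation)
    also have "\<dots> = (\<Sum>b\<in>Basis. (v \<bullet> b) *\<^sub>R frechet_derivative a (at p) b)"
      by (simp add: linear_sum[OF lin] linear_scale[OF lin])
    also have "norm \<dots> \<le> (\<Sum>b\<in>Basis. norm v * \<bar>B b\<bar>)"
    proof (intro order_trans[OF norm_sum] sum_mono)
      fix b :: 'a assume "b \<in> Basis"
      have "norm ((v \<bullet> b) *\<^sub>R frechet_derivative a (at p) b) = \<bar>v \<bullet> b\<bar> * norm (frechet_derivative a (at p) b)" by simp
      also have "\<dots> \<le> norm v * \<bar>B b\<bar>"
        using B[OF p, of b] \<open>b \<in> Basis\<close> by (intro mult_mono) (auto simp: Basis_le_norm)
      finally show "norm ((v \<bullet> b) *\<^sub>R frechet_derivative a (at p) b) \<le> norm v * \<bar>B b\<bar>" .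
    qed
    finally show ?thesis by (simp add: sum_distrib_left mult.commute)
  qed
  then show ?thesis by (intro exI[of _ "\<Sum>b\<in>Basis. \<bar>B b\<bar>"]) (auto intro: sum_nonneg)
qed

section \<open>Derivatives of product functions integrate to zero\<close>

lemma elem_mono:
  assumes "elem S g" "S' \<subseteq> S"
  shows "elem S' g"
  using assms(1)
proof induction
  case (elem_inverse g)
  then show ?case using assms(2) by (intro elem.elem_inverse) auto
next
  case (elem_holo G)
  then show ?case using assms(2) by (intro elem.elem_holo) auto
qed (auto intro: elem.intros)

context lam_current
begin

lemma compact_K_box: "R < 1 \<Longrightarrow> compact (K \<inter> box R)"
proof -
  assume R: "R < 1"
  obtain C where C: "closed C" "K = bidisc \<inter> C"
    using closed_K by (auto simp: closedin_closed)
  have "K \<inter> box R = box R \<inter> C" using C(2) compact_bidisc_cball[OF R] by blast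
  then show ?thesis using compact_bidisc_cball[OF R] C(1) by (simp add: compact_Int_closed)
qed

lemma N_measurable: "continuous_on K h \<Longrightarrow> h \<in> borel_measurable N"
  for h :: "complex \<times> complex \<Rightarrow> 'b::topological_space"
  using borel_measurable_continuous_on_restrict measurable_cong_sets[OF sets_N refl] by blast

lemma sets_N_box: "K \<inter> box R \<in> sets N"
  unfolding sets_N sets_restrict_space using borel_K
  by (auto intro!: image_eqI[of _ _ "box R"] borel_closed closed_Times)

lemma N_integrable:
  fixes h :: "complex \<times> complex \<Rightarrow> complex"
  assumes h: "continuous_on K h" "\<And>p. p \<in> K \<Longrightarrow> p \<notin> box R \<Longrightarrow> h p = 0" and R: "R < 1"
  shows "integrable N h"
proof -
  have "bounded (h ` (K \<inter> box R))"
    using compact_K_box[OF R] h(1) by (intro compact_imp_bounded compact_continuous_image) (auto intro: continuous_on_subset)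
  then obtain B where B: "B > 0" "\<And>p. p \<in> K \<inter> box R \<Longrightarrow> norm (h p) \<le> B" unfolding bounded_pos by blast
  have "integrable N (\<lambda>p. B * indicator (K \<inter> box R) p)"
    using sets_N_box N_finite[OF R] by simp
  then show ?thesis
  proof (rule Bochner_Integration.integrable_bound)
    show "AE p in N. norm (h p) \<le> norm (B * indicator (K \<inter> box R) p)"
      using B h(2) by (intro AE_I2) (auto simp: space_N indicator_def)
  qed (rule N_measurable[OF h(1)])
qed

lemma N_integral_bound:
  fixes h :: "complex \<times> complex \<Rightarrow> complex"
  assumes h: "integrable N h" "\<And>p. p \<in> K \<Longrightarrow> p \<notin> box R \<Longrightarrow> h p = 0"
    "\<And>p. p \<in> K \<Longrightarrow> p \<in> box R \<Longrightarrow> cmod (h p) \<le> C" and R: "R < 1"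
  shows "cmod (LINT p|N. h p) \<le> C * measure N (K \<inter> box R)"
proof -
  have "cmod (LINT p|N. h p) \<le> (LINT p|N. cmod (h p))" by (rule integral_norm_bound)
  also have "\<dots> \<le> (LINT p|N. C * indicator (K \<inter> box R) p)"
  proof (rule integral_mono)
    show "integrable N (\<lambda>p. C * indicator (K \<inter> box R) p)"
      using sets_N_box N_finite[OF R] by simp
    show "cmod (h p) \<le> C * indicator (K \<inter> box R) p" if "p \<in> space N" for p
      using h(2,3)[of p] that by (auto simp: space_N indicator_def)
  qed (use h(1) in auto)
  also have "\<dots> = C * measure N (K \<inter> box R)" using sets_N_box by simp
  finally show ?thesis .
qed

end

lemma frechet_zero_on_open:
  assumes "open S" "p \<in> S" "\<And>x. x \<in> S \<Longrightarrow> f x = c"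
  shows "frechet_derivative f (at p) v = 0"
proof -
  have "(f has_derivative (\<lambda>_. 0)) (at p)"
    by (rule has_derivative_transform_within_open[OF has_derivative_const[of c] assms(1,2)]) (use assms(3) in auto)
  then show ?thesis by (metis frechet_derivative_at)
qed

lemma chain_vector_derivative:
  assumes "a differentiable at (\<gamma> 0)" "(\<gamma> has_vector_derivative v) (at 0)"
  shows "((\<lambda>t. a (\<gamma> t)) has_vector_derivative frechet_derivative a (at (\<gamma> 0)) v) (at (0::real))"
  using vector_derivative_diff_chain_within[of \<gamma> v 0 UNIV a "frechet_derivative a (at (\<gamma> 0))"] assms
  by (auto simp: frechet_derivative_works o_def intro: has_derivative_at_withinI)

context lamination
begin

lemma leaf_curve:
  assumes "\<beta> \<in> I" "cmod z < 1"
  shows "((\<lambda>t. f \<beta> (z + of_real t * e)) has_vector_derivative deriv (f \<beta>) z * e) (at 0)"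
    and "((\<lambda>t. (z + of_real t * e, f \<beta> (z + of_real t * e))) has_vector_derivative (e, deriv (f \<beta>) z * e)) (at 0)"
proof -
  have l: "((\<lambda>t. z + of_real t * e) has_vector_derivative e) (at 0)"
    by (auto intro!: derivative_eq_intros)
  have "(f \<beta> has_field_derivative deriv (f \<beta>) z) (at (z + of_real 0 * e))"
    using holomorphic_derivI[OF leaf_holo[OF assms(1)], of z] assms by auto
  from field_vector_diff_chain_at[OF l this]
  show 1: "((\<lambda>t. f \<beta> (z + of_real t * e)) has_vector_derivative deriv (f \<beta>) z * e) (at 0)"
    by (simp add: o_def mult.commute)
  show "((\<lambda>t. (z + of_real t * e, f \<beta> (z + of_real t * e))) has_vector_derivative (e, deriv (f \<beta>) z * e)) (at 0)"
    by (rule has_vector_derivative_Pair[OF l 1])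
qed

text \<open>The derivative of \<open>\<epsilon>\<^sup>2 + y\<^sup>2\<close> along a leaf is of size \<open>y\<^sup>2 ln (1/y)\<close> by \<open>leaves_bounds\<close>, and
  dividing it by \<open>\<epsilon>\<^sup>2 + y\<^sup>2\<close> leaves \<open>ln (1/\<epsilon>)\<close>.\<close>

lemma weight_derivative:
  fixes e :: complex
  assumes ab: "\<alpha> \<in> I" "\<beta> \<in> I" and z: "cmod z \<le> r" "r < 1" and \<epsilon>: "0 < \<epsilon>" "\<epsilon> \<le> 1" and M: "M \<ge> 1"
  defines "\<rho> \<equiv> \<lambda>t. inverse ((\<epsilon>\<^sup>2 + (cmod ((f \<beta> (z + of_real t * e) - f \<alpha> (z + of_real t * e)) / 2))\<^sup>2) ^ M)"
  shows "\<exists>D. (\<rho> has_real_derivative D) (at 0) \<and> \<bar>D\<bar> \<le> (4 * real M * cmod e / (1 - r) * (1 + ln (1 / \<epsilon>))) * \<rho> 0"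
proof -
  have z1: "cmod z < 1" using z by simp
  define h where "h t = (f \<beta> (z + of_real t * e) - f \<alpha> (z + of_real t * e)) / 2" for t :: real
  define h' where "h' = (deriv (f \<beta>) z - deriv (f \<alpha>) z) / 2 * e"
  define y where "y = cmod (h 0)"
  have hd: "(h has_vector_derivative h') (at 0)"
    unfolding h_def h'_def using leaf_curve(1)[OF ab(1) z1, of e] leaf_curve(1)[OF ab(2) z1, of e]
    by (auto intro!: derivative_eq_intros simp: algebra_simps diff_divide_distrib)
  have y: "0 \<le> y" "y < 1"
    using leaf_lt_1[OF ab(1) z1] leaf_lt_1[OF ab(2) z1] norm_triangle_ineq4[of "f \<beta> z" "f \<alpha> z"]
    by (auto simp: y_def h_def norm_divide)
  define s where "s t = \<epsilon>\<^sup>2 + (cmod (h t))\<^sup>2" for t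
  define s' where "s' = h 0 \<bullet> h' + h' \<bullet> h 0"
  have "((\<lambda>t. h t \<bullet> h t) has_vector_derivative s') (at 0)"
    unfolding s'_def by (rule bounded_bilinear.has_vector_derivative[OF bounded_bilinear_inner hd hd])
  then have sd: "(s has_real_derivative s') (at 0)"
    unfolding s_def power2_norm_eq_inner
    by (auto intro!: derivative_eq_intros simp: has_real_derivative_iff_has_vector_derivative)
  have s0: "s 0 > 0" using \<epsilon> by (simp add: s_def add_pos_nonneg)
  obtain m where m: "M = Suc m" using M by (cases M) auto
  have \<rho>: "\<rho> = (\<lambda>t. inverse (s t) ^ M)"
    by (simp add: \<rho>_def s_def h_def power_inverse fun_eq_iff)
  let ?D = "- (of_nat M * s' / s 0) * inverse (s 0) ^ M"
  have "(\<rho> has_real_derivative (of_nat M * (- (inverse (s 0) * s' * inverse (s 0)) * inverse (s 0) ^ (M - 1)))) (at 0)"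
    unfolding \<rho> using DERIV_power[OF DERIV_inverse'[OF sd], of M] s0 by simp
  moreover have "of_nat M * (- (inverse (s 0) * s' * inverse (s 0)) * inverse (s 0) ^ (M - 1)) = ?D"
    by (simp add: m divide_inverse)
  ultimately have d: "(\<rho> has_real_derivative ?D) (at 0)" by simp
  have h'b: "cmod h' \<le> 2 / (1 - r) * (y * ln (1 / y)) * cmod e"
  proof -
    obtain N :: nat where N: "(1 + r) / (1 - r) \<le> of_nat N" using real_arch_simple by blast
    have "cmod (deriv (f \<beta>) z - deriv (f \<alpha>) z) / 2 \<le> 2 / (1 - r) * (y * ln (1 / y))"
      using leaves_bounds(3)[OF ab(2,1) z N] by (simp add: y_def h_def norm_divide)
    from mult_right_mono[OF this norm_ge_zero[of e]] show ?thesis by (simp add: h'_def norm_mult norm_divide)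
  qed
  have "\<bar>s'\<bar> \<le> 2 * (y * cmod h')"
    using Cauchy_Schwarz_ineq2[of "h 0" h'] by (simp add: s'_def y_def inner_commute)
  also have "\<dots> \<le> 2 * (y * (2 / (1 - r) * (y * ln (1 / y)) * cmod e))"
    using h'b y by (intro mult_left_mono) auto
  also have "\<dots> = (4 * cmod e / (1 - r)) * (y\<^sup>2 * ln (1 / y))" by (simp add: power2_eq_square)
  also have "\<dots> \<le> (4 * cmod e / (1 - r)) * ((1 + ln (1 / \<epsilon>)) * s 0)"
    unfolding s_def y_def[symmetric] using y_sq_ln_bound[OF y \<epsilon>] z by (intro mult_left_mono) auto
  finally have "\<bar>s'\<bar> / s 0 \<le> (4 * cmod e / (1 - r)) * (1 + ln (1 / \<epsilon>))" using s0 by (simp add: divide_le_eq mult_ac)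
  then have "\<bar>of_nat M * s' / s 0\<bar> \<le> 4 * real M * cmod e / (1 - r) * (1 + ln (1 / \<epsilon>))"
    using mult_left_mono[of "\<bar>s'\<bar> / s 0" "(4 * cmod e / (1 - r)) * (1 + ln (1 / \<epsilon>))" "of_nat M"] s0
    by (simp add: abs_mult abs_divide mult_ac)
  then have "\<bar>?D\<bar> \<le> (4 * real M * cmod e / (1 - r) * (1 + ln (1 / \<epsilon>))) * \<rho> 0"
    unfolding abs_mult[of "- (of_nat M * s' / s 0)"] \<rho>
  proof (intro mult_mono)
    have "0 \<le> ln (1 / \<epsilon>)" using \<epsilon> by (simp add: ln_div)
    then show "0 \<le> 4 * real M * cmod e / (1 - r) * (1 + ln (1 / \<epsilon>))" using z by simp
  qed (use s0 in auto)
  with d show ?thesis by (intro exI conjI)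
qed

text \<open>A substitute for \<open>g (leaf p)\<close> that is smooth and defined off \<open>K\<close> too: the average of \<open>g\<close>
  over finitely many leaves, dominated by those nearest to \<open>p\<close>.\<close>

definition blend :: "(complex \<Rightarrow> complex) \<Rightarrow> complex set \<Rightarrow> real \<Rightarrow> nat \<Rightarrow> complex \<times> complex \<Rightarrow> complex" where
  "blend g A \<epsilon> M p =
     (\<Sum>\<alpha>\<in>A. g \<alpha> * of_real (inverse ((\<epsilon>\<^sup>2 + (cmod ((snd p - f \<alpha> (fst p)) / 2))\<^sup>2) ^ M)))
       / of_real (\<Sum>\<alpha>\<in>A. inverse ((\<epsilon>\<^sup>2 + (cmod ((snd p - f \<alpha> (fst p)) / 2))\<^sup>2) ^ M))"

lemma elem_blend:
  assumes A: "finite A" "A \<noteq> {}" "A \<subseteq> I" and \<epsilon>: "\<epsilon> > 0"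
  shows "elem (ball 0 1 \<times> UNIV) (blend g A \<epsilon> M)"
proof -
  let ?S = "ball 0 1 \<times> UNIV"
  let ?s = "\<lambda>\<alpha> p. \<epsilon>\<^sup>2 + (cmod ((snd p - f \<alpha> (fst p)) / 2))\<^sup>2"
  have pos: "?s \<alpha> p > 0" for \<alpha> p using \<epsilon> by (simp add: add_pos_nonneg)
  have w: "elem ?S (\<lambda>p. of_real (inverse (?s \<alpha> p ^ M)))" if "\<alpha> \<in> A" for \<alpha>
  proof -
    have "elem ?S (\<lambda>p. (1/2) * (snd p - f \<alpha> (fst p)))"
      using that A by (intro elem_cmult elem_diff elem_snd elem_holo leaf_holo) auto
    then have "elem ?S (\<lambda>p. (snd p - f \<alpha> (fst p)) / 2)" by simp
    then have "elem ?S (\<lambda>p. inverse ((of_real (\<epsilon>\<^sup>2) + of_real ((cmod ((snd p - f \<alpha> (fst p)) / 2))\<^sup>2)) ^ M))"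
    proof (intro elem_inverse elem_power elem_add elem_const elem_norm_sq)
      fix p :: "complex \<times> complex"
      have "complex_of_real (?s \<alpha> p) ^ M \<noteq> 0" using pos[of p \<alpha>] by (metis less_irrefl of_real_eq_0_iff power_not_zero)
      then show "(complex_of_real (\<epsilon>\<^sup>2) + of_real ((cmod ((snd p - f \<alpha> (fst p)) / 2))\<^sup>2)) ^ M \<noteq> 0"
        unfolding of_real_add .
    qed
    then show ?thesis by simp
  qed
  have "elem ?S (\<lambda>p. (\<Sum>\<alpha>\<in>A. g \<alpha> * of_real (inverse (?s \<alpha> p ^ M))) * inverse (\<Sum>\<alpha>\<in>A. of_real (inverse (?s \<alpha> p ^ M))))"
  proof (intro elem_mult elem_inverse elem_sum elem_const w)
    fix p :: "complex \<times> complex"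
    have "(\<Sum>\<alpha>\<in>A. inverse (?s \<alpha> p ^ M)) > 0" using A pos by (intro sum_pos) auto
    then have "(\<Sum>\<alpha>\<in>A. inverse (?s \<alpha> p ^ M)) \<noteq> 0" by linarith
    then show "(\<Sum>\<alpha>\<in>A. complex_of_real (inverse (?s \<alpha> p ^ M))) \<noteq> 0"
      unfolding of_real_sum[symmetric] of_real_eq_0_iff .
  qed assumption+
  then show ?thesis unfolding blend_def[abs_def] divide_inverse of_real_sum .
qed

text \<open>With mesh \<open>\<epsilon>^N\<close> in the set of labels, the Hoelder estimate places a leaf of the net within
  \<open>\<epsilon>\<close> of every point of \<open>K\<close> over \<open>cball 0 r\<close>.  The bound \<open>B\<close> is of order \<open>1/j\<close>, whereas \<open>ln (1/\<epsilon>)\<close> is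
  of order \<open>ln j\<close>.\<close>

lemma blend_estimate:
  assumes r: "0 \<le> r" "r < 1" and N: "(1 + r) / (1 - r) \<le> of_nat N"
    and g: "\<And>\<alpha> \<beta>. \<alpha> \<in> I \<Longrightarrow> \<beta> \<in> I \<Longrightarrow> cmod (g \<alpha> - g \<beta>) \<le> L * cmod (\<alpha> - \<beta>)" and j: "j \<ge> 1" and ne: "I \<noteq> {}"
    and L: "L \<ge> 0"
  defines "\<epsilon> \<equiv> 1 / (real j ^ N)\<^sup>2" and "B \<equiv> 2 * L * ((1 + 9 * 2 ^ (2 * N + 1)) / j)"
  shows "\<exists>A. finite A \<and> A \<noteq> {} \<and> A \<subseteq> I \<and> (\<forall>\<beta>\<in>I. \<forall>z. cmod z \<le> r \<longrightarrow>
     cmod (blend g A \<epsilon> (2 * N + 1) (z, f \<beta> z) - g \<beta>) \<le> B \<and>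
     (\<forall>e. \<exists>D. ((\<lambda>t. blend g A \<epsilon> (2 * N + 1) (z + of_real t * e, f \<beta> (z + of_real t * e))) has_vector_derivative D) (at 0) \<and>
        cmod D \<le> 2 * (4 * (2 * real N + 1) * cmod e / (1 - r) * (1 + ln (1 / \<epsilon>))) * B))"
proof -
  have N1: "N \<ge> 1" using N r by (cases N) (auto simp: divide_le_0_iff)
  let ?m = "(j ^ N) ^ (2 * N)" and ?M = "2 * N + 1"
  have "?m \<ge> 1" using j by simp
  have Ib: "I \<subseteq> ball 0 1" by (auto simp: indices_def)
  obtain A where A: "finite A" "A \<subseteq> I" "card A \<le> 9 * ?m ^ 2" "\<And>\<beta>. \<beta> \<in> I \<Longrightarrow> \<exists>\<alpha>\<in>A. cmod (\<alpha> - \<beta>) / 2 \<le> 1 / ?m"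
    using grid_net[OF Ib \<open>?m \<ge> 1\<close>] by blast
  have Ane: "A \<noteq> {}" using ne A(4) by blast
  have cA: "card A \<le> 9 * (j ^ N) ^ (4 * N)" using A(3) by (simp add: power_mult[symmetric] mult_ac)
  have \<epsilon>: "0 < \<epsilon>" "\<epsilon> \<le> 1" using j by (auto simp: \<epsilon>_def)
  have main: "cmod (blend g A \<epsilon> ?M (z, f \<beta> z) - g \<beta>) \<le> B \<and>
     (\<exists>D. ((\<lambda>t. blend g A \<epsilon> ?M (z + of_real t * e, f \<beta> (z + of_real t * e))) has_vector_derivative D) (at 0) \<and>
        cmod D \<le> 2 * (4 * (2 * real N + 1) * cmod e / (1 - r) * (1 + ln (1 / \<epsilon>))) * B)"
    if \<beta>: "\<beta> \<in> I" and z: "cmod z \<le> r" for \<beta> z e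
  proof -
    define \<rho> where "\<rho> \<alpha> t = inverse ((\<epsilon>\<^sup>2 + (cmod ((f \<beta> (z + of_real t * e) - f \<alpha> (z + of_real t * e)) / 2))\<^sup>2) ^ ?M)" for \<alpha> and t :: real
    let ?Q = "4 * (2 * real N + 1) * cmod e / (1 - r) * (1 + ln (1 / \<epsilon>))"
    define y where "y \<alpha> = cmod (f \<alpha> z - f \<beta> z) / 2" for \<alpha>
    define d where "d \<alpha> = cmod (\<alpha> - \<beta>) / 2" for \<alpha>
    have "\<forall>\<alpha>\<in>A. \<exists>D. (\<rho> \<alpha> has_real_derivative D) (at 0) \<and> \<bar>D\<bar> \<le> ?Q * \<rho> \<alpha> 0"
    proof
      fix \<alpha> assume "\<alpha> \<in> A"
      then have \<alpha>: "\<alpha> \<in> I" using A(2) by blast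
      have q: "real ?M = 2 * real N + 1" and M1: "1 \<le> ?M" by simp_all
      show "\<exists>D. (\<rho> \<alpha> has_real_derivative D) (at 0) \<and> \<bar>D\<bar> \<le> ?Q * \<rho> \<alpha> 0"
        using weight_derivative[OF \<alpha> \<beta> z r(2) \<epsilon> M1, of e] unfolding \<rho>_def q .
    qed
    then obtain \<rho>' where \<rho>': "\<And>\<alpha>. \<alpha> \<in> A \<Longrightarrow> (\<rho> \<alpha> has_real_derivative \<rho>' \<alpha>) (at 0)"
      "\<And>\<alpha>. \<alpha> \<in> A \<Longrightarrow> \<bar>\<rho>' \<alpha>\<bar> \<le> ?Q * \<rho> \<alpha> 0" by metis
    have pos: "\<rho> \<alpha> 0 > 0" for \<alpha> unfolding \<rho>_def using \<epsilon> by (simp add: add_pos_nonneg)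
    have \<rho>0: "\<rho> \<alpha> 0 = inverse ((\<epsilon>\<^sup>2 + (y \<alpha>)\<^sup>2) ^ ?M)" for \<alpha>
      by (simp add: \<rho>_def y_def norm_divide norm_minus_commute del: power_Suc)
    have avg: "(\<Sum>\<alpha>\<in>A. d \<alpha> * \<rho> \<alpha> 0) \<le> ((1 + 9 * 2 ^ (2 * N + 1)) / j) * (\<Sum>\<alpha>\<in>A. \<rho> \<alpha> 0)"
    proof -
      \<comment> \<open>\<open>\<alpha>0\<close> is a leaf of the net whose distance to the leaf \<open>\<beta>\<close> over \<open>z\<close> is at most \<open>\<epsilon>\<close>\<close>
      obtain \<alpha>0 where a0: "\<alpha>0 \<in> A" "cmod (\<alpha>0 - \<beta>) / 2 \<le> 1 / ?m" using A(4)[OF \<beta>] by blast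
      have "y \<alpha>0 ^ N \<le> cmod (\<alpha>0 - \<beta>) / 2"
        unfolding y_def using leaves_bounds(2)[OF _ \<beta> z r(2) N] a0 A(2) by auto
      also have "\<dots> \<le> \<epsilon> ^ N" using a0(2) by (simp add: \<epsilon>_def power_divide power_mult)
      finally have le: "y \<alpha>0 ^ N \<le> \<epsilon> ^ N" .
      have "0 \<le> y \<alpha>0" by (simp add: y_def)
      then have "y \<alpha>0 \<le> \<epsilon>" using iffD1[OF power_mono_iff le] N1 \<epsilon>(1) by simp
      then have y0: "y \<alpha>0 \<le> 1 / (real j ^ N)\<^sup>2" by (simp add: \<epsilon>_def)
      have yd: "0 \<le> y \<alpha> \<and> 0 \<le> d \<alpha> \<and> d \<alpha> \<le> 1 \<and> d \<alpha> ^ N \<le> y \<alpha>" if "\<alpha> \<in> A" for \<alpha>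
      proof -
        have "\<alpha> \<in> I" using that A by auto
        moreover have "cmod (\<alpha> - \<beta>) \<le> 2"
        proof -
          have "cmod \<alpha> < 1" "cmod \<beta> < 1" using Ib \<beta> \<open>\<alpha> \<in> I\<close> by auto
          then show ?thesis using norm_triangle_ineq4[of \<alpha> \<beta>] by linarith
        qed
        ultimately show ?thesis
          using leaves_bounds(1)[OF _ \<beta> z r(2) N, of \<alpha>] by (auto simp: y_def d_def)
      qed
      show ?thesis
        unfolding \<rho>0 unfolding \<epsilon>_def by (rule concentrated_average[where y=y and d=d, OF A(1) cA j N1 yd a0(1) y0])
    qed
    have B: "(\<Sum>\<alpha>\<in>A. cmod (g \<alpha> - g \<beta>) * \<rho> \<alpha> 0) \<le> B * (\<Sum>\<alpha>\<in>A. \<rho> \<alpha> 0)"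
    proof -
      have "(\<Sum>\<alpha>\<in>A. cmod (g \<alpha> - g \<beta>) * \<rho> \<alpha> 0) \<le> (\<Sum>\<alpha>\<in>A. 2 * L * (d \<alpha> * \<rho> \<alpha> 0))"
      proof (rule sum_mono)
        fix \<alpha> assume "\<alpha> \<in> A"
        then have "cmod (g \<alpha> - g \<beta>) \<le> 2 * L * d \<alpha>" using g[of \<alpha> \<beta>] A(2) \<beta> by (auto simp: d_def)
        then show "cmod (g \<alpha> - g \<beta>) * \<rho> \<alpha> 0 \<le> 2 * L * (d \<alpha> * \<rho> \<alpha> 0)"
          using mult_right_mono[of _ _ "\<rho> \<alpha> 0"] pos[of \<alpha>] by (simp add: mult.assoc[symmetric])
      qed
      also have "\<dots> \<le> 2 * L * (((1 + 9 * 2 ^ (2 * N + 1)) / j) * (\<Sum>\<alpha>\<in>A. \<rho> \<alpha> 0))"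
        unfolding sum_distrib_left[symmetric] using avg L by (intro mult_left_mono) auto
      finally show ?thesis by (simp add: B_def mult.assoc)
    qed
    have bl: "blend g A \<epsilon> ?M (z + of_real t * e, f \<beta> (z + of_real t * e)) =
       (\<Sum>\<alpha>\<in>A. g \<alpha> * of_real (\<rho> \<alpha> t)) / of_real (\<Sum>\<alpha>\<in>A. \<rho> \<alpha> t)" for t
      by (simp only: blend_def \<rho>_def fst_conv snd_conv)
    note W = weighted_average[OF A(1) Ane pos \<rho>' B]
    have b0: "blend g A \<epsilon> ?M (z, f \<beta> z) = (\<Sum>\<alpha>\<in>A. g \<alpha> * of_real (\<rho> \<alpha> 0)) / of_real (\<Sum>\<alpha>\<in>A. \<rho> \<alpha> 0)"
      using bl[of 0] by (simp only: of_real_0 mult_zero_left add_0_right)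
    show ?thesis unfolding b0 bl by (rule conjI[OF W])
  qed
  show ?thesis
    by (intro exI[of _ A] conjI A(1) Ane A(2) ballI allI impI main[THEN conjunct1] main[THEN conjunct2])
qed

end

context closed_wd_current
begin

text \<open>The test function \<open>a1 \<cdot> a2 \<cdot> blend\<close>, with a cutoff \<open>a2\<close> in \<open>w\<close>, has leafwise derivatives with
  integral \<open>0\<close>; on \<open>K\<close> these differ from the integrand by at most a multiple of \<open>(1 + ln j)/j\<close>.\<close>

lemma product_derivative_zero:
  fixes g :: "complex \<Rightarrow> complex" and a1 :: "complex \<times> complex \<Rightarrow> complex"
  assumes r: "0 \<le> r" "r < 1" and s: "0 \<le> s" "s < 1"
    and a1: "elem UNIV a1" "\<And>p. r < cmod (fst p) \<Longrightarrow> a1 p = 0"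
    and g: "\<And>\<alpha> \<beta>. \<alpha> \<in> I \<Longrightarrow> \<beta> \<in> I \<Longrightarrow> cmod (g \<alpha> - g \<beta>) \<le> L * cmod (\<alpha> - \<beta>)"
      "\<And>\<alpha>. \<alpha> \<in> I \<Longrightarrow> s < cmod \<alpha> \<Longrightarrow> g \<alpha> = 0" and L: "L \<ge> 0"
  shows "(LINT p|N. frechet_derivative a1 (at p) (e, slope p * e) * g (leaf p)) = 0"
proof (cases "I = {}")
  case True
  then have KE: "K = {}" using K_iff by auto
  have "space N = {}" using KE unfolding space_N .
  then show ?thesis by (intro integral_eq_zero_AE AE_I2) auto
next
  case ne: False
  \<comment> \<open>leaves on which \<open>g\<close> does not vanish stay in \<open>|w| \<le> S1\<close> over \<open>cball 0 r\<close>; the cutoff \<open>a2\<close>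
    falls from \<open>1\<close> to \<open>0\<close> between \<open>Sa\<close> and \<open>Sb\<close>, so it has no effect on \<open>g\<close>\<close>
  define S1 Sa Sb where "S1 = max 0 (rad r s)" and "Sa = (1 + 2 * S1) / 3" and "Sb = (2 + S1) / 3"
  have S: "0 \<le> S1" "S1 < Sa" "Sa < Sb" "Sb < 1"
    using rad_less[OF r s(2)] by (auto simp: S1_def Sa_def Sb_def)
  define a2 :: "complex \<times> complex \<Rightarrow> complex" where
    "a2 p = of_real (bump (Sa\<^sup>2) (Sb\<^sup>2) ((cmod (snd p))\<^sup>2))" for p
  have sq: "Sa\<^sup>2 < Sb\<^sup>2" using S by (intro power_strict_mono) auto
  have a2e: "elem UNIV a2" unfolding a2_def using S by (intro elem_bump_norm elem_snd) auto
  have a2b: "cmod (a2 p) \<le> 1" for p using bump_range[OF sq] by (simp add: a2_def)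
  have a21: "a2 p = 1" if "cmod (snd p) \<le> Sa" for p
    using that S by (simp add: a2_def bump_1[OF sq] power_mono)
  have a20: "a2 p = 0" if "Sb < cmod (snd p)" for p
    using that S by (simp add: a2_def bump_0 power_mono)
  define R where "R = max r Sb"
  have R: "R < 1" using r S by (simp add: R_def)
  obtain N' :: nat where N': "(1 + r) / (1 - r) \<le> of_nat N'" using real_arch_simple by blast
  note sm1 = elem_imp_smooth[OF a1(1)] and sm2 = elem_imp_smooth[OF a2e]
  have c1: "compact (box 1)" by (intro compact_Times compact_cball)
  obtain B1 where B1: "B1 \<ge> 0" "\<And>p v. p \<in> box 1 \<Longrightarrow> cmod (frechet_derivative a1 (at p) v) \<le> B1 * norm v"
    using smooth_derivative_bounded[OF sm1 c1] by blast
  obtain B2 where B2: "B2 \<ge> 0" "\<And>p v. p \<in> box 1 \<Longrightarrow> cmod (frechet_derivative a2 (at p) v) \<le> B2 * norm v"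
    using smooth_derivative_bounded[OF sm2 c1] by blast
  have "bounded (a1 ` box 1)" by (intro compact_imp_bounded compact_continuous_image smooth_continuous sm1 c1)
  then obtain B0 where B0: "B0 > 0" "\<And>p. p \<in> box 1 \<Longrightarrow> cmod (a1 p) \<le> B0" unfolding bounded_pos by blast
  define V where "V = cmod e * (1 + 2 / (1 - r))"
  \<comment> \<open>\<open>F\<close> is the integrand, \<open>Bj\<close> bounds the distance of the blend to \<open>g\<close> on a leaf, \<open>2 Qj Bj\<close> its
    derivative along the leaf, and \<open>Cj\<close> the total error\<close>
  define F where "F p = frechet_derivative a1 (at p) (e, slope p * e) * g (leaf p)" for p
  define Bj where "Bj j = 2 * L * ((1 + 9 * 2 ^ (2 * N' + 1)) / real j)" for j
  define Qj where "Qj j = 4 * (2 * real N' + 1) * cmod e / (1 - r) * (1 + ln (1 / (1 / (real j ^ N')\<^sup>2)))" for j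
  define Cj where "Cj j = B1 * V * Bj j + B0 * (B2 * V) * Bj j + B0 * (2 * Qj j * Bj j)" for j
  have est: "cmod (LINT p|N. F p) \<le> Cj j * measure N (K \<inter> box R)" if j: "j \<ge> 1" and F: "integrable N F" for j
  proof -
    define \<epsilon> where "\<epsilon> = 1 / (real j ^ N')\<^sup>2"
    have \<epsilon>: "\<epsilon> > 0" using j by (simp add: \<epsilon>_def)
    obtain A where A: "finite A" "A \<noteq> {}" "A \<subseteq> I"
      and A2: "\<And>\<beta> z. \<beta> \<in> I \<Longrightarrow> cmod z \<le> r \<Longrightarrow> cmod (blend g A \<epsilon> (2 * N' + 1) (z, f \<beta> z) - g \<beta>) \<le> Bj j"
      and A3: "\<And>\<beta> z e. \<beta> \<in> I \<Longrightarrow> cmod z \<le> r \<Longrightarrow> 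
       \<exists>D. ((\<lambda>t. blend g A \<epsilon> (2 * N' + 1) (z + of_real t * e, f \<beta> (z + of_real t * e))) has_vector_derivative D) (at 0) \<and>
        cmod D \<le> 2 * (4 * (2 * real N' + 1) * cmod e / (1 - r) * (1 + ln (1 / \<epsilon>))) * Bj j"
    proof -
      have "\<exists>A. finite A \<and> A \<noteq> {} \<and> A \<subseteq> I \<and> (\<forall>\<beta>\<in>I. \<forall>z. cmod z \<le> r \<longrightarrow>
         cmod (blend g A \<epsilon> (2 * N' + 1) (z, f \<beta> z) - g \<beta>) \<le> Bj j \<and>
         (\<forall>e. \<exists>D. ((\<lambda>t. blend g A \<epsilon> (2 * N' + 1) (z + of_real t * e, f \<beta> (z + of_real t * e))) has_vector_derivative D) (at 0) \<and>
          cmod D \<le> 2 * (4 * (2 * real N' + 1) * cmod e / (1 - r) * (1 + ln (1 / \<epsilon>))) * Bj j))"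
        unfolding \<epsilon>_def Bj_def by (rule blend_estimate[OF r N' _ j ne L]) (rule g(1))
      then obtain A where A: "finite A" "A \<noteq> {}" "A \<subseteq> I" and A23: "\<forall>\<beta>\<in>I. \<forall>z. cmod z \<le> r \<longrightarrow>
         cmod (blend g A \<epsilon> (2 * N' + 1) (z, f \<beta> z) - g \<beta>) \<le> Bj j \<and>
         (\<forall>e. \<exists>D. ((\<lambda>t. blend g A \<epsilon> (2 * N' + 1) (z + of_real t * e, f \<beta> (z + of_real t * e))) has_vector_derivative D) (at 0) \<and>
          cmod D \<le> 2 * (4 * (2 * real N' + 1) * cmod e / (1 - r) * (1 + ln (1 / \<epsilon>))) * Bj j)"
        by (elim exE conjE)
      show thesis
      proof (rule that[OF A])
        fix \<beta> z e assume "\<beta> \<in> I" "cmod z \<le> r"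
        note A' = A23[rule_format, OF this]
        show "cmod (blend g A \<epsilon> (2 * N' + 1) (z, f \<beta> z) - g \<beta>) \<le> Bj j" by (rule A'[THEN conjunct1])
        show "\<exists>D. ((\<lambda>t. blend g A \<epsilon> (2 * N' + 1) (z + of_real t * e, f \<beta> (z + of_real t * e))) has_vector_derivative D) (at 0) \<and>
          cmod D \<le> 2 * (4 * (2 * real N' + 1) * cmod e / (1 - r) * (1 + ln (1 / \<epsilon>))) * Bj j"
          by (rule A'[THEN conjunct2, rule_format])
      qed
    qed
    let ?G = "blend g A \<epsilon> (2 * N' + 1)"
    define a where "a p = a1 p * a2 p * ?G p" for p
    have smooth_a: "smooth a"
    proof (rule smoothI_elem)
      fix x :: "complex \<times> complex"
      show "\<exists>S h. open S \<and> x \<in> S \<and> elem S h \<and> (\<forall>y\<in>S. a y = h y)"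
      proof (cases "cmod (fst x) < 1")
        case True
        have e1: "elem (ball 0 1 \<times> UNIV) a1" "elem (ball 0 1 \<times> UNIV) a2"
          using a1(1) a2e by (auto intro: elem_mono)
        have "elem (ball 0 1 \<times> UNIV) (\<lambda>p. a1 p * a2 p * ?G p)"
          by (intro elem_mult e1 elem_blend A \<epsilon>)
        then show ?thesis using True
          by (intro exI[of _ "ball 0 1 \<times> UNIV"] exI[of _ "\<lambda>p. a1 p * a2 p * ?G p"])
             (auto simp: a_def open_Times mem_Times_iff)
      next
        case False
        have "open {p :: complex \<times> complex. r < cmod (fst p)}" by (intro open_Collect_less continuous_intros)
        then show ?thesis using False r
          by (intro exI[of _ "{p. r < cmod (fst p)}"] exI[of _ "\<lambda>_. 0"]) (auto simp: a_def a1 intro: elem_const)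
      qed
    qed
    have a0: "a p = 0" if "p \<notin> box R" for p
    proof -
      have "r < cmod (fst p) \<or> Sb < cmod (snd p)" using that by (cases p) (auto simp: R_def)
      then show ?thesis using a1(2)[of p] a20[of p] by (auto simp: a_def)
    qed
    have ta: "test_on bidisc a"
      by (rule test_onI[OF smooth_a _ _ a0]) (use compact_bidisc_cball[OF R] in auto)
    note LD = leafwise_derivative[OF ta, of e]
    define H where "H p = F p - frechet_derivative a (at p) (e, slope p * e)" for p
    have H: "integrable N H" unfolding H_def by (intro Bochner_Integration.integrable_diff F LD)
    have "(LINT p|N. F p) = (LINT p|N. H p)" unfolding H_def using F LD by simp
    also have "cmod \<dots> \<le> Cj j * measure N (K \<inter> box R)"
    proof (rule N_integral_bound[OF H _ _ R])
      have zero_out: "H p = 0" if p: "p \<in> K" "r < cmod (fst p)" for p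
      proof -
        have o: "open {p :: complex \<times> complex. r < cmod (fst p)}" by (intro open_Collect_less continuous_intros)
        have "frechet_derivative a1 (at p) v = 0" "frechet_derivative a (at p) v = 0" for v
          by (rule frechet_zero_on_open[OF o, of _ _ 0]; use p a1 in \<open>simp add: a_def\<close>)+
        then show ?thesis by (simp add: H_def F_def)
      qed
      show "H p = 0" if p: "p \<in> K" "p \<notin> box R" for p
      proof (cases "r < cmod (fst p)")
        case True
        then show ?thesis using zero_out p by blast
      next
        case False
        note l = leafI[OF p(1)]
        have sb: "Sb < cmod (snd p)" using p(2) False by (cases p) (auto simp: R_def)
        have "open (- box R)" by (intro open_Compl closed_Times closed_cball)
        then have "frechet_derivative a (at p) v = 0" for v
          by (rule frechet_zero_on_open[of _ _ _ 0]) (use p a0 in auto)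
        moreover have "g (leaf p) = 0"
        proof (rule g(2))
          have "\<not> cmod (leaf p) \<le> s"
            using rad_bounds(1)[of "leaf p" "fst p" r s] l False r sb S by (auto simp: S1_def)
          then show "s < cmod (leaf p)" by simp
        qed (use l in simp)
        ultimately show ?thesis by (simp add: H_def F_def)
      qed
      have Bj0: "0 \<le> Bj j" using L by (simp add: Bj_def)
      have lnj: "0 \<le> Qj j"
        using j r by (auto simp: Qj_def intro!: mult_nonneg_nonneg add_nonneg_nonneg ln_ge_zero)
      have V0: "0 \<le> V" using r by (simp add: V_def)
      have Cj0: "0 \<le> Cj j" unfolding Cj_def using Bj0 lnj V0 B0 B1 B2 by simp
      show "cmod (H p) \<le> Cj j" if p: "p \<in> K" "p \<in> box R" for p
      proof (cases "r < cmod (fst p)")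
        case True
        then show ?thesis using zero_out[OF p(1)] Cj0 by simp
      next
        case False
        define z \<beta> where "z = fst p" and "\<beta> = leaf p"
        have z: "cmod z \<le> r" "cmod z < 1" using False r by (auto simp: z_def)
        have \<beta>: "\<beta> \<in> I" "f \<beta> z = snd p" using leafI[OF p(1)] by (auto simp: z_def \<beta>_def)
        have p_eq: "p = (z, f \<beta> z)" using \<beta> by (simp add: z_def)
        have p1: "p \<in> box 1" using p(2) R by (cases p) auto
        define v where "v = (e, deriv (f \<beta>) z * e)"
        have sl: "slope p = deriv (f \<beta>) z" by (simp add: slope_def z_def \<beta>_def)
        have nv: "norm v \<le> V"
        proof -
          have "norm v \<le> cmod e + cmod (deriv (f \<beta>) z * e)" unfolding v_def by (rule norm_Pair_le)
          also have "\<dots> \<le> cmod e + 2 / (1 - r) * cmod e"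
            using mult_right_mono[OF slope_bound[OF \<beta>(1) z(1) r(2)], of "cmod e"] by (simp add: norm_mult)
          finally show ?thesis by (simp add: V_def algebra_simps)
        qed
        define \<gamma> where "\<gamma> t = (z + of_real t * e, f \<beta> (z + of_real t * e))" for t
        have \<gamma>0: "\<gamma> 0 = p" by (simp add: \<gamma>_def p_eq)
        have \<gamma>': "(\<gamma> has_vector_derivative v) (at 0)"
          unfolding \<gamma>_def v_def by (rule leaf_curve(2)[OF \<beta>(1) z(2)])
        obtain D where D: "((\<lambda>t. ?G (\<gamma> t)) has_vector_derivative D) (at 0)" "cmod D \<le> 2 * Qj j * Bj j"
          using A3[OF \<beta>(1) z(1), of e] unfolding \<gamma>_def Qj_def \<epsilon>_def by blast
        let ?E = "frechet_derivative a1 (at p) v" and ?k = "frechet_derivative a2 (at p) v"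
        have d1: "((\<lambda>t. a1 (\<gamma> t)) has_vector_derivative ?E) (at 0)"
          using chain_vector_derivative[OF smooth_differentiable[OF sm1] \<gamma>'] by (simp add: \<gamma>0)
        have d2: "((\<lambda>t. a2 (\<gamma> t)) has_vector_derivative ?k) (at 0)"
          using chain_vector_derivative[OF smooth_differentiable[OF sm2] \<gamma>'] by (simp add: \<gamma>0)
        have da: "((\<lambda>t. a (\<gamma> t)) has_vector_derivative frechet_derivative a (at p) v) (at 0)"
          using chain_vector_derivative[OF smooth_differentiable[OF smooth_a] \<gamma>'] by (simp add: \<gamma>0)
        have "((\<lambda>t. a (\<gamma> t)) has_vector_derivative (a1 p * a2 p * D + (a1 p * ?k + ?E * a2 p) * ?G p)) (at 0)"
          unfolding a_def using has_vector_derivative_mult[OF has_vector_derivative_mult[OF d1 d2] D(1)] by (simp add: \<gamma>0)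
        then have fa: "frechet_derivative a (at p) v = a1 p * a2 p * D + (a1 p * ?k + ?E * a2 p) * ?G p"
          using da vector_derivative_unique_at by blast
        \<comment> \<open>the cutoff and its derivative are invisible where \<open>g\<close> does not vanish\<close>
        have gk: "a2 p * g \<beta> = g \<beta>" "?k * g \<beta> = 0"
        proof -
          have "a2 p * g \<beta> = g \<beta> \<and> ?k * g \<beta> = 0"
          proof (cases "s < cmod \<beta>")
            case False
            then have "cmod (snd p) \<le> S1" using rad_bounds(1)[OF \<beta>(1) z(1) r(2), of s] \<beta>(2) by (auto simp: S1_def)
            then have lt: "cmod (snd p) < Sa" using S by simp
            have "open {p :: complex \<times> complex. cmod (snd p) < Sa}" by (intro open_Collect_less continuous_intros)
            then have "?k = 0" by (rule frechet_zero_on_open[of _ _ _ 1]) (use lt a21 in auto)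
            then show ?thesis using a21[of p] lt by simp
          qed (use g(2)[OF \<beta>(1)] in simp)
          then show "a2 p * g \<beta> = g \<beta>" "?k * g \<beta> = 0" by auto
        qed
        have "H p = ?E * g \<beta> - frechet_derivative a (at p) v"
          by (simp add: H_def F_def v_def sl \<beta>_def)
        also have "\<dots> = - (?E * a2 p * (?G p - g \<beta>) + a1 p * ?k * (?G p - g \<beta>) + a1 p * a2 p * D)
             + (?E * (g \<beta> - a2 p * g \<beta>) - a1 p * (?k * g \<beta>))"
          unfolding fa by (simp add: algebra_simps)
        also have "\<dots> = - (?E * a2 p * (?G p - g \<beta>) + a1 p * ?k * (?G p - g \<beta>) + a1 p * a2 p * D)"
          unfolding gk by simp
        also have "cmod \<dots> \<le> cmod (?E * a2 p * (?G p - g \<beta>)) + cmod (a1 p * ?k * (?G p - g \<beta>)) + cmod (a1 p * a2 p * D)"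
          unfolding norm_minus_cancel by (intro order_trans[OF norm_triangle_ineq] add_right_mono norm_triangle_ineq)
        also have "\<dots> \<le> (B1 * V) * 1 * Bj j + B0 * (B2 * V) * Bj j + B0 * 1 * (2 * Qj j * Bj j)"
        proof -
          have E: "cmod ?E \<le> B1 * V" by (rule order_trans[OF B1(2)[OF p1] mult_left_mono[OF nv B1(1)]])
          have k: "cmod ?k \<le> B2 * V" by (rule order_trans[OF B2(2)[OF p1] mult_left_mono[OF nv B2(1)]])
          have gg: "cmod (?G p - g \<beta>) \<le> Bj j" by (rule A2[OF \<beta>(1) z(1), folded p_eq])
          have 1: "cmod (?E * a2 p * (?G p - g \<beta>)) \<le> (B1 * V) * 1 * Bj j"
            unfolding norm_mult by (rule mult_mono[OF mult_mono[OF E a2b] gg]) (use B1 V0 in simp_all)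
          have 2: "cmod (a1 p * ?k * (?G p - g \<beta>)) \<le> B0 * (B2 * V) * Bj j"
            unfolding norm_mult by (rule mult_mono[OF mult_mono[OF B0(2)[OF p1] k] gg]) (use B0 B2 V0 in simp_all)
          have 3: "cmod (a1 p * a2 p * D) \<le> B0 * 1 * (2 * Qj j * Bj j)"
            unfolding norm_mult by (rule mult_mono[OF mult_mono[OF B0(2)[OF p1] a2b] D(2)]) (use B0 in simp_all)
          show ?thesis by (rule add_mono[OF add_mono[OF 1 2] 3])
        qed
        finally show ?thesis by (simp add: Cj_def)
      qed
    qed
    finally show ?thesis .
  qed
  have "Cj \<longlonglongrightarrow> 0"
  proof -
    have Bl: "Bj \<longlonglongrightarrow> 0"
    proof -
      have "(\<lambda>j. 2 * L * ((1 + 9 * 2 ^ (2 * N' + 1)) * (1 / real j))) \<longlonglongrightarrow> 2 * L * ((1 + 9 * 2 ^ (2 * N' + 1)) * 0)"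
        by (intro tendsto_intros)
      then show ?thesis by (simp add: Bj_def[abs_def])
    qed
    \<comment> \<open>\<open>Qj\<close> grows like \<open>ln j\<close> and \<open>Bj\<close> decays like \<open>1/j\<close>\<close>
    have Ql: "(\<lambda>j. Qj j * Bj j) \<longlonglongrightarrow> 0"
    proof -
      define c where "c = 4 * (2 * real N' + 1) * cmod e / (1 - r) * (2 * L * (1 + 9 * 2 ^ (2 * N' + 1)))"
      have "(\<lambda>j. c * (1 / real j + 2 * real N' * (ln (real j) / real j))) \<longlonglongrightarrow> c * (0 + 2 * real N' * 0)"
        by (intro tendsto_intros)
      then have "(\<lambda>j. c * (1 / real j + 2 * real N' * (ln (real j) / real j))) \<longlonglongrightarrow> 0" by simp
      moreover have "eventually (\<lambda>j. c * (1 / real j + 2 * real N' * (ln (real j) / real j)) = Qj j * Bj j) sequentially"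
        using eventually_gt_at_top[of 0]
      proof eventually_elim
        case (elim j)
        have "ln ((real j ^ N')\<^sup>2) = 2 * real N' * ln (real j)" using elim by (simp add: ln_realpow power_mult[symmetric] mult.commute)
        then show ?case by (simp add: Qj_def Bj_def c_def algebra_simps add_divide_distrib)
      qed
      ultimately show ?thesis by (rule Lim_transform_eventually)
    qed
    have "(\<lambda>j. B1 * V * Bj j + B0 * (B2 * V) * Bj j + B0 * (2 * (Qj j * Bj j))) \<longlonglongrightarrow> B1 * V * 0 + B0 * (B2 * V) * 0 + B0 * (2 * 0)"
      by (intro tendsto_intros Bl Ql)
    then show ?thesis by (simp add: Cj_def[abs_def] mult.assoc)
  qed
  then have lim: "(\<lambda>j. Cj j * measure N (K \<inter> box R)) \<longlonglongrightarrow> 0" by (rule tendsto_mult_left_zero)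
  have "(LINT p|N. F p) = 0"
  proof (cases "integrable N F")
    case True
    have "cmod (LINT p|N. F p) \<le> 0"
      by (rule tendsto_lowerbound[OF lim]) (use est[OF _ True] in \<open>auto simp: eventually_sequentially intro!: exI[of _ 1]\<close>)
    then show ?thesis by simp
  qed (simp add: not_integrable_integral_eq)
  then show ?thesis by (simp add: F_def)
qed

end

section \<open>Translation invariance along the leaves\<close>

text \<open>Rotation invariant bumps about \<open>0\<close>, with support of radius \<open>\<rho>\<close>.  They are not
  normalised.\<close>

definition bmp :: "real \<Rightarrow> complex \<Rightarrow> real" where
  "bmp \<rho> z = flat 1 (\<rho>\<^sup>2 - (cmod z)\<^sup>2)"

definition dbmp :: "real \<Rightarrow> complex \<Rightarrow> complex \<Rightarrow> real" where
  "dbmp \<rho> z e = flat (flat_next 1) (\<rho>\<^sup>2 - (cmod z)\<^sup>2) * (- 2 * (z \<bullet> e))"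

lemma bmp_nonneg: "0 \<le> bmp \<rho> z" and bmp_le_1: "bmp \<rho> z \<le> 1"
  by (auto simp: bmp_def flat_def)

lemma bmp_eq_0: "0 < \<rho> \<Longrightarrow> bmp \<rho> z = 0 \<longleftrightarrow> \<rho> \<le> cmod z"
proof -
  assume "0 < \<rho>"
  have "bmp \<rho> z = 0 \<longleftrightarrow> \<rho>\<^sup>2 \<le> (cmod z)\<^sup>2" by (simp add: bmp_def flat_eq_0)
  also have "\<dots> \<longleftrightarrow> \<rho> \<le> cmod z" using \<open>0 < \<rho>\<close> by (intro power_mono_iff) auto
  finally show ?thesis .
qed

lemma dbmp_eq_0: "0 < \<rho> \<Longrightarrow> \<rho> \<le> cmod z \<Longrightarrow> dbmp \<rho> z e = 0"
  by (simp add: dbmp_def flat_def power_mono)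

lemma bmp_has_derivative: "(bmp \<rho> has_derivative dbmp \<rho> z) (at z)"
proof -
  have "((\<lambda>z. \<rho>\<^sup>2 - z \<bullet> z) has_derivative (\<lambda>e. - 2 * (z \<bullet> e))) (at z)"
    by (auto intro!: derivative_eq_intros simp: inner_commute)
  from has_derivative_compose[OF this flat_deriv[unfolded has_field_derivative_def]]
  show ?thesis by (simp add: bmp_def[abs_def] dbmp_def[abs_def] power2_norm_eq_inner)
qed

lemma cont_flat: "continuous_on UNIV (flat P)"
  using flat_deriv DERIV_isCont by (simp add: continuous_on_eq_continuous_at) blast

lemma cont_bmp: "continuous_on A (bmp \<rho>)"
  using bmp_has_derivative by (meson continuous_at_imp_continuous_on has_derivative_continuous)

lemma cont_dbmp: "continuous_on A h \<Longrightarrow> continuous_on A (\<lambda>x. dbmp \<rho> (h x) e)"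
  unfolding dbmp_def by (intro continuous_intros continuous_on_compose2[OF cont_flat]) auto

lemma elem_bmp: "elem S (\<lambda>p. of_real (bmp \<rho> (fst p - u)))"
proof -
  have "elem S (\<lambda>p. of_real (flat 1 (Re (of_real (\<rho>\<^sup>2) - of_real ((cmod (fst p - u))\<^sup>2)))))"
    by (intro elem_flat elem_diff elem_const elem_norm_sq elem_fst)
  then show ?thesis by (simp add: bmp_def)
qed

lemma frechet_bmp:
  fixes p :: "complex \<times> complex"
  shows "frechet_derivative (\<lambda>p. complex_of_real (bmp \<rho> (fst p - u))) (at p) (e, c) = of_real (dbmp \<rho> (fst p - u) e)"
proof -
  have "((\<lambda>p::complex \<times> complex. fst p - u) has_derivative fst) (at p)"
    by (auto intro!: derivative_eq_intros bounded_linear_imp_has_derivative[OF bounded_linear_fst])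
  from bounded_linear.has_derivative[OF bounded_linear_of_real has_derivative_compose[OF this bmp_has_derivative]]
  have "((\<lambda>p. complex_of_real (bmp \<rho> (fst p - u))) has_derivative (\<lambda>v. of_real (dbmp \<rho> (fst p - u) (fst v)))) (at p)" .
  from frechet_derivative_at[OF this, symmetric] show ?thesis by simp
qed

context lamination
begin

definition reach :: "real \<Rightarrow> real \<Rightarrow> real" where
  "reach r s = max r (rad r s)"

lemma reach_less: "0 \<le> r \<Longrightarrow> r < 1 \<Longrightarrow> s < 1 \<Longrightarrow> reach r s < 1"
  using rad_less by (simp add: reach_def)

lemma in_reach:
  assumes "p \<in> K" "cmod (fst p) \<le> r" "cmod (leaf p) \<le> s" "r < 1"
  shows "p \<in> box (reach r s)"
  using rad_bounds(1)[of "leaf p" "fst p" r s] leafI[OF assms(1)] assms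
  by (cases p) (auto simp: reach_def le_max_iff_disj)

end

context lam_current
begin

text \<open>Off a compact set the integrand vanishes, so \<open>N\<close> can be replaced by a finite measure on the
  whole space, for which Fubini's theorem is at hand.\<close>

lemma N_fubini:
  fixes h :: "complex \<times> complex \<Rightarrow> 'b::euclidean_space \<Rightarrow> complex"
  assumes h: "continuous_on (K \<times> C) (\<lambda>(p, y). h p y)" "\<And>p y. p \<in> K \<Longrightarrow> y \<in> C \<Longrightarrow> p \<notin> box R \<Longrightarrow> h p y = 0"
    and R: "R < 1" and C: "compact C"
  shows "(LINT p|N. (LINT y:C|lborel. h p y)) = (LINT y:C|lborel. (LINT p|N. h p y))"
proof -
  let ?KR = "K \<inter> box R"
  have KRb: "?KR \<in> sets borel" by (intro borel_closed compact_imp_closed compact_K_box R)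
  have Kn: "K \<inter> space R.\<nu> \<in> sets R.\<nu>" using borel_K by (simp add: R.sets_nu R.space_nu)
  have KRn: "?KR \<in> sets R.\<nu>" using KRb by (simp add: R.sets_nu)
  have Cb: "C \<in> sets borel" by (intro borel_closed compact_imp_closed C)
  \<comment> \<open>the finite measure that replaces \<open>N\<close>\<close>
  define N' where "N' = density R.\<nu> (indicator ?KR)"
  have sN': "sets N' = sets borel" by (simp add: N'_def R.sets_nu)
  have fin: "emeasure R.\<nu> ?KR < top"
  proof -
    have "emeasure R.\<nu> ?KR \<le> emeasure R.\<nu> (box R)"
      by (rule emeasure_mono) (auto simp: R.sets_nu intro!: borel_closed closed_Times)
    also have "\<dots> < top" using compact_bidisc_cball[OF R] by (intro R.emeasure_nu_finite) auto
    finally show ?thesis .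
  qed
  have "emeasure N' (space N') = emeasure R.\<nu> ?KR"
    using emeasure_density[OF borel_measurable_indicator[OF KRn] sets.top] KRn by (simp add: N'_def R.space_nu)
  then interpret N': finite_measure N' using fin by (intro finite_measureI) auto
  interpret P: pair_sigma_finite N' "lborel :: 'b measure" ..
  define H where "H p y = indicator ?KR p *\<^sub>R (indicator C y *\<^sub>R h p y)" for p y
  have Hm: "case_prod H \<in> borel_measurable borel"
  proof -
    have "(\<lambda>x. indicator (?KR \<times> C) x *\<^sub>R (case x of (p, y) \<Rightarrow> h p y)) \<in> borel_measurable borel"
      by (intro borel_measurable_continuous_on_indicator borel_closed closed_Times compact_imp_closed[OF C]
            compact_imp_closed[OF compact_K_box[OF R]] continuous_on_subset[OF h(1)]) auto
    then show ?thesis by (simp add: H_def case_prod_beta' indicator_times)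
  qed
  have sets_pair: "sets (N' \<Otimes>\<^sub>M (lborel :: 'b measure)) = sets (borel :: ((complex \<times> complex) \<times> 'b) measure)"
    unfolding sets_pair_measure_cong[OF sN' sets_lborel] borel_prod ..
  have KC: "?KR \<times> C \<in> sets (N' \<Otimes>\<^sub>M (lborel :: 'b measure))"
    using KRb Cb by (intro pair_measureI) (auto simp: sN')
  have bdd: "bounded ((\<lambda>(p, y). h p y) ` (?KR \<times> C))"
    using compact_K_box[OF R] C h(1)
    by (intro compact_imp_bounded compact_continuous_image compact_Times) (auto intro: continuous_on_subset)
  then obtain B where B: "B > 0" "\<And>p y. p \<in> ?KR \<Longrightarrow> y \<in> C \<Longrightarrow> norm (h p y) \<le> B" unfolding bounded_pos by force
  have int: "integrable (N' \<Otimes>\<^sub>M (lborel :: 'b measure)) (case_prod H)"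
  proof (rule Bochner_Integration.integrable_bound)
    have "emeasure (N' \<Otimes>\<^sub>M (lborel :: 'b measure)) (?KR \<times> C) = emeasure N' ?KR * emeasure lborel C"
      using KRb Cb by (intro sigma_finite_measure.emeasure_pair_measure_Times[OF sigma_finite_lborel]) (auto simp: sN')
    also have "\<dots> < top"
    proof -
      have "emeasure N' ?KR < top" using N'.emeasure_finite[of ?KR] by (simp add: less_top[symmetric])
      then show ?thesis using emeasure_compact_finite[OF C] by (simp add: ennreal_mult_less_top)
    qed
    finally show "integrable (N' \<Otimes>\<^sub>M (lborel :: 'b measure)) (\<lambda>x. B * indicator (?KR \<times> C) x)"
      using KC by simp
    show "case_prod H \<in> borel_measurable (N' \<Otimes>\<^sub>M (lborel :: 'b measure))"
      using Hm measurable_cong_sets[OF sets_pair refl] by blast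
    show "AE x in N' \<Otimes>\<^sub>M (lborel :: 'b measure). norm (case_prod H x) \<le> norm (B * indicator (?KR \<times> C) x)"
      using B by (intro AE_I2) (auto simp: H_def indicator_def split: if_splits)
  qed
  have swap: "(LINT y|lborel. LINT p|N'. H p y) = (LINT p|N'. LINT y|lborel. H p y)"
    by (rule P.Fubini_integral[OF int])
  have NN: "(LINT p|N. q p) = (LINT p|N'. indicator ?KR p *\<^sub>R q p)"
    if q: "\<And>p. p \<in> K \<Longrightarrow> p \<notin> box R \<Longrightarrow> q p = 0" and m: "(\<lambda>p. indicator ?KR p *\<^sub>R q p) \<in> borel_measurable borel"
    for q :: "complex \<times> complex \<Rightarrow> complex"
  proof -
    have "(LINT p|N. q p) = (LINT p|R.\<nu>. indicator K p *\<^sub>R q p)"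
      unfolding N_def using Kn by (simp add: integral_restrict_space)
    also have "\<dots> = (LINT p|R.\<nu>. indicator ?KR p *\<^sub>R (indicator ?KR p *\<^sub>R q p))"
      using q by (intro Bochner_Integration.integral_cong refl) (auto simp: indicator_def)
    also have "\<dots> = (LINT p|N'. indicator ?KR p *\<^sub>R q p)"
      unfolding N'_def using m measurable_cong_sets[OF R.sets_nu refl] KRn
      by (subst integral_density[where g = "indicator ?KR :: _ \<Rightarrow> real", symmetric]) (auto simp: ennreal_indicator)
    finally show ?thesis .
  qed
  have sec: "(\<lambda>p. H p y) \<in> borel_measurable borel" for y
  proof -
    have "(\<lambda>p. (p, y)) \<in> borel_measurable (borel :: (complex \<times> complex) measure)"
      by (intro borel_measurable_continuous_onI continuous_intros)
    from measurable_compose[OF this Hm] show ?thesis by simp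
  qed
  have "(LINT p|N. (LINT y:C|lborel. h p y)) = (LINT p|N'. indicator ?KR p *\<^sub>R (LINT y:C|lborel. h p y))"
  proof (rule NN)
    show "(LINT y:C|lborel. h p y) = 0" if "p \<in> K" "p \<notin> box R" for p
      unfolding set_lebesgue_integral_def using h(2)[OF that(1) _ that(2)]
      by (intro integral_eq_zero_AE AE_I2) (auto simp: indicator_def)
    have "(\<lambda>p. LINT y|lborel. H p y) \<in> borel_measurable N'"
      by (rule sigma_finite_measure.borel_measurable_lebesgue_integral[OF sigma_finite_lborel]) (use int in auto)
    moreover have "(LINT y|lborel. H p y) = indicator ?KR p *\<^sub>R (LINT y:C|lborel. h p y)" for p
      unfolding H_def set_lebesgue_integral_def by (rule integral_scaleR_right)
    ultimately show "(\<lambda>p. indicator ?KR p *\<^sub>R (LINT y:C|lborel. h p y)) \<in> borel_measurable borel"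
      by (simp add: measurable_cong_sets[OF sN' refl])
  qed
  also have "\<dots> = (LINT p|N'. LINT y|lborel. H p y)"
    unfolding H_def set_lebesgue_integral_def integral_scaleR_right ..
  also have "\<dots> = (LINT y|lborel. LINT p|N'. H p y)" by (rule swap[symmetric])
  also have "\<dots> = (LINT y:C|lborel. (LINT p|N. h p y))"
    unfolding set_lebesgue_integral_def
  proof (rule Bochner_Integration.integral_cong[OF refl])
    fix y :: 'b
    show "(LINT p|N'. H p y) = indicator C y *\<^sub>R (LINT p|N. h p y)"
    proof (cases "y \<in> C")
      case True
      have "(LINT p|N. h p y) = (LINT p|N'. indicator ?KR p *\<^sub>R h p y)"
        by (rule NN) (use h(2) True sec[of y] in \<open>auto simp: H_def\<close>)
      then show ?thesis using True by (simp add: H_def)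
    qed (simp add: H_def)
  qed
  finally show ?thesis .
qed

end

context closed_wd_current
begin

text \<open>The derivative of the integral with respect to the translation \<open>t w\<close> is \<open>0\<close> for
  \<open>0 \<le> t \<le> 1\<close>, by \<open>product_derivative_zero\<close>.\<close>

lemma translation_lipschitz:
  fixes g :: "complex \<Rightarrow> complex"
  assumes \<rho>: "0 < \<rho>" and w: "cmod w + \<rho> < 1" and s: "0 \<le> s" "s < 1"
    and g: "\<And>\<alpha> \<beta>. \<alpha> \<in> I \<Longrightarrow> \<beta> \<in> I \<Longrightarrow> cmod (g \<alpha> - g \<beta>) \<le> L * cmod (\<alpha> - \<beta>)"
      "\<And>\<alpha>. \<alpha> \<in> I \<Longrightarrow> s < cmod \<alpha> \<Longrightarrow> g \<alpha> = 0" and L: "L \<ge> 0" and gc: "continuous_on I g"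
  shows "(LINT p|N. of_real (bmp \<rho> (fst p - w)) * g (leaf p)) = (LINT p|N. of_real (bmp \<rho> (fst p)) * g (leaf p))"
proof -
  define r where "r = cmod w + \<rho>"
  have r: "0 \<le> r" "r < 1" using \<rho> w by (auto simp: r_def)
  let ?R = "reach r s"
  have R: "?R < 1" by (rule reach_less[OF r s(2)])
  have far: "\<rho> \<le> cmod (z - of_real t * w)" if "r < cmod z" "0 \<le> t" "t \<le> 1" for z t
  proof -
    have "cmod (of_real t * w) \<le> cmod w" using that by (simp add: norm_mult mult_left_le_one_le)
    then show ?thesis using that norm_triangle_ineq2[of z "of_real t * w"] by (simp add: r_def)
  qed
  have out: "cmod (fst p) > r \<or> cmod (leaf p) > s" if "p \<in> K" "p \<notin> box ?R" for p
    using in_reach[OF that(1), of r s] that(2) r by force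
  have gl: "continuous_on K (\<lambda>p. g (leaf p))"
    by (rule continuous_on_compose2[OF gc cont_leaf]) (use leafI in auto)
  have gl0: "g (leaf p) = 0" if "p \<in> K" "s < cmod (leaf p)" for p using g(2) leafI[OF that(1)] that(2) by blast
  have int: "integrable N (\<lambda>p. of_real (bmp \<rho> (fst p - of_real t * w)) * g (leaf p))" if t: "0 \<le> t" "t \<le> 1" for t
  proof (rule N_integrable[OF _ _ R])
    show "continuous_on K (\<lambda>p. of_real (bmp \<rho> (fst p - of_real t * w)) * g (leaf p))"
      by (intro continuous_intros gl continuous_on_compose2[OF cont_bmp[of UNIV]]) auto
    show "of_real (bmp \<rho> (fst p - of_real t * w)) * g (leaf p) = 0" if "p \<in> K" "p \<notin> box ?R" for p
      using out[OF that] gl0[OF that(1)] far[of "fst p" t] t bmp_eq_0[OF \<rho>] by auto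
  qed
  define h where "h p t = of_real (- dbmp \<rho> (fst p - of_real t * w) w) * g (leaf p)" for p :: "complex \<times> complex" and t :: real
  have ftc: "(LINT t:{0..1}|lborel. h p t) = of_real (bmp \<rho> (fst p - w)) * g (leaf p) - of_real (bmp \<rho> (fst p)) * g (leaf p)" for p
  proof -
    have "((\<lambda>t. bmp \<rho> (fst p - of_real t * w)) has_vector_derivative (- dbmp \<rho> (fst p - of_real t * w) w)) (at t within {0..1})" for t :: real
    proof -
      have "((\<lambda>t. fst p - of_real t * w) has_vector_derivative (- w)) (at t within {0..1})"
        by (auto intro!: derivative_eq_intros)
      from vector_derivative_diff_chain_within[OF this has_derivative_at_withinI[OF bmp_has_derivative]]
      show ?thesis by (simp add: o_def dbmp_def)
    qed
    then have "((\<lambda>t. complex_of_real (bmp \<rho> (fst p - of_real t * w)) * g (leaf p)) has_vector_derivative h p t) (at t within {0..1})" for t :: real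
      unfolding h_def
      by (intro has_vector_derivative_mult_left has_vector_derivative_of_real)
         (simp add: has_real_derivative_iff_has_vector_derivative)
    moreover have "continuous_on {0..1} (h p)"
      unfolding h_def by (intro continuous_intros cont_dbmp)
    ultimately have "has_bochner_integral lborel (\<lambda>t. indicator {0..1} t *\<^sub>R h p t)
       (of_real (bmp \<rho> (fst p - of_real 1 * w)) * g (leaf p) - of_real (bmp \<rho> (fst p - of_real 0 * w)) * g (leaf p))"
      by (intro has_bochner_integral_FTC_Icc) auto
    then show ?thesis by (simp add: set_lebesgue_integral_def has_bochner_integral_integral_eq)
  qed
  have zero: "(LINT p|N. h p t) = 0" if t: "0 \<le> t" "t \<le> 1" for t
  proof -
    have "(LINT p|N. frechet_derivative (\<lambda>p. complex_of_real (bmp \<rho> (fst p - of_real t * w))) (at p) (w, slope p * w) * g (leaf p)) = 0"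
    proof (rule product_derivative_zero[OF r s elem_bmp _ g(1,2) L])
      show "complex_of_real (bmp \<rho> (fst p - of_real t * w)) = 0" if "r < cmod (fst p)" for p :: "complex \<times> complex"
        using far[OF that t] bmp_eq_0[OF \<rho>] by simp
    qed
    then have "(LINT p|N. of_real (dbmp \<rho> (fst p - of_real t * w) w) * g (leaf p)) = 0" unfolding frechet_bmp .
    then show ?thesis by (simp add: h_def)
  qed
  have "(LINT p|N. (LINT t:{0..1}|lborel. h p t)) = (LINT t:{0..1}|lborel. (LINT p|N. h p t))"
  proof (rule N_fubini[OF _ _ R])
    have "continuous_on (K \<times> {0..1}) (\<lambda>x. of_real (- dbmp \<rho> (fst (fst x) - of_real (snd x) * w) w) * g (leaf (fst x)))"
      by (intro continuous_intros cont_dbmp continuous_on_compose2[OF gl]) auto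
    then show "continuous_on (K \<times> {0..1}) (\<lambda>(p, y). h p y)" by (simp add: h_def case_prod_beta)
    show "h p t = 0" if "p \<in> K" "t \<in> {0..1}" "p \<notin> box ?R" for p t
      using out[OF that(1,3)] gl0[OF that(1)] far[of "fst p" t] that dbmp_eq_0[OF \<rho>] by (auto simp: h_def)
  qed simp
  also have "\<dots> = 0"
    unfolding set_lebesgue_integral_def using zero
    by (intro integral_eq_zero_AE AE_I2) (auto simp: indicator_def)
  finally show ?thesis
    unfolding ftc using int[of 1] int[of 0] by simp
qed

lemma compact_I: "s < 1 \<Longrightarrow> compact (I \<inter> cball 0 s)"
proof -
  assume s: "s < 1"
  have c: "compact (K \<inter> box s \<inter> ({0} \<times> UNIV))"
    by (intro compact_Int_closed compact_K_box s closed_Times closed_singleton closed_UNIV)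
  have "I \<inter> cball 0 s = snd ` (K \<inter> box s \<inter> ({0} \<times> UNIV))"
  proof (intro set_eqI iffI)
    fix \<alpha> assume a: "\<alpha> \<in> I \<inter> cball 0 s"
    then have "0 \<le> s" using norm_ge_zero[of \<alpha>] by (simp del: norm_ge_zero)
    then have "(0, \<alpha>) \<in> K \<inter> box s \<inter> ({0} \<times> UNIV)" using a by (simp add: indices_def)
    then show "\<alpha> \<in> snd ` (K \<inter> box s \<inter> ({0} \<times> UNIV))" by force
  next
    fix \<alpha> assume "\<alpha> \<in> snd ` (K \<inter> box s \<inter> ({0} \<times> UNIV))"
    then show "\<alpha> \<in> I \<inter> cball 0 s" using s by (auto simp: indices_def)
  qed
  moreover have "compact (snd ` (K \<inter> box s \<inter> ({0} \<times> UNIV)))"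
    by (rule compact_continuous_image[OF continuous_on_snd[OF continuous_on_id] c])
  ultimately show ?thesis by simp
qed

text \<open>The radius outside which the Lipschitz approximations of a function supported in
  \<open>cball 0 s\<close> vanish.\<close>

definition widen :: "real \<Rightarrow> real" where
  "widen s = (1 + max ((1 + s) / 2) (1/2)) / 2"

lemma widen: "s < 1 \<Longrightarrow> s \<le> widen s \<and> 0 \<le> widen s \<and> widen s < 1"
  by (auto simp: widen_def max_def field_simps)

text \<open>Extended by Tietze's theorem and multiplied by a tent function of \<open>z\<close>, \<open>g\<close> becomes a
  continuous function with compact support in the bidisc; the approximation is the restriction of
  a test function to \<open>z = 0\<close>.\<close>

lemma lipschitz_approx:
  fixes g :: "complex \<Rightarrow> complex"
  assumes s: "0 \<le> s" "s < 1" and g: "continuous_on I g" "\<And>\<alpha>. \<alpha> \<in> I \<Longrightarrow> s < cmod \<alpha> \<Longrightarrow> g \<alpha> = 0" and e: "e > 0"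
  shows "\<exists>g' L. 0 \<le> L \<and> continuous_on I g' \<and> (\<forall>\<alpha>\<in>I. \<forall>\<beta>\<in>I. cmod (g' \<alpha> - g' \<beta>) \<le> L * cmod (\<alpha> - \<beta>)) \<and>
    (\<forall>\<alpha>\<in>I. widen s < cmod \<alpha> \<longrightarrow> g' \<alpha> = 0) \<and> (\<forall>\<alpha>\<in>I. cmod (g \<alpha> - g' \<alpha>) \<le> e)"
proof -
  define t where "t = (1 + s) / 2"
  have t: "s < t" "t < 1" "0 < t" using s by (auto simp: t_def)
  let ?A = "I \<inter> cball 0 t" and ?B = "- ball (0::complex) t"
  define g0 where "g0 \<alpha> = (if \<alpha> \<in> I then g \<alpha> else 0)" for \<alpha>
  have c1: "continuous_on (?A \<union> ?B) (\<lambda>\<alpha>. if cmod \<alpha> \<le> t then g0 \<alpha> else 0)"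
  proof (rule continuous_on_closed_Un)
    show "closed ?A" using compact_I[OF t(2)] compact_imp_closed by blast
    show "closed ?B" by auto
    have "continuous_on ?A g" by (rule continuous_on_subset[OF g(1)]) auto
    then show "continuous_on ?A (\<lambda>\<alpha>. if cmod \<alpha> \<le> t then g0 \<alpha> else 0)"
      by (rule continuous_on_eq) (auto simp: g0_def)
    have "continuous_on ?B (\<lambda>_. 0 :: complex)" by simp
    then show "continuous_on ?B (\<lambda>\<alpha>. if cmod \<alpha> \<le> t then g0 \<alpha> else 0)"
      by (rule continuous_on_eq) (use g(2) t in \<open>auto simp: g0_def\<close>)
  qed
  have c2: "closedin (top_of_set UNIV) (?A \<union> ?B)"
    using compact_imp_closed[OF compact_I[OF t(2)]] by auto
  obtain G where G: "continuous_on UNIV G" "\<And>\<alpha>. \<alpha> \<in> ?A \<union> ?B \<Longrightarrow> G \<alpha> = (if cmod \<alpha> \<le> t then g0 \<alpha> else 0)"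
    using Tietze_unbounded[OF c1 c2] by blast
  have GI: "G \<alpha> = g \<alpha>" if "\<alpha> \<in> I" for \<alpha>
    using G(2)[of \<alpha>] that g(2)[OF that] t by (cases "cmod \<alpha> \<le> t") (auto simp: g0_def)
  have G0: "G \<alpha> = 0" if "cmod \<alpha> > t" for \<alpha> using G(2)[of \<alpha>] that by auto
  \<comment> \<open>the tent function is \<open>1\<close> at \<open>z = 0\<close>\<close>
  define \<psi> :: "complex \<times> complex \<Rightarrow> complex" where "\<psi> p = G (snd p) * of_real (max 0 (1 - 2 * cmod (fst p)))" for p
  define r where "r = max t (1/2)"
  have r: "0 < r" "r < 1" using t by (auto simp: r_def)
  have "continuous_on UNIV \<psi>"
    unfolding \<psi>_def by (intro continuous_intros continuous_on_compose2[OF G(1)]) auto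
  moreover have "\<psi> p = 0" if "p \<notin> box r" for p
    using that G0[of "snd p"] by (cases p) (auto simp: \<psi>_def r_def)
  ultimately obtain \<eta> where \<eta>: "test_on bidisc \<eta>" "\<And>x. x \<notin> box ((1+r)/2) \<Longrightarrow> \<eta> x = 0" "\<And>x. cmod (\<eta> x - \<psi> x) \<le> e"
    using scalar_approx[OF _ r _ e, of \<psi>] by blast
  define g' where "g' \<alpha> = \<eta> (0, \<alpha>)" for \<alpha>
  have sm: "smooth \<eta>" by (rule test_onD(1)[OF \<eta>(1)])
  have "compact (box 1)" by (intro compact_Times compact_cball)
  from smooth_derivative_bounded[OF sm this]
  obtain L where L: "L \<ge> 0" "\<And>p v. p \<in> box 1 \<Longrightarrow> cmod (frechet_derivative \<eta> (at p) v) \<le> L * norm v" by blast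
  have lip: "cmod (g' \<alpha> - g' \<beta>) \<le> L * cmod (\<alpha> - \<beta>)" if "\<alpha> \<in> I" "\<beta> \<in> I" for \<alpha> \<beta>
  proof -
    have m: "(0, \<alpha>) \<in> box 1" "(0, \<beta>) \<in> box 1" using that by (auto simp: indices_def)
    have "cmod (\<eta> (0, \<alpha>) - \<eta> (0, \<beta>)) \<le> L * norm ((0, \<alpha>) - (0::complex, \<beta>))"
    proof (rule differentiable_bound[OF _ _ _ m])
      show "convex (box 1)" by (intro convex_Times convex_cball)
      show "(\<eta> has_derivative frechet_derivative \<eta> (at x)) (at x within box 1)" for x
        using smooth_differentiable[OF sm] by (simp add: frechet_derivative_works has_derivative_at_withinI)
      show "onorm (frechet_derivative \<eta> (at x)) \<le> L" if "x \<in> box 1" for x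
        by (rule onorm_bound[OF L(1) L(2)[OF that]])
    qed
    then show ?thesis by (simp add: g'_def norm_Pair)
  qed
  have c: "continuous_on I g'"
    unfolding g'_def by (intro continuous_on_compose2[OF smooth_continuous[OF sm, of UNIV]] continuous_intros) auto
  have z: "g' \<alpha> = 0" if "\<alpha> \<in> I" "(1+r)/2 < cmod \<alpha>" for \<alpha> using \<eta>(2)[of "(0, \<alpha>)"] that(2) by (simp add: g'_def)
  have a: "cmod (g \<alpha> - g' \<alpha>) \<le> e" if "\<alpha> \<in> I" for \<alpha>
    using \<eta>(3)[of "(0, \<alpha>)"] GI[OF that] by (simp add: g'_def \<psi>_def norm_minus_commute)
  have "widen s = (1+r)/2" by (simp add: widen_def r_def t_def)
  then show ?thesis using L(1) c lip z a by (intro exI[of _ g'] exI[of _ L]) auto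
qed

lemma translation_continuous:
  fixes g :: "complex \<Rightarrow> complex"
  assumes \<rho>: "0 < \<rho>" and w: "cmod w + \<rho> < 1" and s: "0 \<le> s" "s < 1"
    and g: "continuous_on I g" "\<And>\<alpha>. \<alpha> \<in> I \<Longrightarrow> s < cmod \<alpha> \<Longrightarrow> g \<alpha> = 0"
  shows "(LINT p|N. of_real (bmp \<rho> (fst p - w)) * g (leaf p)) = (LINT p|N. of_real (bmp \<rho> (fst p)) * g (leaf p))"
proof -
  define r where "r = cmod w + \<rho>"
  have r: "0 \<le> r" "r < 1" using \<rho> w by (auto simp: r_def)
  have far: "\<rho> \<le> cmod (z - v)" if "r < cmod z" "v = w \<or> v = 0" for z v
  proof -
    have "cmod v \<le> cmod w" using that(2) by auto
    then show ?thesis using that(1) norm_triangle_ineq2[of z v] unfolding r_def by linarith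
  qed
  let ?R = "reach r (widen s)"
  have R: "?R < 1" by (rule reach_less[OF r]) (use widen[OF s(2)] in auto)
  define m where "m = measure N (K \<inter> box ?R)"
  define X :: "(complex \<Rightarrow> complex) \<Rightarrow> complex \<Rightarrow> complex" where "X g v = (LINT p|N. of_real (bmp \<rho> (fst p - v)) * g (leaf p))" for g v
  have X: "integrable N (\<lambda>p. of_real (bmp \<rho> (fst p - v)) * q (leaf p)) \<and> ((\<forall>\<alpha>\<in>I. cmod (q \<alpha>) \<le> e) \<longrightarrow> cmod (X q v) \<le> e * m)"
    if v: "v = w \<or> v = 0" and q: "continuous_on I q" "\<forall>\<alpha>\<in>I. widen s < cmod \<alpha> \<longrightarrow> q \<alpha> = 0" for q v e
  proof -
    have ql: "continuous_on K (\<lambda>p. q (leaf p))"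
      by (rule continuous_on_compose2[OF q(1) cont_leaf]) (use leafI in auto)
    have z: "of_real (bmp \<rho> (fst p - v)) * q (leaf p) = 0" if p: "p \<in> K" "p \<notin> box ?R" for p
    proof -
      have "r < cmod (fst p) \<or> widen s < cmod (leaf p)" using in_reach[OF p(1), of r "widen s"] p(2) r by force
      then show ?thesis using far[of "fst p" v] v bmp_eq_0[OF \<rho>] q(2) leafI[OF p(1)] by auto
    qed
    have i: "integrable N (\<lambda>p. of_real (bmp \<rho> (fst p - v)) * q (leaf p))"
      by (rule N_integrable[OF _ z R]) (intro continuous_intros ql continuous_on_compose2[OF cont_bmp[of UNIV]]; auto)
    have "cmod (X q v) \<le> e * m" if e: "\<forall>\<alpha>\<in>I. cmod (q \<alpha>) \<le> e"
      unfolding X_def m_def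
    proof (rule N_integral_bound[OF i z _ R])
      fix p assume "p \<in> K"
      then have "cmod (of_real (bmp \<rho> (fst p - v)) * q (leaf p)) \<le> 1 * e"
        unfolding norm_mult using e leafI bmp_nonneg[of \<rho> "fst p - v"] bmp_le_1[of \<rho> "fst p - v"]
        by (intro mult_mono) auto
      then show "cmod (of_real (bmp \<rho> (fst p - v)) * q (leaf p)) \<le> e" by simp
    qed
    with i show ?thesis by blast
  qed
  have g0: "\<forall>\<alpha>\<in>I. widen s < cmod \<alpha> \<longrightarrow> g \<alpha> = 0" using g(2) widen[OF s(2)] by auto
  have small: "cmod (X g w - X g 0) \<le> e * (2 * m)" if e: "e > 0" for e
  proof -
    obtain g' L where g': "0 \<le> L" "continuous_on I g'" "\<And>\<alpha> \<beta>. \<alpha> \<in> I \<Longrightarrow> \<beta> \<in> I \<Longrightarrow> cmod (g' \<alpha> - g' \<beta>) \<le> L * cmod (\<alpha> - \<beta>)"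
      "\<forall>\<alpha>\<in>I. widen s < cmod \<alpha> \<longrightarrow> g' \<alpha> = 0" "\<forall>\<alpha>\<in>I. cmod (g \<alpha> - g' \<alpha>) \<le> e"
      using lipschitz_approx[OF s g e] by blast
    have eq: "X g' w = X g' 0"
      unfolding X_def using translation_lipschitz[OF \<rho> w _ _ g'(3) _ g'(1,2), of "widen s"] widen[OF s(2)] g'(4) by simp
    have dc: "continuous_on I (\<lambda>\<alpha>. g \<alpha> - g' \<alpha>)" by (intro continuous_intros g g')
    have d0: "\<forall>\<alpha>\<in>I. widen s < cmod \<alpha> \<longrightarrow> g \<alpha> - g' \<alpha> = 0" using g0 g'(4) by auto
    have d: "X (\<lambda>\<alpha>. g \<alpha> - g' \<alpha>) v = X g v - X g' v" "cmod (X (\<lambda>\<alpha>. g \<alpha> - g' \<alpha>) v) \<le> e * m" if v: "v = w \<or> v = 0" for v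
    proof -
      show "X (\<lambda>\<alpha>. g \<alpha> - g' \<alpha>) v = X g v - X g' v"
        using X[OF v g(1) g0] X[OF v g'(2,4)] by (simp add: X_def right_diff_distrib)
      show "cmod (X (\<lambda>\<alpha>. g \<alpha> - g' \<alpha>) v) \<le> e * m" using X[OF v dc d0, of e] g'(5) by blast
    qed
    have "X g w - X g 0 = X (\<lambda>\<alpha>. g \<alpha> - g' \<alpha>) w - X (\<lambda>\<alpha>. g \<alpha> - g' \<alpha>) 0" using d(1)[of w] d(1)[of 0] eq by simp
    also have "cmod \<dots> \<le> e * m + e * m" using d(2)[of w] d(2)[of 0] by (intro order_trans[OF norm_triangle_ineq4] add_mono) auto
    finally show ?thesis by simp
  qed
  have m0: "0 \<le> m" by (simp add: m_def)
  have "cmod (X g w - X g 0) \<le> 0"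
  proof (rule field_le_epsilon)
    fix d :: real assume d: "d > 0"
    have "cmod (X g w - X g 0) \<le> d / (2 * m + 1) * (2 * m)" using d m0 by (intro small) auto
    also have "\<dots> \<le> d" using d m0 by (simp add: divide_simps algebra_simps)
    finally show "cmod (X g w - X g 0) \<le> 0 + d" by simp
  qed
  then show ?thesis by (simp add: X_def)
qed

end

section \<open>Disintegration along the leaves\<close>

lemma continuous_on_set_integral:
  fixes h :: "'a::heine_borel \<Rightarrow> 'b::euclidean_space \<Rightarrow> complex"
  assumes h: "continuous_on (S \<times> C) (\<lambda>(p, y). h p y)" and C: "compact C"
  shows "continuous_on S (\<lambda>p. LINT y:C|lborel. h p y)"
  unfolding continuous_on_sequentially
proof (intro allI ballI impI)
  fix x a assume a: "a \<in> S" and "(\<forall>n. x n \<in> S) \<and> x \<longlonglongrightarrow> a"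
  then have x: "\<And>n. x n \<in> S" and lim: "x \<longlonglongrightarrow> a" by auto
  let ?Q = "insert a (range x)"
  have Q: "compact ?Q" "?Q \<subseteq> S" using compact_sequence_with_limit[OF lim] a x by auto
  have "bounded ((\<lambda>(p, y). h p y) ` (?Q \<times> C))"
    using Q C by (intro compact_imp_bounded compact_continuous_image compact_Times continuous_on_subset[OF h]) auto
  then obtain B where B: "B > 0" "\<And>x. x \<in> ?Q \<times> C \<Longrightarrow> norm (case x of (p, y) \<Rightarrow> h p y) \<le> B"
    unfolding bounded_pos by blast
  have B2: "norm (h p y) \<le> B" if "p \<in> ?Q" "y \<in> C" for p y using B(2)[of "(p, y)"] that by simp
  have Cb: "C \<in> sets borel" by (intro borel_closed compact_imp_closed C)
  have cy: "continuous_on C (h p)" if "p \<in> S" for p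
  proof -
    have "(\<lambda>y. (p, y)) ` C \<subseteq> S \<times> C" using that by auto
    from continuous_on_compose2[OF h continuous_on_Pair[OF continuous_on_const continuous_on_id] this]
    show ?thesis by simp
  qed
  have m: "(\<lambda>y. indicator C y *\<^sub>R h p y) \<in> borel_measurable lborel" if "p \<in> S" for p
    using borel_measurable_continuous_on_indicator[OF Cb cy[OF that]] by simp
  have "(\<lambda>n. LINT y|lborel. indicator C y *\<^sub>R h (x n) y) \<longlonglongrightarrow> (LINT y|lborel. indicator C y *\<^sub>R h a y)"
  proof (rule integral_dominated_convergence[where w = "\<lambda>y. B * indicator C y"])
    show "integrable lborel (\<lambda>y. B * indicator C y)" using Cb emeasure_compact_finite[OF C] by simp
    show "AE y in lborel. (\<lambda>n. indicator C y *\<^sub>R h (x n) y) \<longlonglongrightarrow> indicator C y *\<^sub>R h a y"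
    proof (rule AE_I2)
      fix y :: 'b
      show "(\<lambda>n. indicator C y *\<^sub>R h (x n) y) \<longlonglongrightarrow> indicator C y *\<^sub>R h a y"
      proof (cases "y \<in> C")
        case True
        have "(\<lambda>p. (p, y)) ` S \<subseteq> S \<times> C" using True by auto
        from continuous_on_compose2[OF h continuous_on_Pair[OF continuous_on_id continuous_on_const] this]
        have "continuous_on S (\<lambda>p. h p y)" by simp
        then have "(\<lambda>n. h (x n) y) \<longlonglongrightarrow> h a y"
          using a x lim unfolding continuous_on_sequentially by (auto simp: o_def)
        then show ?thesis by (intro tendsto_intros)
      qed simp
    qed
    show "AE y in lborel. norm (indicator C y *\<^sub>R h (x n) y) \<le> B * indicator C y" for n
      using B2[of "x n"] by (intro AE_I2) (auto simp: indicator_def)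
  qed (use m a x in auto)
  then show "((\<lambda>p. LINT y:C|lborel. h p y) \<circ> x) \<longlonglongrightarrow> (LINT y:C|lborel. h a y)"
    by (simp add: set_lebesgue_integral_def o_def)
qed

definition bmass :: "real \<Rightarrow> real" where
  "bmass \<rho> = (LINT z|lborel. bmp \<rho> z)"

lemma bmp_integrable: "0 < \<rho> \<Longrightarrow> integrable lborel (\<lambda>y. bmp \<rho> (z - y))"
proof -
  assume \<rho>: "0 < \<rho>"
  have "integrable lborel (\<lambda>y. indicator (cball z \<rho>) y *\<^sub>R bmp \<rho> (z - y))"
    by (intro borel_integrable_compact continuous_on_compose2[OF cont_bmp[of UNIV]] continuous_intros) auto
  moreover have "(\<lambda>y. indicator (cball z \<rho>) y *\<^sub>R bmp \<rho> (z - y)) = (\<lambda>y. bmp \<rho> (z - y))"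
  proof
    show "indicator (cball z \<rho>) y *\<^sub>R bmp \<rho> (z - y) = bmp \<rho> (z - y)" for y
      using bmp_eq_0[OF \<rho>, of "z - y"] by (auto simp: indicator_def dist_norm)
  qed
  ultimately show ?thesis by simp
qed

lemma bmp_even: "bmp \<rho> (- z) = bmp \<rho> z"
  by (simp add: bmp_def)

lemma bmass_translate: "(LINT y|lborel. bmp \<rho> (z - y)) = bmass \<rho>"
proof -
  have "bmass \<rho> = (LINT y|distr lborel borel ((+) (- z)). bmp \<rho> y)" by (simp add: bmass_def lborel_distr_plus)
  also have "\<dots> = (LINT y|lborel. bmp \<rho> (- z + y))"
    by (subst integral_distr) (auto intro: borel_measurable_continuous_onI cont_bmp)
  also have "\<dots> = (LINT y|lborel. bmp \<rho> (z - y))"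
    using bmp_even[of \<rho> "z - y" for y] by (intro Bochner_Integration.integral_cong refl) (metis minus_diff_eq uminus_add_conv_diff)
  finally show ?thesis by simp
qed

lemma bmass_pos: "0 < \<rho> \<Longrightarrow> 0 < bmass \<rho>"
proof -
  assume \<rho>: "0 < \<rho>"
  have int: "integrable lborel (bmp \<rho>)" using bmp_integrable[OF \<rho>, of 0] by (simp add: bmp_even)
  have "bmass \<rho> \<noteq> 0"
  proof
    assume "bmass \<rho> = 0"
    then have "AE z in lborel. bmp \<rho> z = 0"
      using integral_nonneg_eq_0_iff_AE[OF int] bmp_nonneg by (simp add: bmass_def)
    then have "AE z in lborel. z \<notin> ball (0::complex) \<rho>" by eventually_elim (use bmp_eq_0[OF \<rho>] in auto)
    then have "emeasure lborel (ball (0::complex) \<rho>) = 0"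
      by (subst (asm) AE_iff_measurable[where N="ball 0 \<rho>"]) auto
    then show False using content_ball_pos[OF \<rho>, of "0::complex"] by (simp add: measure_def)
  qed
  moreover have "0 \<le> bmass \<rho>" unfolding bmass_def by (rule integral_nonneg_AE) (simp add: bmp_nonneg)
  ultimately show ?thesis by simp
qed

context closed_wd_current
begin

text \<open>Functions on the product of the disc and the set of labels, in the coordinates
  \<open>(z, leaf)\<close> of \<open>K\<close>, to which the invariance under translations applies.\<close>

definition adm :: "real \<Rightarrow> real \<Rightarrow> (complex \<Rightarrow> complex \<Rightarrow> complex) \<Rightarrow> bool" where
  "adm r s \<Phi> \<longleftrightarrow> 0 \<le> r \<and> r < 1 \<and> 0 \<le> s \<and> s < 1 \<and> continuous_on (ball 0 1 \<times> I) (\<lambda>(y, \<alpha>). \<Phi> y \<alpha>) \<and>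
     (\<forall>\<alpha>\<in>I. \<forall>y. r < cmod y \<longrightarrow> \<Phi> y \<alpha> = 0) \<and> (\<forall>\<alpha>\<in>I. s < cmod \<alpha> \<longrightarrow> (\<forall>y. cmod y < 1 \<longrightarrow> \<Phi> y \<alpha> = 0))"

text \<open>The integral over a leaf.\<close>

definition fibre :: "real \<Rightarrow> (complex \<Rightarrow> complex \<Rightarrow> complex) \<Rightarrow> complex \<Rightarrow> complex" where
  "fibre r \<Phi> \<alpha> = (LINT y:cball 0 r|lborel. \<Phi> y \<alpha>)"

lemma adm_section:
  assumes "adm r s \<Phi>"
  shows "cmod y < 1 \<Longrightarrow> continuous_on I (\<Phi> y)" and "\<alpha> \<in> I \<Longrightarrow> continuous_on (ball 0 1) (\<lambda>y. \<Phi> y \<alpha>)"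
proof -
  have c: "continuous_on (ball 0 1 \<times> I) (\<lambda>(y, \<alpha>). \<Phi> y \<alpha>)" using assms by (simp add: adm_def)
  show "continuous_on I (\<Phi> y)" if "cmod y < 1"
  proof -
    have "(\<lambda>\<alpha>. (y, \<alpha>)) ` I \<subseteq> ball 0 1 \<times> I" using that by auto
    from continuous_on_compose2[OF c continuous_on_Pair[OF continuous_on_const continuous_on_id] this]
    show ?thesis by simp
  qed
  show "\<alpha> \<in> I \<Longrightarrow> continuous_on (ball 0 1) (\<lambda>y. \<Phi> y \<alpha>)"
    using continuous_on_compose2[OF c continuous_on_Pair[OF continuous_on_id continuous_on_const[of "ball 0 1" \<alpha>]]] by auto
qed

lemma adm_fibre:
  assumes "adm r s \<Phi>"
  shows "continuous_on I (fibre r \<Phi>)" and "\<alpha> \<in> I \<Longrightarrow> s < cmod \<alpha> \<Longrightarrow> fibre r \<Phi> \<alpha> = 0"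
proof -
  have r: "r < 1" and c: "continuous_on (ball 0 1 \<times> I) (\<lambda>(y, \<alpha>). \<Phi> y \<alpha>)"
    and z: "\<And>\<alpha> y. \<alpha> \<in> I \<Longrightarrow> s < cmod \<alpha> \<Longrightarrow> cmod y < 1 \<Longrightarrow> \<Phi> y \<alpha> = 0" using assms by (auto simp: adm_def)
  have "continuous_on (I \<times> cball 0 r) (\<lambda>x. case (snd x, fst x) of (y, \<alpha>) \<Rightarrow> \<Phi> y \<alpha>)"
    by (rule continuous_on_compose2[OF c]) (use r in \<open>auto intro!: continuous_intros\<close>)
  then have "continuous_on (I \<times> cball 0 r) (\<lambda>(\<alpha>, y). \<Phi> y \<alpha>)" by (simp add: case_prod_beta)
  then show "continuous_on I (fibre r \<Phi>)" unfolding fibre_def by (rule continuous_on_set_integral) simp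
  show "fibre r \<Phi> \<alpha> = 0" if a: "\<alpha> \<in> I" "s < cmod \<alpha>"
    unfolding fibre_def set_lebesgue_integral_def using z[OF a] r
    by (intro integral_eq_zero_AE AE_I2) (auto simp: indicator_def)
qed

lemma adm_integrable:
  assumes a: "adm r s \<Phi>"
  shows "continuous_on K (\<lambda>p. \<Phi> (fst p) (leaf p))" "integrable N (\<lambda>p. \<Phi> (fst p) (leaf p))"
    "p \<in> K \<Longrightarrow> p \<notin> box (reach r s) \<Longrightarrow> \<Phi> (fst p) (leaf p) = 0"
proof -
  have r: "0 \<le> r" "r < 1" "0 \<le> s" "s < 1" and c: "continuous_on (ball 0 1 \<times> I) (\<lambda>(y, \<alpha>). \<Phi> y \<alpha>)"
    and z: "\<And>\<alpha> y. \<alpha> \<in> I \<Longrightarrow> r < cmod y \<Longrightarrow> \<Phi> y \<alpha> = 0" "\<And>\<alpha> y. \<alpha> \<in> I \<Longrightarrow> s < cmod \<alpha> \<Longrightarrow> cmod y < 1 \<Longrightarrow> \<Phi> y \<alpha> = 0"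
    using a by (auto simp: adm_def)
  have "continuous_on K (\<lambda>p. case (fst p, leaf p) of (y, \<alpha>) \<Rightarrow> \<Phi> y \<alpha>)"
    by (rule continuous_on_compose2[OF c]) (use leafI in \<open>auto intro!: continuous_intros cont_leaf\<close>)
  then show cc: "continuous_on K (\<lambda>p. \<Phi> (fst p) (leaf p))" by simp
  show out: "\<Phi> (fst p) (leaf p) = 0" if p: "p \<in> K" "p \<notin> box (reach r s)" for p
  proof -
    have "r < cmod (fst p) \<or> s < cmod (leaf p)" using in_reach[OF p(1), of r s] p(2) r by force
    then show ?thesis using z leafI[OF p(1)] by auto
  qed
  show "integrable N (\<lambda>p. \<Phi> (fst p) (leaf p))"
    by (rule N_integrable[OF cc out reach_less[OF r(1,2,4)]])
qed

text \<open>Writing \<open>fibre\<close> as an integral over \<open>y\<close>, Fubini's theorem and the translation of the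
  bump from \<open>0\<close> to \<open>y\<close> turn the first integral into that of the convolution of \<open>\<Phi>\<close> with the bump
  along the leaves, which is close to \<open>\<Phi>\<close> times the mass of the bump.\<close>

lemma mollify:
  assumes a: "adm r s \<Phi>" and e: "e > 0"
  shows "\<exists>\<delta>>0. \<forall>\<rho>. 0 < \<rho> \<and> \<rho> < \<delta> \<longrightarrow>
     cmod ((LINT p|N. of_real (bmp \<rho> (fst p)) * fibre r \<Phi> (leaf p)) - of_real (bmass \<rho>) * (LINT p|N. \<Phi> (fst p) (leaf p))) \<le> e * bmass \<rho>"
proof -
  have r: "0 \<le> r" "r < 1" "0 \<le> s" "s < 1" and c: "continuous_on (ball 0 1 \<times> I) (\<lambda>(y, \<alpha>). \<Phi> y \<alpha>)"
    and z: "\<And>\<alpha> y. \<alpha> \<in> I \<Longrightarrow> r < cmod y \<Longrightarrow> \<Phi> y \<alpha> = 0" "\<And>\<alpha> y. \<alpha> \<in> I \<Longrightarrow> s < cmod \<alpha> \<Longrightarrow> cmod y < 1 \<Longrightarrow> \<Phi> y \<alpha> = 0"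
    using a by (auto simp: adm_def)
  \<comment> \<open>a margin for the translated bumps: they must not leave \<open>cball 0 r'\<close>\<close>
  define r' where "r' = (1 + r) / 2"
  have r': "r < r'" "r' < 1" "0 \<le> r'" using r by (auto simp: r'_def)
  let ?R = "reach r' s"
  have R: "?R < 1" by (rule reach_less) (use r r' in auto)
  define m where "m = measure N (K \<inter> box ?R)"
  have m0: "0 \<le> m" by (simp add: m_def)
  define e0 where "e0 = e / (m + 1)"
  have e0: "e0 > 0" "e0 * m \<le> e" using e m0 by (auto simp: e0_def divide_simps)
  let ?S = "cball (0::complex) r' \<times> (I \<inter> cball 0 s)"
  have "compact ?S" by (intro compact_Times compact_cball compact_I r)
  moreover have "continuous_on ?S (\<lambda>(y, \<alpha>). \<Phi> y \<alpha>)" by (rule continuous_on_subset[OF c]) (use r' in auto)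
  ultimately have "uniformly_continuous_on ?S (\<lambda>(y, \<alpha>). \<Phi> y \<alpha>)" by (rule compact_uniformly_continuous[rotated])
  then obtain d where d: "d > 0" "\<And>x x'. x \<in> ?S \<Longrightarrow> x' \<in> ?S \<Longrightarrow> dist x' x < d \<Longrightarrow>
      dist (case x' of (y, \<alpha>) \<Rightarrow> \<Phi> y \<alpha>) (case x of (y, \<alpha>) \<Rightarrow> \<Phi> y \<alpha>) < e0"
    unfolding uniformly_continuous_on_def using e0(1) by meson
  define \<delta> where "\<delta> = min d (r' - r)"
  have \<delta>: "\<delta> > 0" using d r' by (simp add: \<delta>_def)
  have "cmod ((LINT p|N. of_real (bmp \<rho> (fst p)) * fibre r \<Phi> (leaf p)) - of_real (bmass \<rho>) * (LINT p|N. \<Phi> (fst p) (leaf p))) \<le> e * bmass \<rho>"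
    if \<rho>: "0 < \<rho>" "\<rho> < \<delta>" for \<rho>
  proof -
    let ?C = "cball (0::complex) r"
    \<comment> \<open>translation invariance in the first argument takes \<open>h1\<close> to \<open>h2\<close> for each fixed \<open>y\<close>\<close>
    define h1 where "h1 p y = of_real (bmp \<rho> (fst p)) * \<Phi> y (leaf p)" for p :: "complex \<times> complex" and y
    define h2 where "h2 p y = of_real (bmp \<rho> (fst p - y)) * \<Phi> y (leaf p)" for p :: "complex \<times> complex" and y
    have out: "r' < cmod (fst p) \<or> s < cmod (leaf p)" if p: "p \<in> K" "p \<notin> box ?R" for p
      using in_reach[OF p(1), of r' s] p(2) r' by force
    have \<Phi>c: "continuous_on (K \<times> ?C) (\<lambda>x. \<Phi> (snd x) (leaf (fst x)))"
    proof -
      have "continuous_on (K \<times> ?C) (\<lambda>x. case (snd x, leaf (fst x)) of (y, \<alpha>) \<Rightarrow> \<Phi> y \<alpha>)"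
        by (rule continuous_on_compose2[OF c])
          (use leafI r in \<open>auto intro!: continuous_intros continuous_on_compose2[OF cont_leaf]\<close>)
      then show ?thesis by simp
    qed
    have h1c: "continuous_on (K \<times> ?C) (\<lambda>(p, y). h1 p y)"
      unfolding h1_def case_prod_beta
      by (intro continuous_intros \<Phi>c continuous_on_compose2[OF cont_bmp[of UNIV]]) auto
    have h2c: "continuous_on (K \<times> ?C) (\<lambda>(p, y). h2 p y)"
      unfolding h2_def case_prod_beta
      by (intro continuous_intros \<Phi>c continuous_on_compose2[OF cont_bmp[of UNIV]]) auto
    have h1z: "h1 p y = 0" if p: "p \<in> K" "y \<in> ?C" "p \<notin> box ?R" for p y
    proof -
      have "\<rho> \<le> r'" using \<rho> r by (auto simp: \<delta>_def)
      then show ?thesis using out[OF p(1,3)] z(2) leafI[OF p(1)] p(2) r bmp_eq_0[OF \<rho>(1), of "fst p"] by (auto simp: h1_def)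
    qed
    have h2z: "h2 p y = 0" if p: "p \<in> K" "y \<in> ?C" "p \<notin> box ?R" for p y
      using out[OF p(1,3)]
    proof
      assume "r' < cmod (fst p)"
      then have "\<rho> \<le> cmod (fst p - y)" using p(2) norm_triangle_ineq2[of "fst p" y] \<rho> by (simp add: \<delta>_def)
      then show ?thesis using bmp_eq_0[OF \<rho>(1)] by (simp add: h2_def)
    next
      assume "s < cmod (leaf p)"
      then show ?thesis using z(2)[of "leaf p" y] leafI[OF p(1)] p(2) r by (simp add: h2_def)
    qed
    have "(LINT p|N. of_real (bmp \<rho> (fst p)) * fibre r \<Phi> (leaf p)) = (LINT p|N. (LINT y:?C|lborel. h1 p y))"
      by (simp add: h1_def fibre_def)
    also have "\<dots> = (LINT y:?C|lborel. (LINT p|N. h1 p y))" by (rule N_fubini[OF h1c h1z R compact_cball])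
    also have "\<dots> = (LINT y:?C|lborel. (LINT p|N. h2 p y))"
      unfolding set_lebesgue_integral_def
    proof (rule Bochner_Integration.integral_cong[OF refl])
      fix y :: complex
      show "indicator ?C y *\<^sub>R (LINT p|N. h1 p y) = indicator ?C y *\<^sub>R (LINT p|N. h2 p y)"
      proof (cases "y \<in> ?C")
        case True
        have y: "cmod y < 1" "cmod y + \<rho> < 1" using True r r' \<rho> by (auto simp: \<delta>_def)
        have "(LINT p|N. h2 p y) = (LINT p|N. h1 p y)"
          unfolding h1_def h2_def
          by (rule translation_continuous[OF \<rho>(1) y(2) r(3,4) adm_section(1)[OF a y(1)]]) (use z(2) y in auto)
        then show ?thesis by simp
      qed simp
    qed
    also have "\<dots> = (LINT p|N. (LINT y:?C|lborel. h2 p y))" by (rule N_fubini[OF h2c h2z R compact_cball, symmetric])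
    finally have eq: "(LINT p|N. of_real (bmp \<rho> (fst p)) * fibre r \<Phi> (leaf p)) = (LINT p|N. (LINT y:?C|lborel. h2 p y))" .
    define F where "F p = (LINT y:?C|lborel. h2 p y) - of_real (bmass \<rho>) * \<Phi> (fst p) (leaf p)" for p
    have z2: "(LINT y:?C|lborel. h2 p y) = 0" if "p \<in> K" "p \<notin> box ?R" for p
      unfolding set_lebesgue_integral_def using h2z[OF that(1) _ that(2)]
      by (intro integral_eq_zero_AE AE_I2) (auto simp: indicator_def)
    have i2: "integrable N (\<lambda>p. LINT y:?C|lborel. h2 p y)"
      by (rule N_integrable[OF continuous_on_set_integral[OF h2c compact_cball] z2 R])
    have iF: "integrable N F"
      unfolding F_def by (intro Bochner_Integration.integrable_diff i2 integrable_mult_right adm_integrable(2)[OF a])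
    have "(LINT p|N. F p) = (LINT p|N. of_real (bmp \<rho> (fst p)) * fibre r \<Phi> (leaf p)) - of_real (bmass \<rho>) * (LINT p|N. \<Phi> (fst p) (leaf p))"
      unfolding F_def eq using i2 adm_integrable(2)[OF a] by simp
    moreover have "cmod (LINT p|N. F p) \<le> (e0 * bmass \<rho>) * m"
      unfolding m_def
    proof (rule N_integral_bound[OF iF _ _ R])
      show "F p = 0" if p: "p \<in> K" "p \<notin> box ?R" for p
      proof -
        have "\<Phi> (fst p) (leaf p) = 0" using out[OF p] z leafI[OF p(1)] r' by auto
        then show ?thesis using z2[OF p] by (simp add: F_def)
      qed
      show "cmod (F p) \<le> e0 * bmass \<rho>" if p: "p \<in> K" for p
      proof -
        define w \<alpha> where "w = fst p" and "\<alpha> = leaf p"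
        have w: "cmod w < 1" "\<alpha> \<in> I" using leafI[OF p] by (auto simp: w_def \<alpha>_def)
        have near: "cmod (\<Phi> y \<alpha> - \<Phi> w \<alpha>) \<le> e0" if y: "cmod (w - y) < \<rho>" "cmod y < 1" for y
        proof (cases "s < cmod \<alpha>")
          case True
          then show ?thesis using z(2)[OF w(2)] w y e0 by simp
        next
          case False
          show ?thesis
          proof (cases "cmod y \<le> r' \<and> cmod w \<le> r'")
            case True
            then have "dist (\<Phi> y \<alpha>) (\<Phi> w \<alpha>) < e0"
              using d(2)[of "(w, \<alpha>)" "(y, \<alpha>)"] False w y \<rho>
              by (simp add: dist_Pair_Pair dist_norm norm_minus_commute \<delta>_def)
            then show ?thesis by (simp add: dist_norm)
          next
            case False
            have "r < cmod y" "r < cmod w"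
              using False y(1) \<rho> r' norm_triangle_ineq3[of w y] by (auto simp: \<delta>_def)
            then show ?thesis using z(1)[OF w(2)] e0 by simp
          qed
        qed
        have ib: "integrable lborel (\<lambda>y. complex_of_real (bmp \<rho> (w - y)) * \<Phi> w \<alpha>)"
          using bmp_integrable[OF \<rho>(1), of w] by (intro integrable_mult_left integrable_of_real)
        have "continuous_on ?C (\<lambda>y. of_real (bmp \<rho> (w - y)) * \<Phi> y \<alpha>)"
          by (intro continuous_intros continuous_on_compose2[OF cont_bmp[of UNIV]] continuous_on_subset[OF adm_section(2)[OF a w(2)]]) (use r in auto)
        then have ic: "integrable lborel (\<lambda>y. indicator ?C y *\<^sub>R (of_real (bmp \<rho> (w - y)) * \<Phi> y \<alpha>))"
          by (intro borel_integrable_compact compact_cball)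
        have "F p = (LINT y|lborel. indicator ?C y *\<^sub>R (of_real (bmp \<rho> (w - y)) * \<Phi> y \<alpha>)) - (LINT y|lborel. complex_of_real (bmp \<rho> (w - y)) * \<Phi> w \<alpha>)"
          using bmp_integrable[OF \<rho>(1), of w]
          by (simp add: F_def h2_def set_lebesgue_integral_def w_def \<alpha>_def bmass_translate)
        also have "\<dots> = (LINT y|lborel. indicator ?C y *\<^sub>R (of_real (bmp \<rho> (w - y)) * \<Phi> y \<alpha>) - complex_of_real (bmp \<rho> (w - y)) * \<Phi> w \<alpha>)"
          using ib ic by simp
        also have "cmod \<dots> \<le> (LINT y|lborel. e0 * bmp \<rho> (w - y))"
        proof (rule Bochner_Integration.integral_norm_bound_integral)
          show "integrable lborel (\<lambda>y. e0 * bmp \<rho> (w - y))" using bmp_integrable[OF \<rho>(1), of w] by simp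
          fix y :: complex
          have "indicator ?C y *\<^sub>R (complex_of_real (bmp \<rho> (w - y)) * \<Phi> y \<alpha>) - of_real (bmp \<rho> (w - y)) * \<Phi> w \<alpha>
              = of_real (bmp \<rho> (w - y)) * (\<Phi> y \<alpha> - \<Phi> w \<alpha>)"
            using z(1)[OF w(2), of y] by (auto simp: indicator_def algebra_simps)
          also have "cmod \<dots> \<le> e0 * bmp \<rho> (w - y)"
          proof (cases "\<rho> \<le> cmod (w - y)")
            case True
            then have "bmp \<rho> (w - y) = 0" using bmp_eq_0[OF \<rho>(1)] by blast
            then show ?thesis by simp
          next
            case False
            have "cmod (\<Phi> y \<alpha> - \<Phi> w \<alpha>) \<le> e0"
            proof (cases "cmod y < 1")
              case True
              then show ?thesis using near False by simp
            next
              case not1: False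
              have "r < cmod y" "r < cmod w"
                using not1 False \<rho> r' norm_triangle_ineq3[of w y] by (auto simp: \<delta>_def)
              then show ?thesis using z(1)[OF w(2)] e0 by simp
            qed
            from mult_right_mono[OF this bmp_nonneg[of \<rho> "w - y"]] show ?thesis
              using bmp_nonneg[of \<rho> "w - y"] by (simp add: norm_mult mult.commute)
          qed
          finally show "cmod (indicator ?C y *\<^sub>R (complex_of_real (bmp \<rho> (w - y)) * \<Phi> y \<alpha>) - of_real (bmp \<rho> (w - y)) * \<Phi> w \<alpha>) \<le> e0 * bmp \<rho> (w - y)" .
        qed (use ib ic in simp)
        also have "\<dots> = e0 * bmass \<rho>" by (simp add: bmass_translate)
        finally show ?thesis .
      qed
    qed
    moreover have "(e0 * bmass \<rho>) * m \<le> e * bmass \<rho>"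
      using mult_right_mono[OF e0(2), of "bmass \<rho>"] bmass_pos[OF \<rho>(1)] by (simp add: mult_ac)
    ultimately show ?thesis by simp
  qed
  then show ?thesis using \<delta> by blast
qed

text \<open>The integrand \<open>\<Psi>\<close> on the right, a normalised bump in \<open>z\<close> times \<open>fibre \<Phi>\<close>, has the same
  fibre integrals as \<open>\<Phi>\<close>.  By \<open>mollify\<close> the integrals of \<open>\<Phi>\<close> and \<open>\<Psi>\<close> are limits of the same
  expression.\<close>

lemma disintegration:
  assumes a: "adm r s \<Phi>"
  shows "(LINT p|N. \<Phi> (fst p) (leaf p)) = (LINT p|N. of_real (bmp (1/2) (fst p) / bmass (1/2)) * fibre r \<Phi> (leaf p))"
proof -
  define c where "c = bmass (1/2)"
  have c: "c > 0" using bmass_pos[of "1/2"] by (simp add: c_def)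
  define \<Psi> where "\<Psi> y \<alpha> = of_real (bmp (1/2) y / c) * fibre r \<Phi> \<alpha>" for y \<alpha>
  have s: "0 \<le> s" "s < 1" using a by (auto simp: adm_def)
  have a': "adm (1/2) s \<Psi>"
  proof -
    have "continuous_on (ball 0 1 \<times> I) (\<lambda>x. of_real (bmp (1/2) (fst x) / c) * fibre r \<Phi> (snd x))"
      using c by (intro continuous_intros continuous_on_compose2[OF cont_bmp[of UNIV]] continuous_on_compose2[OF adm_fibre(1)[OF a]]) auto
    then have "continuous_on (ball 0 1 \<times> I) (\<lambda>(y, \<alpha>). \<Psi> y \<alpha>)" by (simp add: \<Psi>_def case_prod_beta)
    moreover have "\<Psi> y \<alpha> = 0" if "1/2 < cmod y" for y \<alpha> using bmp_eq_0[of "1/2" y] that by (simp add: \<Psi>_def)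
    moreover have "\<Psi> y \<alpha> = 0" if "\<alpha> \<in> I" "s < cmod \<alpha>" for y \<alpha> using adm_fibre(2)[OF a that] by (simp add: \<Psi>_def)
    ultimately show ?thesis using s by (auto simp: adm_def)
  qed
  have fib: "fibre (1/2) \<Psi> \<alpha> = fibre r \<Phi> \<alpha>" for \<alpha>
  proof -
    have "fibre (1/2) \<Psi> \<alpha> = (LINT y|lborel. complex_of_real (bmp (1/2) (0 - y)) * (fibre r \<Phi> \<alpha> / c))"
      unfolding fibre_def[of "1/2"] set_lebesgue_integral_def
      by (intro Bochner_Integration.integral_cong refl)
         (use bmp_eq_0[of "1/2"] in \<open>auto simp: indicator_def \<Psi>_def bmp_even not_le\<close>)
    also have "\<dots> = of_real c * (fibre r \<Phi> \<alpha> / c)"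
      using bmp_integrable[of "1/2" 0] bmass_translate[of "1/2" 0] by (simp add: c_def)
    finally show ?thesis using c by simp
  qed
  let ?X = "LINT p|N. \<Phi> (fst p) (leaf p)" and ?Y = "LINT p|N. \<Psi> (fst p) (leaf p)"
  have "cmod (?X - ?Y) \<le> 0"
  proof (rule field_le_epsilon)
    fix e :: real assume e: "e > 0"
    then have e2: "e / 2 > 0" by simp
    obtain d1 where d1: "d1 > 0" "\<And>\<rho>. 0 < \<rho> \<Longrightarrow> \<rho> < d1 \<Longrightarrow>
      cmod ((LINT p|N. of_real (bmp \<rho> (fst p)) * fibre r \<Phi> (leaf p)) - of_real (bmass \<rho>) * ?X) \<le> e / 2 * bmass \<rho>"
      using mollify[OF a e2] by blast
    obtain d2 where d2: "d2 > 0" "\<And>\<rho>. 0 < \<rho> \<Longrightarrow> \<rho> < d2 \<Longrightarrow>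
      cmod ((LINT p|N. of_real (bmp \<rho> (fst p)) * fibre r \<Phi> (leaf p)) - of_real (bmass \<rho>) * ?Y) \<le> e / 2 * bmass \<rho>"
      using mollify[OF a' e2] unfolding fib by blast
    define \<rho> where "\<rho> = min d1 d2 / 2"
    have \<rho>: "0 < \<rho>" "\<rho> < d1" "\<rho> < d2" using d1(1) d2(1) by (auto simp: \<rho>_def)
    define Z where "Z = (LINT p|N. of_real (bmp \<rho> (fst p)) * fibre r \<Phi> (leaf p))"
    have b: "bmass \<rho> > 0" by (rule bmass_pos[OF \<rho>(1)])
    have "bmass \<rho> * cmod (?X - ?Y) = cmod (of_real (bmass \<rho>) * (?X - ?Y))" using b by (simp add: norm_mult)
    also have "of_real (bmass \<rho>) * (?X - ?Y) = (Z - of_real (bmass \<rho>) * ?Y) - (Z - of_real (bmass \<rho>) * ?X)" by (simp add: algebra_simps)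
    also have "cmod \<dots> \<le> e / 2 * bmass \<rho> + e / 2 * bmass \<rho>"
      unfolding Z_def by (intro order_trans[OF norm_triangle_ineq4] add_mono d1(2) d2(2) \<rho>)
    finally have "bmass \<rho> * cmod (?X - ?Y) \<le> bmass \<rho> * e" by (simp add: mult.commute)
    then show "cmod (?X - ?Y) \<le> 0 + e" using b by simp
  qed
  then show ?thesis by (simp add: \<Psi>_def c_def)
qed

text \<open>If \<open>N\<close> is the product of the area with a measure on the labels, then that measure is
  recovered by projecting \<open>N\<close>, weighted by any function of \<open>z\<close> with integral \<open>1\<close>.\<close>

definition transverse :: "complex measure" where
  "transverse = distr (density N (\<lambda>p. ennreal (bmp (1/2) (fst p) / bmass (1/2)))) (restrict_space borel I) leaf"

lemma transverse_integral:
  assumes a: "adm r s \<Phi>"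
  shows "integrable transverse (fibre r \<Phi>)"
    and "(LINT \<alpha>|transverse. fibre r \<Phi> \<alpha>) = (LINT p|N. \<Phi> (fst p) (leaf p))"
proof -
  let ?w = "\<lambda>p. bmp (1/2) (fst p) / bmass (1/2)"
  have b: "bmass (1/2) > 0" by (rule bmass_pos) simp
  have s: "0 \<le> s" "s < 1" using a by (auto simp: adm_def)
  have wc: "continuous_on K (\<lambda>p. ?w p)"
    using b by (intro continuous_intros continuous_on_compose2[OF cont_bmp[of UNIV]]) auto
  have wm: "?w \<in> borel_measurable N" by (rule N_measurable[OF wc])
  have w0: "0 \<le> ?w p" for p using b bmp_nonneg[of "1/2" "fst p"] by simp
  have lm: "leaf \<in> measurable N (restrict_space borel I)"
    using N_measurable[OF cont_leaf] leafI by (intro measurable_restrict_space2) (auto simp: space_N)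
  then have lm': "leaf \<in> measurable (density N (\<lambda>p. ennreal (?w p))) (restrict_space borel I)" by simp
  have fm: "fibre r \<Phi> \<in> borel_measurable (restrict_space borel I)"
    by (rule borel_measurable_continuous_on_restrict[OF adm_fibre(1)[OF a]])
  have flc: "continuous_on K (\<lambda>p. fibre r \<Phi> (leaf p))"
    by (rule continuous_on_compose2[OF adm_fibre(1)[OF a] cont_leaf]) (use leafI in auto)
  have flm: "(\<lambda>p. fibre r \<Phi> (leaf p)) \<in> borel_measurable N" by (rule N_measurable[OF flc])
  have int: "integrable N (\<lambda>p. ?w p *\<^sub>R fibre r \<Phi> (leaf p))"
  proof (rule N_integrable[where R = "reach (1/2) s"])
    show "continuous_on K (\<lambda>p. ?w p *\<^sub>R fibre r \<Phi> (leaf p))" by (intro continuous_on_scaleR wc flc)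
    show "?w p *\<^sub>R fibre r \<Phi> (leaf p) = 0" if p: "p \<in> K" "p \<notin> box (reach (1/2) s)" for p
    proof -
      have "1/2 < cmod (fst p) \<or> s < cmod (leaf p)" using in_reach[OF p(1), of "1/2" s] p(2) by force
      then show ?thesis using bmp_eq_0[of "1/2" "fst p"] adm_fibre(2)[OF a, of "leaf p"] leafI[OF p(1)] by auto
    qed
    show "reach (1/2) s < 1" by (rule reach_less) (use s in auto)
  qed
  show "integrable transverse (fibre r \<Phi>)"
    unfolding transverse_def integrable_distr_eq[OF lm' fm]
    using int w0 by (subst integrable_density[OF flm wm]) auto
  have "(LINT \<alpha>|transverse. fibre r \<Phi> \<alpha>) = (LINT p|density N (\<lambda>p. ennreal (?w p)). fibre r \<Phi> (leaf p))"
    unfolding transverse_def by (rule integral_distr[OF lm' fm])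
  also have "\<dots> = (LINT p|N. ?w p *\<^sub>R fibre r \<Phi> (leaf p))"
    using w0 by (intro integral_density[OF flm wm]) auto
  also have "\<dots> = (LINT p|N. \<Phi> (fst p) (leaf p))"
    unfolding disintegration[OF a] by (simp add: scaleR_conv_of_real)
  finally show "(LINT \<alpha>|transverse. fibre r \<Phi> \<alpha>) = (LINT p|N. \<Phi> (fst p) (leaf p))" .
qed

text \<open>The pairing of \<open>[V\<^sub>\<alpha>]\<close> with \<open>\<phi>\<close> is the fibre integral of the value of \<open>\<phi>\<close> on the tangent
  vectors of the leaf.\<close>

lemma weakly_directed_imp_directed: "directed K f T"
  unfolding directed_def
proof (intro exI conjI allI impI)
  show "sets transverse = sets (restrict_space borel I)" by (simp add: transverse_def)
next
  fix \<phi> :: form11 assume \<phi>: "test_on bidisc \<phi>"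
  obtain r where r: "0 < r" "r < 1" "\<forall>x. x \<notin> box r \<longrightarrow> \<phi> x = 0" using cc_bidiscE[OF test_on_cc[OF \<phi>]] by blast
  define s where "s = max 0 (rad r r)"
  have s: "0 \<le> s" "s < 1" using rad_less[of r r] r by (auto simp: s_def)
  define \<Phi> where "\<Phi> y \<alpha> = qform (\<phi> (y, f \<alpha> y)) (vector [1, deriv (f \<alpha>) y])" for y \<alpha>
  have q0: "qform 0 v = 0" for v by (simp add: qform_def)
  have z: "\<Phi> y \<alpha> = 0" if "r < cmod y" for y \<alpha> using r(3) that by (simp add: \<Phi>_def q0)
  have a: "adm r s \<Phi>"
  proof -
    have g: "continuous_on (ball 0 1 \<times> I) (\<lambda>x. f (snd x) (fst x))" using cont_graph by (simp add: case_prod_beta)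
    have gr: "continuous_on (ball 0 1 \<times> I) (\<lambda>x. (fst x, f (snd x) (fst x)))" by (intro continuous_intros g)
    have "continuous_on (ball 0 1 \<times> I) (\<lambda>x. slope (fst x, f (snd x) (fst x)))"
      by (rule continuous_on_compose2[OF cont_slope gr]) (auto intro: graph_in_K)
    then have sl: "continuous_on (ball 0 1 \<times> I) (\<lambda>x. deriv (f (snd x)) (fst x))"
      by (rule continuous_on_eq) (auto simp: slope_def leaf_eq)
    have ph: "continuous_on (ball 0 1 \<times> I) (\<lambda>x. \<phi> (fst x, f (snd x) (fst x)))"
      by (rule continuous_on_compose2[OF smooth_continuous[OF test_onD(1)[OF \<phi>], of UNIV] gr]) auto
    have "continuous_on (ball 0 1 \<times> I) (\<lambda>x. \<Phi> (fst x) (snd x))"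
      unfolding \<Phi>_def qform_tangent by (intro continuous_intros ph sl)
    moreover have "\<Phi> y \<alpha> = 0" if "\<alpha> \<in> I" "s < cmod \<alpha>" "cmod y < 1" for y \<alpha>
    proof (cases "r < cmod y")
      case False
      then have "(y, f \<alpha> y) \<notin> box r" using rad_bounds(2)[OF that(1), of y r r] that(2) r by (auto simp: s_def)
      then show ?thesis using r(3) by (simp add: \<Phi>_def q0)
    qed (rule z)
    ultimately show ?thesis using r s z by (auto simp: adm_def case_prod_beta)
  qed
  have gc: "graph_current (f \<alpha>) \<phi> = fibre r \<Phi> \<alpha>" for \<alpha>
    unfolding graph_current_def fibre_def set_lebesgue_integral_def Let_def
    by (intro Bochner_Integration.integral_cong refl)
       (use z r in \<open>auto simp: indicator_def \<Phi>_def qform_def not_le\<close>)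
  show "integrable transverse (\<lambda>\<alpha>. graph_current (f \<alpha>) \<phi>)"
    unfolding gc using transverse_integral(1)[OF a] by simp
  have "T \<phi> = (LINT p|N. qform (\<phi> p) (vector [1, slope p]))"
    using TE_representation(2)[OF test_on_cc[OF \<phi>]] TE_test[OF \<phi>] by simp
  also have "\<dots> = (LINT p|N. \<Phi> (fst p) (leaf p))"
    using leafI by (intro Bochner_Integration.integral_cong refl) (simp add: \<Phi>_def slope_def space_N)
  also have "\<dots> = (LINT \<alpha>|transverse. graph_current (f \<alpha>) \<phi>)"
    unfolding gc using transverse_integral(2)[OF a] by simp
  finally show "T \<phi> = (LINT \<alpha>|transverse. graph_current (f \<alpha>) \<phi>)" .
qed

end

section \<open>Directed currents are weakly directed\<close>

lemma qform_bound:
  assumes "\<And>j k. cmod (A $ j $ k) \<le> c"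
  shows "cmod (qform A v) \<le> 2 * c * ((cmod (v $ 1))\<^sup>2 + (cmod (v $ 2))\<^sup>2)"
proof -
  let ?x = "cmod (v $ 1)" and ?y = "cmod (v $ 2)"
  have t: "cmod (A $ j $ k * (v $ j * cnj (v $ k))) \<le> c * (cmod (v $ j) * cmod (v $ k))" for j k
    using assms[of j k] by (simp add: norm_mult mult_right_mono)
  have c: "0 \<le> c" using assms[of 1 1] norm_ge_zero order_trans by blast
  have "cmod (qform A v) \<le> (\<Sum>j\<in>UNIV. \<Sum>k\<in>UNIV. c * (cmod (v $ j) * cmod (v $ k)))"
    unfolding qform_def by (intro order_trans[OF norm_sum] sum_mono t)
  also have "\<dots> = c * (?x + ?y)\<^sup>2" by (simp add: sum_2 power2_eq_square algebra_simps)
  also have "\<dots> \<le> c * (2 * (?x\<^sup>2 + ?y\<^sup>2))"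
  proof (rule mult_left_mono[OF _ c])
    have "0 \<le> (?x - ?y)\<^sup>2" by simp
    then show "(?x + ?y)\<^sup>2 \<le> 2 * (?x\<^sup>2 + ?y\<^sup>2)" by (simp add: power2_eq_square algebra_simps)
  qed
  finally show ?thesis by (simp add: mult.assoc mult.left_commute)
qed

lemma qform_diff: "qform (A - B) v = qform A v - qform B v"
  by (simp add: qform_def sum_2 algebra_simps)

lemma graph_current_qform:
  "graph_current g \<phi> = (LINT z|lborel. indicator (ball 0 1) z *\<^sub>R qform (\<phi> (z, g z)) (vector [1, deriv g z]))"
  by (simp add: graph_current_def set_lebesgue_integral_def qform_def Let_def)

locale lam_pos = lamination K f + pos_current T for K f T
begin

text \<open>On a leaf, this form restricts to a smooth cutoff of the area.\<close>

definition area_form :: "real \<Rightarrow> form11" where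
  "area_form r p = munit 1 1 (of_real (cut r ((1+r)/2) p)) + munit 2 2 (of_real (cut r ((1+r)/2) p))"

lemma test_on_area_form:
  assumes "0 < r" "r < 1"
  shows "test_on bidisc (area_form r)"
  unfolding area_form_def using test_on_cut[OF assms elem_const[of _ 1]]
  by (auto intro!: test_on_add test_on_munit)

lemma graph_current_bound:
  assumes r: "0 < r" "r < 1" and \<alpha>: "\<alpha> \<in> I" and e: "e \<ge> 0"
    and \<psi>: "\<And>z. cmod z < 1 \<Longrightarrow> cmod (qform (\<psi> (z, f \<alpha> z)) (vector [1, deriv (f \<alpha>) z]))
        \<le> e * cut r ((1+r)/2) (z, f \<alpha> z) * (1 + (cmod (deriv (f \<alpha>) z))\<^sup>2)"
  shows "cmod (graph_current (f \<alpha>) \<psi>) \<le> e * cmod (graph_current (f \<alpha>) (area_form r))"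
proof -
  define s where "s = (1 + r) / 2"
  have s: "0 < s" "s < 1" "r < s" using r by (auto simp: s_def)
  let ?g = "f \<alpha>"
  let ?\<kappa> = "\<lambda>z. cut r s (z, ?g z)"
  define w where "w z = indicator (ball 0 1) z * (?\<kappa> z * (1 + (cmod (deriv ?g z))\<^sup>2))" for z
  have k0: "0 \<le> ?\<kappa> z" for z using cut_range[of r s] r s by auto
  have area: "graph_current ?g (area_form r) = (LINT z|lborel. of_real (w z))"
    unfolding graph_current_qform
  proof (rule Bochner_Integration.integral_cong[OF refl])
    fix z
    have "qform (area_form r (z, ?g z)) (vector [1, deriv ?g z]) = of_real (?\<kappa> z) + deriv ?g z * cnj (deriv ?g z) * of_real (?\<kappa> z)"
      by (simp add: qform_tangent area_form_def munit_def s_def mult_ac)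
    then show "indicator (ball 0 1) z *\<^sub>R qform (area_form r (z, ?g z)) (vector [1, deriv ?g z]) = complex_of_real (w z)"
      by (simp add: w_def indicator_def complex_norm_square[symmetric] algebra_simps)
  qed
  have iw: "integrable lborel w"
  proof -
    have "continuous_on (cball 0 s) (\<lambda>z. ?\<kappa> z * (1 + (cmod (deriv ?g z))\<^sup>2))"
    proof -
      have sub: "cball 0 s \<subseteq> ball (0::complex) 1" using s by auto
      have g: "continuous_on (cball 0 s) ?g" "continuous_on (cball 0 s) (deriv ?g)"
        using holomorphic_on_imp_continuous_on[OF leaf_holo[OF \<alpha>]]
          holomorphic_on_imp_continuous_on[OF holomorphic_deriv[OF leaf_holo[OF \<alpha>] open_ball]]
        by (meson sub continuous_on_subset)+
      have "continuous_on UNIV (\<lambda>p. complex_of_real (cut r s p))"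
        using smooth_continuous[OF elem_imp_smooth[OF elem_cut]] r s by auto
      then have "continuous_on UNIV (\<lambda>p. Re (complex_of_real (cut r s p)))" by (rule continuous_on_Re)
      then have c: "continuous_on UNIV (\<lambda>p. cut r s p)" by (simp only: Re_complex_of_real)
      show ?thesis by (intro continuous_intros g continuous_on_compose2[OF c]) auto
    qed
    then have "integrable lborel (\<lambda>z. indicator (cball 0 s) z *\<^sub>R (?\<kappa> z * (1 + (cmod (deriv ?g z))\<^sup>2)))"
      by (intro borel_integrable_compact compact_cball)
    moreover have "(\<lambda>z. indicator (cball 0 s) z *\<^sub>R (?\<kappa> z * (1 + (cmod (deriv ?g z))\<^sup>2))) = w"
    proof
      fix z
      show "indicator (cball 0 s) z *\<^sub>R (?\<kappa> z * (1 + (cmod (deriv ?g z))\<^sup>2)) = w z"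
      proof (cases "cmod z \<le> s")
        case False
        then have "?\<kappa> z = 0" using s by (intro cut_0) auto
        then show ?thesis by (simp add: w_def)
      qed (use s in \<open>auto simp: w_def indicator_def\<close>)
    qed
    ultimately show ?thesis by simp
  qed
  have w0: "0 \<le> w z" for z using k0 by (simp add: w_def indicator_def)
  have val: "cmod (graph_current ?g (area_form r)) = (LINT z|lborel. w z)"
    unfolding area using w0 by (simp add: integral_nonneg_AE)
  show ?thesis
  proof (cases "integrable lborel (\<lambda>z. indicator (ball 0 1) z *\<^sub>R qform (\<psi> (z, ?g z)) (vector [1, deriv ?g z]))")
    case True
    have "cmod (graph_current ?g \<psi>) \<le> (LINT z|lborel. e * w z)"
      unfolding graph_current_qform
    proof (rule Bochner_Integration.integral_norm_bound_integral[OF True])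
      show "integrable lborel (\<lambda>z. e * w z)" using iw by simp
      show "cmod (indicator (ball 0 1) z *\<^sub>R qform (\<psi> (z, ?g z)) (vector [1, deriv ?g z])) \<le> e * w z" for z
        using \<psi>[of z] by (simp add: w_def indicator_def s_def mult_ac)
    qed
    then show ?thesis using val by simp
  next
    case False
    \<comment> \<open>by convention, the integral of a function that is not integrable is \<open>0\<close>\<close>
    then have "graph_current ?g \<psi> = 0" unfolding graph_current_qform by (rule not_integrable_integral_eq)
    then show ?thesis using e by simp
  qed
qed

text \<open>The form \<open>\<lambda> \<and> b\<close> vanishes on the tangent vectors of the leaves, but it is merely continuous,
  and \<open>T\<close> is given as an integral of leaves only on test forms.  On a leaf the \<open>n\<close>th approximating
  test form is bounded by \<open>2/(n+1)\<close> times the area form, whose pairings with the leaves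
  are integrable because it is a test form too.\<close>

lemma directed_imp_weakly_directed:
  assumes "directed K f T"
  shows "weakly_directed K f T"
  unfolding weakly_directed_def
proof (intro allI impI)
  fix l b :: coform assume l: "continuous_on bidisc l"
    and tang: "\<forall>\<alpha>\<in>I. \<forall>z\<in>ball 0 1. \<exists>c. c \<noteq> 0 \<and> l (z, f \<alpha> z) $ 1 = - c * deriv (f \<alpha>) z \<and> l (z, f \<alpha> z) $ 2 = c"
    and b: "test_on bidisc b"
  obtain \<mu> :: "complex measure" where \<mu>: "sets \<mu> = sets (restrict_space borel I)"
    "\<And>\<phi>. test_on bidisc \<phi> \<Longrightarrow> integrable \<mu> (\<lambda>\<alpha>. graph_current (f \<alpha>) \<phi>) \<and> T \<phi> = (LINT \<alpha>|\<mu>. graph_current (f \<alpha>) \<phi>)"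
    using assms unfolding directed_def by blast
  have spI: "space \<mu> = I" using sets_eq_imp_space_eq[OF \<mu>(1)] by (simp add: space_restrict_space)
  define \<phi> where "\<phi> = wedge l b"
  have tangent: "qform (\<phi> (z, f \<alpha> z)) (vector [1, deriv (f \<alpha>) z]) = 0"
    if \<alpha>: "\<alpha> \<in> I" and z: "cmod z < 1" for \<alpha> z
  proof -
    obtain c where "l (z, f \<alpha> z) $ 1 = - c * deriv (f \<alpha>) z" "l (z, f \<alpha> z) $ 2 = c" 
      using bspec[OF bspec[OF tang \<alpha>], of z] z by auto
    then show ?thesis by (simp add: qform_tangent \<phi>_def wedge_def algebra_simps)
  qed
  have cphi: "cc bidisc \<phi>"
  proof -
    have e: "\<phi> p = (\<Sum>j\<in>UNIV. \<Sum>k\<in>UNIV. munit j k (- 2 * \<i> * (l p $ j * b p $ k)))" for p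
      by (subst mat_decomp) (simp add: \<phi>_def wedge_def)
    have bk: "cc bidisc (\<lambda>p. b p $ k)" for k by (rule cc_linear[OF test_on_cc[OF b] bounded_linear_vec_nth])
    have lj: "continuous_on bidisc (\<lambda>p. l p $ j)" for j by (intro continuous_intros l)
    show ?thesis
      unfolding e[abs_def] by (intro cc_sum cc_munit cc_linear[OF cc_mult_on[OF bk lj open_bidisc] bounded_linear_mult_right])
  qed
  obtain r where r: "0 < r" "r < 1" "\<And>x. x \<notin> box r \<Longrightarrow> \<phi> x = 0" using cc_bidiscE[OF cphi] by blast
  define s where "s = (1 + r) / 2"
  have s: "0 < s" "s < 1" "r \<le> s" using r by (auto simp: s_def)
  obtain \<psi> where \<psi>: "approximates bidisc \<psi> \<phi>" "\<And>n x. x \<notin> box s \<Longrightarrow> \<psi> n x = 0"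
    "\<And>n x. norm (\<psi> n x - \<phi> x) \<le> inverse (real (Suc n))" "\<And>n. test_on bidisc (\<psi> n)"
    using approximates_exists[OF conjunct1[OF cphi[unfolded cc_def]] r] unfolding s_def by blast
  note tA = test_on_area_form[OF s(1,2)]
  define M where "M = (LINT \<alpha>|\<mu>. cmod (graph_current (f \<alpha>) (area_form s)))"
  have bound: "cmod (T (\<psi> n)) \<le> 2 * inverse (real (Suc n)) * M" for n
  proof -
    let ?e = "2 * inverse (real (Suc n))"
    have "cmod (graph_current (f \<alpha>) (\<psi> n)) \<le> ?e * cmod (graph_current (f \<alpha>) (area_form s))" if \<alpha>: "\<alpha> \<in> I" for \<alpha>
    proof (rule graph_current_bound[OF s(1,2) \<alpha>])
      fix z assume z: "cmod z < 1"
      let ?p = "(z, f \<alpha> z)" and ?v = "vector [1, deriv (f \<alpha>) z] :: complex^2"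
      show "cmod (qform (\<psi> n ?p) ?v) \<le> ?e * cut s ((1+s)/2) ?p * (1 + (cmod (deriv (f \<alpha>) z))\<^sup>2)"
      proof (cases "?p \<in> box s")
        case True
        have "cmod (qform (\<psi> n ?p) ?v) = cmod (qform (\<psi> n ?p - \<phi> ?p) ?v)"
          unfolding qform_diff tangent[OF \<alpha> z] by simp
        also have "\<dots> \<le> 2 * inverse (real (Suc n)) * ((cmod (?v $ 1))\<^sup>2 + (cmod (?v $ 2))\<^sup>2)"
          by (rule qform_bound[OF order_trans[OF entry_le_norm \<psi>(3)]])
        finally show ?thesis using cut_1[of s "(1+s)/2" ?p] True s by simp
      next
        case False
        have "0 \<le> cut s ((1+s)/2) ?p" using cut_range[of s "(1+s)/2" ?p] s by simp
        then show ?thesis using \<psi>(2)[OF False] by (simp add: qform_def)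
      qed
    qed simp
    moreover have "T (\<psi> n) = (LINT \<alpha>|\<mu>. graph_current (f \<alpha>) (\<psi> n))" using \<mu>(2)[OF \<psi>(4)] by blast
    moreover have "integrable \<mu> (\<lambda>\<alpha>. graph_current (f \<alpha>) (\<psi> n))" using \<mu>(2)[OF \<psi>(4)] by blast
    moreover have "integrable \<mu> (\<lambda>\<alpha>. ?e * cmod (graph_current (f \<alpha>) (area_form s)))" using \<mu>(2)[OF tA] by simp
    ultimately have "cmod (T (\<psi> n)) \<le> (LINT \<alpha>|\<mu>. ?e * cmod (graph_current (f \<alpha>) (area_form s)))"
      using spI by (simp only:) (rule Bochner_Integration.integral_norm_bound_integral; simp)
    then show ?thesis by (simp add: M_def)
  qed
  have "(\<lambda>n. 2 * inverse (real (Suc n)) * M) \<longlonglongrightarrow> 2 * 0 * M" by (intro tendsto_intros LIMSEQ_inverse_real_of_nat)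
  then have "(\<lambda>n. 2 * inverse (real (Suc n)) * M) \<longlonglongrightarrow> 0" by simp
  then have "(\<lambda>n. T (\<psi> n)) \<longlonglongrightarrow> 0" by (rule Lim_null_comparison[rotated]) (use bound in auto)
  then have "TE \<phi> = 0" using cont_ext_lim[OF \<psi>(1)] LIMSEQ_unique by blast
  then show "wedge_current bidisc l T b = 0" by (simp add: wedge_current_def \<phi>_def)
qed

end

theorem mainTheorem1:
  fixes K :: "(complex \<times> complex) set"
    and f :: "complex \<Rightarrow> complex \<Rightarrow> complex"
    and T :: current11
  assumes "closedin (top_of_set bidisc) K"
    and "laminated_by K f"
    and "positive_current bidisc T"
    and "closed_current bidisc T"
    and "supported_on bidisc T K"
    and "\<exists>W S. open W \<and> closure bidisc \<subseteq> W \<and> positive_current W S \<and> closed_current W S \<and>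
               equal_on bidisc T S"
  shows "directed K f T \<longleftrightarrow> weakly_directed K f T"
proof
  interpret lam_pos K f T using assms by unfold_locales auto
  show "directed K f T \<Longrightarrow> weakly_directed K f T" by (rule directed_imp_weakly_directed)
next
  assume "weakly_directed K f T"
  then interpret closed_wd_current K f T using assms by unfold_locales auto
  show "directed K f T" by (rule weakly_directed_imp_directed)
qed

end
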